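(* Let $U,V$ be real Banach spaces and let $\mathfrak{F}\in\mathcal{C}^{\omega}(\mathbb{R}\times U,V)$ be an analytic map such that: (F1) $\mathfrak{F}(\lambda,0)=0$ for all $\lambda\in\mathbb{R}$; (F2) $D_u\mathfrak{F}(\lambda,u)$ is a Fredholm operator of index zero from $U$ to $V$ for all $(\lambda,u)\in\mathbb{R}\times U$; (F3) $\dim N[D_u\mathfrak{F}(\lambda,u)]\in\{0,1\}$ for all $(\lambda,u)\in\mathbb{R}\times U$. Then $\mathfrak{F}^{-1}(0)$ is an analytic graph of $\mathbb{R}\times U$.
   Context: A closed subset $\mathscr{A}\neq\emptyset$ of $\mathbb{R}\times U$ is an analytic graph if, for every $(\lambda,u)\in\mathscr{A}$, one of the following mutually excluding options occurs ($B_\varepsilon(\lambda,u)$ is the ball of radius $\varepsilon$ centred at $(\lambda,u)$): (a) (edge point) There exists $\varepsilon>0$ such that $B_\varepsilon(\lambda,u)\cap\mathscr{A}$ is the graph of an injective analytic curve $\gamma:(-\delta,\delta)\to\mathbb{R}\times U$ with $\gamma(0)=(\lambda,u)$, i.e. $B_\varepsilon(\lambda,u)\cap\mathscr{A}=\gamma((-\delta,\delta))$. (b) (vertex, or nodal point) Option (a) does not occur and there exists $\varepsilon>0$ such that either $B_\varepsilon(\lambda,u)\cap\mathscr{A}=\{(\lambda,u)\}$, or there are $N\geq1$ analytic injective curves $\gamma_i:(0,1)\to\mathbb{R}\times U$, $(\lambda,u)\notin\gamma_i((0,1))$, $\gamma_i(t)\to(\lambda,u)$ as $t\uparrow1$,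 $i\in\{1,\dots,N\}$, such that $B_\varepsilon(\lambda,u)\cap\mathscr{A}=\bigcup_{i=1}^N\gamma_i((0,1))\cup\{(\lambda,u)\}$. (c) (residual point) There exist $\varepsilon>0$, an open subset $\Omega\subset\mathbb{R}^2$ and an analytic homeomorphism $\Psi:\Omega\to B_\varepsilon(\lambda,u)\cap\mathscr{A}$. *)

theory Defs
  imports "HOL-Analysis.Analysis"
begin

text \<open>A \<open>k\<close>-linear map is encoded as a function on sequences that depends only on the first
  \<open>k\<close> entries. In the power series below, the bound on \<open>r ^ k * norm (m k x)\<close> says that
  \<open>r\<^sup>k \<parallel>m\<^sub>k\<parallel>\<close> is bounded in \<open>k\<close>; in particular every \<open>m\<^sub>k\<close> is continuous.\<close>

definition symmetric_multilinear ::
    "nat \<Rightarrow> ((nat \<Rightarrow> 'a::real_vector) \<Rightarrow> 'b::real_vector) \<Rightarrow> bool" where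
  "symmetric_multilinear k m \<longleftrightarrow>
     (\<forall>x y. (\<forall>i<k. x i = y i) \<longrightarrow> m x = m y) \<and>
     (\<forall>i<k. \<forall>x. linear (\<lambda>a. m (x(i := a)))) \<and>
     (\<forall>p x. p permutes {..<k} \<longrightarrow> m (x \<circ> p) = m x)"

definition analytic_map_at ::
    "('a::real_normed_vector \<Rightarrow> 'b::real_normed_vector) \<Rightarrow> 'a \<Rightarrow> bool" where
  "analytic_map_at f x0 \<longleftrightarrow>
     (\<exists>m \<epsilon> r M. \<epsilon> > 0 \<and> r > 0 \<and>
        (\<forall>k. symmetric_multilinear k (m k)) \<and>
        (\<forall>k x. r ^ k * norm (m k x) \<le> M * (\<Prod>i<k. norm (x i))) \<and>
        (\<forall>x \<in> ball x0 \<epsilon>. (\<lambda>k. m k (\<lambda>_. x - x0)) sums f x))"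

text \<open>Intended for open sets \<open>S\<close>.\<close>

definition analytic_map_on ::
    "('a::real_normed_vector \<Rightarrow> 'b::real_normed_vector) \<Rightarrow> 'a set \<Rightarrow> bool" where
  "analytic_map_on f S \<longleftrightarrow> (\<forall>x\<in>S. analytic_map_at f x)"

definition finite_dim :: "'a::real_vector set \<Rightarrow> bool" where
  "finite_dim S \<longleftrightarrow> (\<exists>B. finite B \<and> S \<subseteq> span B)"

definition linear_complement :: "'a::real_vector set \<Rightarrow> 'a set \<Rightarrow> bool" where
  "linear_complement W C \<longleftrightarrow>
     subspace C \<and> W \<inter> C = {0} \<and> (\<forall>v. \<exists>w\<in>W. \<exists>c\<in>C. v = w + c)"

text \<open>Any two complements of a subspace \<open>W\<close> are isomorphic to the quotient by \<open>W\<close>, so the choice is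
  immaterial. As \<open>dim\<close> is \<open>0\<close> on infinite-dimensional spaces, \<open>codim\<close> is only meaningful when the
  complements are finite-dimensional.\<close>

definition codim :: "'a::real_vector set \<Rightarrow> nat" where
  "codim W = dim (SOME C. linear_complement W C)"

definition null_space :: "('a::real_vector \<Rightarrow> 'b::real_vector) \<Rightarrow> 'a set" where
  "null_space T = {x. T x = 0}"

definition fredholm :: "('a::real_normed_vector \<Rightarrow> 'b::real_normed_vector) \<Rightarrow> bool" where
  "fredholm T \<longleftrightarrow>
     bounded_linear T \<and> finite_dim (null_space T) \<and> closed (range T) \<and>
     (\<exists>C. linear_complement (range T) C \<and> finite_dim C)"

definition fredholm_index :: "('a::real_normed_vector \<Rightarrow> 'b::real_normed_vector) \<Rightarrow> int" where
  "fredholm_index T = int (dim (null_space T)) - int (codim (range T))"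

definition D_u :: "(real \<times> 'u::real_normed_vector \<Rightarrow> 'v::real_normed_vector)
    \<Rightarrow> real \<Rightarrow> 'u \<Rightarrow> 'u \<Rightarrow> 'v" where
  "D_u F l u = frechet_derivative (\<lambda>w. F (l, w)) (at u)"

definition edge_point :: "(real \<times> 'u::real_normed_vector) set \<Rightarrow> real \<times> 'u \<Rightarrow> bool" where
  "edge_point A p \<longleftrightarrow>
     (\<exists>\<epsilon>>0. \<exists>\<delta>>0. \<exists>\<gamma>.
        analytic_map_on \<gamma> {-\<delta><..<\<delta>} \<and> inj_on \<gamma> {-\<delta><..<\<delta>} \<and> \<gamma> (0::real) = p \<and>
        ball p \<epsilon> \<inter> A = \<gamma> ` {-\<delta><..<\<delta>})"

definition vertex_point :: "(real \<times> 'u::real_normed_vector) set \<Rightarrow> real \<times> 'u \<Rightarrow> bool" where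
  "vertex_point A p \<longleftrightarrow>
     \<not> edge_point A p \<and>
     (\<exists>\<epsilon>>0. ball p \<epsilon> \<inter> A = {p} \<or>
        (\<exists>N\<ge>1. \<exists>\<gamma> :: nat \<Rightarrow> real \<Rightarrow> real \<times> 'u.
           (\<forall>i\<in>{1..N}. analytic_map_on (\<gamma> i) {0<..<1} \<and> inj_on (\<gamma> i) {0<..<1} \<and>
              p \<notin> \<gamma> i ` {0<..<1} \<and> (\<gamma> i \<longlongrightarrow> p) (at_left 1)) \<and>
           ball p \<epsilon> \<inter> A = (\<Union>i\<in>{1..N}. \<gamma> i ` {0<..<1}) \<union> {p}))"

definition residual_point :: "(real \<times> 'u::real_normed_vector) set \<Rightarrow> real \<times> 'u \<Rightarrow> bool" where
  "residual_point A p \<longleftrightarrow>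
     (\<exists>\<epsilon>>0. \<exists>\<Omega> :: (real \<times> real) set. \<exists>\<Psi> \<Phi>.
        open \<Omega> \<and> analytic_map_on \<Psi> \<Omega> \<and> homeomorphism \<Omega> (ball p \<epsilon> \<inter> A) \<Psi> \<Phi>)"

definition analytic_graph :: "(real \<times> 'u::real_normed_vector) set \<Rightarrow> bool" where
  "analytic_graph A \<longleftrightarrow>
     closed A \<and> A \<noteq> {} \<and>
     (\<forall>p\<in>A. (edge_point A p \<or> vertex_point A p \<or> residual_point A p) \<and>
        \<not> (edge_point A p \<and> vertex_point A p) \<and>
        \<not> (edge_point A p \<and> residual_point A p) \<and>
        \<not> (vertex_point A p \<and> residual_point A p))"

end

theory Submission
  imports Defs
begin

text \<open>
  At a zero \<open>(\<lambda>\<^sub>0, u\<^sub>0)\<close> put \<open>L = D\<^sub>u F(\<lambda>\<^sub>0, u\<^sub>0)\<close>. Since \<open>L\<close> has index zero and a kernel of dimension at most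
  one, some rank-one perturbation \<open>L + l(\<sqdot>) \<psi>\<close> is invertible. Hence \<open>F(\<lambda>\<^sub>0 + x, u\<^sub>0 + w) + l(w) \<psi> = y \<psi>\<close> has a
  unique small solution \<open>w(x, y)\<close>, and near the point the zeros of \<open>F\<close> correspond to the zeros of the scalar
  function \<open>f(x, y) = y - l(w(x, y))\<close>. The solution is found by iterating a contraction for the norm that
  sums the weighted norms of the coefficients, which makes it analytic at once.

  If \<open>f\<close> vanishes near the origin, \<open>(x, y) \<mapsto> (\<lambda>\<^sub>0 + x, u\<^sub>0 + w(x, y))\<close> is a chart and the point is residual.
  Otherwise the zeros of \<open>f\<close> form finitely many half-branches with analytic parametrisations, by Puiseux's
  theorem: induct on the order of \<open>f(0, y)\<close>, remove the subleading coefficient by a shift of \<open>y\<close> and rescale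
  along an edge of the Newton polygon. Along each half-branch the distance to the point increases strictly,
  so small balls cut it in a single arc.

  Residual points are neither edges nor vertices, since a plane open set is not a countable union of arcs.
\<close>

section \<open>Analytic maps and residual points\<close>

text \<open>The reduced function \<open>f\<close> is handled over the reals only, and three
  obstacles shape this. The restriction \<open>f (0, y)\<close> may vanish identically, so the plane
  is first sheared along a line on which \<open>f\<close> does not vanish identically. Fractional
  powers of \<open>x\<close> need a sign, so branches are followed for \<open>x > 0\<close> and a
  reflection supplies the others. Non-real roots of the edge polynomial contribute no real zeros:
  only its real roots are pursued, and a root bound together with compactness shows that no zero is
  missed. The shift of \<open>y\<close> is what makes the induction terminate: with the subleading
  term gone, a root of full multiplicity could only be 0, and the choice of the edge excludes that.
  The weighted coefficient norm is submultiplicative, so products, substitutions and the terms of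
  the expansion of \<open>F\<close> are all estimated by the triangle inequality, without complex
  variables or Cauchy estimates.\<close>

lemma multilinear_term_bound:
  assumes "r > 0" "\<forall>k x. r ^ k * norm (m k x) \<le> M * (\<Prod>i<k. norm (x i))"
  shows "norm (m k (\<lambda>_. h)) \<le> M * (norm h / r) ^ k"
proof -
  have "r ^ k * norm (m k (\<lambda>_. h)) \<le> M * (norm h) ^ k"
    using assms(2)[rule_format, of k "\<lambda>_. h"] by simp
  then show ?thesis
    using assms(1) by (simp add: field_simps power_divide)
qed

text \<open>Beyond degree one the series is dominated by a geometric series, so the remainder is of
  order \<open>norm h ^ 2\<close>. This yields continuity of analytic maps and identifies
  \<open>D_u F\<close> with the first-order term of the expansion of \<open>F\<close>.\<close>

lemma power_series_has_derivative:
  fixes f :: "'a::real_normed_vector \<Rightarrow> 'b::real_normed_vector"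
  assumes "\<epsilon> > 0" "r > 0"
    and sm: "\<forall>k. symmetric_multilinear k (m k)"
    and bd: "\<forall>k x. r ^ k * norm (m k x) \<le> M * (\<Prod>i<k. norm (x i))"
    and sums: "\<forall>x \<in> ball x0 \<epsilon>. (\<lambda>k. m k (\<lambda>_. x - x0)) sums f x"
  shows "(f has_derivative (\<lambda>h. m 1 (\<lambda>_. h))) (at x0)" and "f x0 = m 0 (\<lambda>_. 0)"
proof -
  have tb: "norm (m k (\<lambda>_. h)) \<le> M * (norm h / r) ^ k" for k h
    by (rule multilinear_term_bound[OF assms(2) bd])
  have M: "M \<ge> 0" using tb[of 0 0] norm_ge_zero[of "m 0 (\<lambda>_. 0)"] by (simp del: norm_ge_zero)
  have indep: "m k x = m k y" if "\<forall>i<k. x i = y i" for k x y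
    using sm that unfolding symmetric_multilinear_def by blast
  have "(\<lambda>k. m k (\<lambda>_. 0)) sums f x0"
    using sums[rule_format, of x0] \<open>\<epsilon> > 0\<close> by simp
  moreover have "(\<lambda>k. m k (\<lambda>_. 0)) sums (\<Sum>k\<in>{0}. m k (\<lambda>_. 0))"
  proof (rule sums_finite)
    fix k :: nat assume "k \<notin> {0}"
    then show "m k (\<lambda>_. 0) = 0" using tb[of k 0] by (simp add: power_0_left)
  qed simp
  then have "(\<lambda>k. m k (\<lambda>_. 0)) sums m 0 (\<lambda>_. 0)" by simp
  ultimately show f0: "f x0 = m 0 (\<lambda>_. 0)" by (rule sums_unique2)
  have lin1: "linear (\<lambda>h. m 1 (\<lambda>_. h))"
  proof -
    have "linear (\<lambda>a. m 1 ((\<lambda>_. 0)(0 := a)))"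
      using sm unfolding symmetric_multilinear_def by (metis One_nat_def zero_less_Suc)
    moreover have "m 1 ((\<lambda>_. 0)(0 := a)) = m 1 (\<lambda>_. a)" for a
      by (rule indep) simp
    ultimately show ?thesis by simp
  qed
  have bl: "bounded_linear (\<lambda>h. m 1 (\<lambda>_. h))"
  proof (rule bounded_linear_intro[where K = "M / r"])
    fix x y c
    show "m 1 (\<lambda>_. x + y) = m 1 (\<lambda>_. x) + m 1 (\<lambda>_. y)" using linear_add[OF lin1] .
    show "m 1 (\<lambda>_. c *\<^sub>R x) = c *\<^sub>R m 1 (\<lambda>_. x)" using linear_scale[OF lin1] .
    show "norm (m 1 (\<lambda>_. x)) \<le> norm x * (M / r)"
      using tb[of 1 x] by (simp add: field_simps)
  qed
  have est: "norm (f (x0 + h) - f x0 - m 1 (\<lambda>_. h)) \<le> (2 * M / r^2) * norm h ^ 2"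
    if h: "norm h < \<epsilon>" "norm h < r / 2" for h
  proof -
    have s: "(\<lambda>k. m k (\<lambda>_. h)) sums f (x0 + h)"
      using sums[rule_format, of "x0 + h"] h by (simp add: dist_norm)
    have m0: "m 0 (\<lambda>_. h) = f x0" unfolding f0 by (rule indep) simp
    have "(\<Sum>k<2. m k (\<lambda>_. h)) = f x0 + m 1 (\<lambda>_. h)"
      by (simp add: numeral_2_eq_2 m0)
    then have s2: "(\<lambda>k. m (k+2) (\<lambda>_. h)) sums (f (x0 + h) - f x0 - m 1 (\<lambda>_. h))"
      using sums_split_initial_segment[OF s, of 2] by (simp only: diff_diff_eq)
    \<comment> \<open>\<open>norm h < r / 2\<close> keeps the ratio below 1/2, so the geometric
      factor \<open>1 / (1 - q)\<close> is at most 2; this is the 2 in the constant.\<close>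
    define q where "q = norm h / r"
    have q: "q < 1/2" "q \<ge> 0" using h \<open>r > 0\<close> by (simp_all add: q_def divide_less_eq)
    have tq: "norm (m k (\<lambda>_. h)) \<le> M * q ^ k" for k unfolding q_def by (rule tb)
    have g: "(\<lambda>k. M * q^2 * q ^ k) sums (M * q^2 * (1 / (1 - q)))"
      by (rule sums_mult, rule geometric_sums) (use q in simp)
    have ps: "norm (\<Sum>k<n. m (k+2) (\<lambda>_. h)) \<le> M * q^2 * (1 / (1 - q))" for n
    proof -
      have "norm (\<Sum>k<n. m (k+2) (\<lambda>_. h)) \<le> (\<Sum>k<n. M * q^2 * q ^ k)"
      proof (intro order.trans[OF norm_sum] sum_mono)
        fix k
        show "norm (m (k+2) (\<lambda>_. h)) \<le> M * q^2 * q ^ k"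
          using tq[of "k + 2"] unfolding power_add by (simp only: mult_ac)
      qed
      also have "\<dots> \<le> M * q^2 * (1 / (1 - q))"
        unfolding sums_unique[OF g] by (rule sum_le_suminf[OF sums_summable[OF g]]) (use M q in simp_all)
      finally show ?thesis .
    qed
    have "norm (f (x0 + h) - f x0 - m 1 (\<lambda>_. h)) \<le> M * q^2 * (1 / (1 - q))"
      by (rule LIMSEQ_le_const2[OF tendsto_norm[OF s2[unfolded sums_def]]]) (use ps in blast)
    also have "\<dots> \<le> M * q^2 * 2"
    proof (rule mult_left_mono)
      show "1 / (1 - q) \<le> 2" using q by (simp add: divide_le_eq)
      show "0 \<le> M * q^2" using M by simp
    qed
    finally show ?thesis unfolding q_def power_divide by (simp only: mult_ac times_divide_eq_right times_divide_eq_left)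
  qed
  show "(f has_derivative (\<lambda>h. m 1 (\<lambda>_. h))) (at x0)"
    unfolding has_derivative_at_within
  proof (intro conjI bl)
    define C where "C = 2 * M / r^2"
    have C: "C \<ge> 0" unfolding C_def using M by simp
    have "\<forall>\<^sub>F y in at x0. norm (((f y - f x0) - m 1 (\<lambda>_. y - x0)) /\<^sub>R norm (y - x0)) \<le> C * norm (y - x0)"
      unfolding eventually_at
    proof (intro exI[of _ "min \<epsilon> (r/2)"] conjI ballI impI)
      fix y assume y: "y \<noteq> x0 \<and> dist y x0 < min \<epsilon> (r / 2)"
      then have "norm (f y - f x0 - m 1 (\<lambda>_. y - x0)) \<le> C * norm (y - x0) ^ 2"
        using est[of "y - x0"] by (simp add: dist_norm C_def)
      then show "norm (((f y - f x0) - m 1 (\<lambda>_. y - x0)) /\<^sub>R norm (y - x0)) \<le> C * norm (y - x0)"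
        using y by (simp add: divide_simps power2_eq_square mult_ac)
    qed (use \<open>\<epsilon> > 0\<close> \<open>r > 0\<close> in auto)
    moreover have "((\<lambda>y. C * norm (y - x0)) \<longlongrightarrow> 0) (at x0)"
      by (rule tendsto_mult_right_zero, rule tendsto_norm_zero, rule LIM_zero, rule tendsto_ident_at)
    ultimately show "((\<lambda>y. ((f y - f x0) - m 1 (\<lambda>_. y - x0)) /\<^sub>R norm (y - x0)) \<longlongrightarrow> 0) (at x0)"
      by (rule Lim_null_comparison)
  qed
qed

lemma analytic_map_atE:
  assumes "analytic_map_at f x0"
  obtains m \<epsilon> r M where "\<epsilon> > 0" "r > 0" "\<forall>k. symmetric_multilinear k (m k)"
    "\<forall>k x. r ^ k * norm (m k x) \<le> M * (\<Prod>i<k. norm (x i))"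
    "\<forall>x \<in> ball x0 \<epsilon>. (\<lambda>k. m k (\<lambda>_. x - x0)) sums f x"
  using assms unfolding analytic_map_at_def by (elim exE conjE) (rule that)

lemma analytic_map_at_imp_isCont:
  assumes "analytic_map_at f x"
  shows "isCont f x"
proof -
  from assms obtain m \<epsilon> r M where "\<epsilon> > 0" "r > 0" "\<forall>k. symmetric_multilinear k (m k)"
    "\<forall>k x. r ^ k * norm (m k x) \<le> M * (\<Prod>i<k. norm (x i))"
    "\<forall>y \<in> ball x \<epsilon>. (\<lambda>k. m k (\<lambda>_. y - x)) sums f y"
    by (rule analytic_map_atE)
  from power_series_has_derivative(1)[OF this] show ?thesis
    by (rule has_derivative_continuous)
qed

lemma analytic_map_on_imp_continuous_on:
  assumes "analytic_map_on f S"
  shows "continuous_on S f"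
  using assms analytic_map_at_imp_isCont unfolding analytic_map_on_def
  by (metis continuous_at_imp_continuous_on)

section \<open>Arcs and Baire's theorem\<close>

definition simple_arc_image :: "'a::topological_space set \<Rightarrow> bool" where
  "simple_arc_image K \<longleftrightarrow>
     (\<exists>J (g :: real \<Rightarrow> 'a). compact J \<and> continuous_on J g \<and> inj_on g J \<and> K = g ` J)"

text \<open>Baire's theorem read backwards: if no member had interior points, neither would the
  union. Used for the arcs and again for the bounded inverse theorem.\<close>

lemma Baire_closed_interior:
  fixes \<T> :: "'a::complete_space set set"
  assumes "countable \<T>" "\<And>T. T \<in> \<T> \<Longrightarrow> closed T" "interior (\<Union>\<T>) \<noteq> {}"
  obtains T where "T \<in> \<T>" "interior T \<noteq> {}"
proof (rule ccontr)
  assume "\<not> thesis"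
  then have "interior T = {}" if "T \<in> \<T>" for T using that \<open>\<And>T. T \<in> \<T> \<Longrightarrow> interior T \<noteq> {} \<Longrightarrow> thesis\<close> by blast
  then have "euclidean interior_of \<Union>\<T> = {}"
    using assms by (intro Baire_category_alt disjI1 completely_metrizable_space_euclidean) auto
  then show False using assms(3) by simp
qed

text \<open>By Baire's theorem one of the arcs would contain the image of a disc, against invariance of
  dimension.\<close>

lemma residual_point_not_countable_arcs:
  assumes res: "residual_point A p" and p: "p \<in> A" and "\<epsilon> > 0" "countable \<K>"
    and cover: "ball p \<epsilon> \<inter> A \<subseteq> \<Union>\<K>" and arc: "\<And>K. K \<in> \<K> \<Longrightarrow> simple_arc_image K"
  shows False
proof -
  obtain e \<Omega> \<Psi> \<Phi> where e: "e > 0" "open (\<Omega> :: (real \<times> real) set)" "analytic_map_on \<Psi> \<Omega>"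
    and hom: "homeomorphism \<Omega> (ball p e \<inter> A) \<Psi> \<Phi>"
    using res unfolding residual_point_def by (elim exE conjE) (rule that)
  have cont: "continuous_on \<Omega> \<Psi>" by (rule homeomorphism_cont1[OF hom])
  define \<Omega>' where "\<Omega>' = \<Omega> \<inter> \<Psi> -` ball p \<epsilon>"
  have "open \<Omega>'" unfolding \<Omega>'_def by (rule continuous_open_preimage[OF cont e(2)]) simp
  moreover have "\<Phi> p \<in> \<Omega>'"
  proof -
    have "p \<in> ball p e \<inter> A" using p e by simp
    then have "\<Phi> p \<in> \<Omega>" "\<Psi> (\<Phi> p) = p"
      using homeomorphism_image2[OF hom] homeomorphism_apply2[OF hom] by (blast, blast)
    then show ?thesis unfolding \<Omega>'_def using \<open>\<epsilon> > 0\<close> by simp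
  qed
  ultimately obtain d where d: "d > 0" "cball (\<Phi> p) d \<subseteq> \<Omega>'"
    using open_contains_cball by blast
  let ?B = "cball (\<Phi> p) d"
  have contB: "continuous_on ?B \<Psi>" and injB: "inj_on \<Psi> ?B"
  proof -
    have B: "?B \<subseteq> \<Omega>" using d unfolding \<Omega>'_def by blast
    then show "continuous_on ?B \<Psi>" by (rule continuous_on_subset[OF cont])
    show "inj_on \<Psi> ?B"
      using B homeomorphism_apply1[OF hom] by (intro inj_on_inverseI[of _ \<Phi>]) auto
  qed
  \<comment> \<open>Baire is applied in the parameter plane: the preimages of the arcs are closed
    and cover the disc.\<close>
  define \<T> where "\<T> = (\<lambda>K. ?B \<inter> \<Psi> -` K) ` \<K>"
  have cl: "closed T" if "T \<in> \<T>" for T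
  proof -
    from that obtain K where K: "K \<in> \<K>" "T = ?B \<inter> \<Psi> -` K" unfolding \<T>_def by blast
    have "closed K"
      using arc[OF K(1)] unfolding simple_arc_image_def
      by (elim exE conjE) (simp add: compact_imp_closed compact_continuous_image)
    then show ?thesis unfolding K(2)
      by (intro continuous_closed_preimage[OF contB]) auto
  qed
  have "?B \<subseteq> \<Union>\<T>"
  proof
    fix z assume z: "z \<in> ?B"
    then have "\<Psi> z \<in> ball p \<epsilon> \<inter> A"
      using d(2) homeomorphism_image1[OF hom] unfolding \<Omega>'_def by blast
    then show "z \<in> \<Union>\<T>" using cover z unfolding \<T>_def by blast
  qed
  then have int: "interior (\<Union>\<T>) \<noteq> {}"
    using interior_mono[of ?B "\<Union>\<T>"] d by (auto simp: interior_cball)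
  have "countable \<T>" using \<open>countable \<K>\<close> \<T>_def by simp
  from Baire_closed_interior[OF this cl int] obtain T where T: "T \<in> \<T>" "interior T \<noteq> {}" .
  from T(1) obtain K where K: "K \<in> \<K>" "T = ?B \<inter> \<Psi> -` K" unfolding \<T>_def by blast
  obtain J and g :: "real \<Rightarrow> real \<times> 'a"
    where J: "compact J" "continuous_on J g" "inj_on g J" "K = g ` J"
    using arc[OF K(1)] unfolding simple_arc_image_def by (elim exE conjE) (rule that)
  \<comment> \<open>Compactness of \<open>J\<close> makes the inverse of \<open>g\<close>
    continuous, so \<open>h \<circ> \<Psi>\<close> embeds a nonempty open subset of the plane into
    the line.\<close>
  obtain h where h: "homeomorphism J K g h"
    using homeomorphism_compact[OF J(1,2) _ J(3)] J(4) by metis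
  have sub: "interior T \<subseteq> ?B" "\<Psi> ` interior T \<subseteq> K"
    using interior_subset[of T] K by auto
  have "continuous_on (interior T) (h \<circ> \<Psi>)"
    by (intro continuous_on_compose continuous_on_subset[OF contB sub(1)]
        continuous_on_subset[OF homeomorphism_cont2[OF h] sub(2)])
  moreover have "inj_on (h \<circ> \<Psi>) (interior T)"
  proof (rule comp_inj_on)
    show "inj_on \<Psi> (interior T)" by (rule inj_on_subset[OF injB sub(1)])
    show "inj_on h (\<Psi> ` interior T)"
      using homeomorphism_apply2[OF h] sub(2) by (intro inj_on_inverseI[of _ g]) auto
  qed
  ultimately have "DIM(real \<times> real) \<le> DIM(real)"
    using invariance_of_dimension[of "interior T" "h \<circ> \<Psi>"] T(2) by blast
  then show False by simp
qed

lemma open_interval_countable_compact: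
  fixes a b :: real
  shows "\<exists>\<J>. countable \<J> \<and> \<Union>\<J> = {a<..<b} \<and> (\<forall>J\<in>\<J>. compact J)"
proof -
  define J where "J n = {a + 1 / real (Suc n) .. b - 1 / real (Suc n)}" for n
  have "{a<..<b} \<subseteq> (\<Union>n. J n)"
  proof
    fix x assume x: "x \<in> {a<..<b}"
    then have "min (x - a) (b - x) > 0" by simp
    then obtain n where n: "1 / real (Suc n) < min (x - a) (b - x)"
      by (rule nat_approx_posE)
    then have "x \<in> J n"
      unfolding J_def atLeastAtMost_iff min_less_iff_conj by linarith
    then show "x \<in> (\<Union>n. J n)" by blast
  qed
  moreover have "J n \<subseteq> {a<..<b}" for n
  proof
    fix x assume "x \<in> J n"
    moreover have "1 / real (Suc n) > 0" by simp
    ultimately show "x \<in> {a<..<b}" unfolding J_def atLeastAtMost_iff greaterThanLessThan_iff by linarith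
  qed
  ultimately have "\<Union>(range J) = {a<..<b}" by blast
  moreover have "\<forall>K\<in>range J. compact K" by (simp add: J_def)
  ultimately show ?thesis by (intro exI[of _ "range J"]) simp
qed

text \<open>The open interval is exhausted by compact pieces, because on all of it an injective
  continuous curve need not be a homeomorphism onto its image.\<close>

lemma analytic_curve_countable_arcs:
  fixes \<gamma> :: "real \<Rightarrow> 'a::real_normed_vector"
  assumes "analytic_map_on \<gamma> {a<..<b}" "inj_on \<gamma> {a<..<b}"
  shows "\<exists>\<K>. countable \<K> \<and> \<gamma> ` {a<..<b} \<subseteq> \<Union>\<K> \<and> (\<forall>K\<in>\<K>. simple_arc_image K)"
proof -
  obtain \<J> where J: "countable \<J>" "\<Union>\<J> = {a<..<b}" "\<forall>J\<in>\<J>. compact J"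
    using open_interval_countable_compact[of a b] by (elim exE conjE) (rule that)
  have "simple_arc_image (\<gamma> ` J)" if "J \<in> \<J>" for J
  proof -
    have "J \<subseteq> {a<..<b}" using J(2) that by blast
    then have "continuous_on J \<gamma>" "inj_on \<gamma> J"
      using assms(2) analytic_map_on_imp_continuous_on[OF assms(1)]
      by (auto elim: continuous_on_subset inj_on_subset)
    then show ?thesis unfolding simple_arc_image_def using J(3) that by blast
  qed
  then have "\<forall>K\<in>(`) \<gamma> ` \<J>. simple_arc_image K" by blast
  moreover have "\<gamma> ` {a<..<b} \<subseteq> \<Union>((`) \<gamma> ` \<J>)" 
    unfolding J(2)[symmetric] by (simp add: image_Union)
  ultimately show ?thesis using countable_image[OF J(1), of "(`) \<gamma>"] by (intro exI[of _ "(`) \<gamma> ` \<J>"] conjI)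
qed

lemma simple_arc_image_singleton: "simple_arc_image {p}"
  unfolding simple_arc_image_def
  by (intro exI[of _ "{0::real}"] exI[of _ "\<lambda>_. p"]) simp

lemma edge_point_not_residual:
  assumes "edge_point A p" "p \<in> A"
  shows "\<not> residual_point A p"
proof
  assume res: "residual_point A p"
  obtain \<epsilon> \<delta> and \<gamma> :: "real \<Rightarrow> real \<times> 'a" where e: "\<epsilon> > 0" "analytic_map_on \<gamma> {-\<delta><..<\<delta>}" "inj_on \<gamma> {-\<delta><..<\<delta>}"
    "ball p \<epsilon> \<inter> A = \<gamma> ` {-\<delta><..<\<delta>}"
    using assms(1) unfolding edge_point_def by (elim exE conjE) (rule that)
  obtain \<K> where "countable \<K>" "\<gamma> ` {-\<delta><..<\<delta>} \<subseteq> \<Union>\<K>" "\<forall>K\<in>\<K>. simple_arc_image K"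
    using analytic_curve_countable_arcs[OF e(2,3)] by (elim exE conjE) (rule that)
  then show False
    using residual_point_not_countable_arcs[OF res assms(2) e(1), of \<K>] e(4) by simp
qed

lemma vertex_point_not_residual:
  assumes "vertex_point A p" "p \<in> A"
  shows "\<not> residual_point A p"
proof
  assume res: "residual_point A p"
  from conjunct2[OF assms(1)[unfolded vertex_point_def]]
  obtain \<epsilon> where "\<epsilon> > 0 \<and> (ball p \<epsilon> \<inter> A = {p} \<or>
        (\<exists>N\<ge>1. \<exists>\<gamma> :: nat \<Rightarrow> real \<Rightarrow> real \<times> 'a.
           (\<forall>i\<in>{1..N}. analytic_map_on (\<gamma> i) {0<..<1} \<and> inj_on (\<gamma> i) {0<..<1} \<and>
              p \<notin> \<gamma> i ` {0<..<1} \<and> (\<gamma> i \<longlongrightarrow> p) (at_left 1)) \<and>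
           ball p \<epsilon> \<inter> A = (\<Union>i\<in>{1..N}. \<gamma> i ` {0<..<1}) \<union> {p}))" ..
  note e = conjunct1[OF this] and alt = conjunct2[OF this]
  from alt obtain N :: nat and \<gamma> :: "nat \<Rightarrow> real \<Rightarrow> real \<times> 'a"
    where g: "\<forall>i\<in>{1..N}. analytic_map_on (\<gamma> i) {0<..<1} \<and> inj_on (\<gamma> i) {0<..<1}"
      and u: "ball p \<epsilon> \<inter> A = (\<Union>i\<in>{1..N}. \<gamma> i ` {0<..<1}) \<union> {p}"
  proof
    assume "ball p \<epsilon> \<inter> A = {p}"
    \<comment> \<open>An isolated vertex is the case of no curves: \<open>{1..0}\<close> is
      empty.\<close>
    then show ?thesis using that[of 0 "\<lambda>_ _. p"] by simp
  next
    assume "\<exists>N\<ge>1. \<exists>\<gamma> :: nat \<Rightarrow> real \<Rightarrow> real \<times> 'a.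
           (\<forall>i\<in>{1..N}. analytic_map_on (\<gamma> i) {0<..<1} \<and> inj_on (\<gamma> i) {0<..<1} \<and>
              p \<notin> \<gamma> i ` {0<..<1} \<and> (\<gamma> i \<longlongrightarrow> p) (at_left 1)) \<and>
           ball p \<epsilon> \<inter> A = (\<Union>i\<in>{1..N}. \<gamma> i ` {0<..<1}) \<union> {p}"
    then obtain N and \<gamma> :: "nat \<Rightarrow> real \<Rightarrow> real \<times> 'a" where
      "\<forall>i\<in>{1..N}. analytic_map_on (\<gamma> i) {0<..<1} \<and> inj_on (\<gamma> i) {0<..<1} \<and>
              p \<notin> \<gamma> i ` {0<..<1} \<and> (\<gamma> i \<longlongrightarrow> p) (at_left 1)"
      "ball p \<epsilon> \<inter> A = (\<Union>i\<in>{1..N}. \<gamma> i ` {0<..<1}) \<union> {p}"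
      by (elim exE conjE) (rule that)
    then show ?thesis by (intro that[of N \<gamma>]) simp_all
  qed
  have "\<forall>i\<in>{1..N}. \<exists>\<K>. countable \<K> \<and> \<gamma> i ` {0<..<1} \<subseteq> \<Union>\<K> \<and> (\<forall>K\<in>\<K>. simple_arc_image K)"
    by (intro ballI analytic_curve_countable_arcs) (use g in simp_all)
  from bchoice[OF this] obtain \<K> where K: "\<forall>i\<in>{1..N}. countable (\<K> i) \<and> \<gamma> i ` {0<..<1} \<subseteq> \<Union>(\<K> i) \<and> (\<forall>K\<in>\<K> i. simple_arc_image K)"
    ..
  \<comment> \<open>The point \<open>p\<close> is itself an arc, over a one-point
    \<open>J\<close>.\<close>
  let ?\<L> = "insert {p} (\<Union>i\<in>{1..N}. \<K> i)"
  have sub: "\<gamma> i ` {0<..<1} \<subseteq> \<Union>?\<L>" if "i \<in> {1..N}" for i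
  proof -
    have "\<gamma> i ` {0<..<1} \<subseteq> \<Union>(\<K> i)" using bspec[OF K that] by simp
    also have "\<dots> \<subseteq> \<Union>?\<L>"
      by (rule Union_mono, rule subset_insertI2, rule UN_upper[OF that])
    finally show ?thesis .
  qed
  have "ball p \<epsilon> \<inter> A \<subseteq> \<Union>?\<L>"
    unfolding u
  proof (rule Un_least)
    show "{p} \<subseteq> \<Union>?\<L>" by simp
    show "(\<Union>i\<in>{1..N}. \<gamma> i ` {0<..<1}) \<subseteq> \<Union>?\<L>" by (rule UN_least, rule sub)
  qed
  moreover have "countable ?\<L>"
  proof (intro countable_insert countable_UN)
    show "countable {1..N}" by simp
    show "countable (\<K> i)" if "i \<in> {1..N}" for i using bspec[OF K that] by simp
  qed
  moreover have "simple_arc_image K" if K': "K \<in> ?\<L>" for K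
  proof (cases "K = {p}")
    case True then show ?thesis by (simp only: simple_arc_image_singleton)
  next
    case False
    then have "K \<in> (\<Union>i\<in>{1..N}. \<K> i)" using K' by simp
    then obtain i where i: "i \<in> {1..N}" "K \<in> \<K> i" by (rule UN_E)
    then show ?thesis using bspec[OF K i(1)] by simp
  qed
  ultimately show False
    using residual_point_not_countable_arcs[OF res assms(2) e, of ?\<L>] by simp
qed

section \<open>Absolutely convergent power series in two real variables\<close>

definition monom2 :: "nat \<times> nat \<Rightarrow> real \<times> real \<Rightarrow> real" where
  "monom2 i z = fst z ^ fst i * snd z ^ snd i"

text \<open>The maximum of \<open>\<bar>monom2 i z\<bar>\<close> over \<open>box2 \<rho>\<close>,
  for \<open>\<rho> \<ge> 0\<close>.\<close>

definition wt2 :: "real \<Rightarrow> nat \<times> nat \<Rightarrow> real" where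
  "wt2 \<rho> i = \<rho> ^ (fst i + snd i)"

definition box2 :: "real \<Rightarrow> (real \<times> real) set" where
  "box2 \<rho> = {z. \<bar>fst z\<bar> \<le> \<rho> \<and> \<bar>snd z\<bar> \<le> \<rho>}"

text \<open>\<open>C\<close> bounds the weighted \<open>\<ell>\<^sup>1\<close> norm of some coefficient family of \<open>f\<close> on the square of half-width \<open>\<rho>\<close>;
  the values of \<open>f\<close> outside that square are unconstrained.\<close>

definition pser :: "real \<Rightarrow> (real \<times> real \<Rightarrow> 'w::banach) \<Rightarrow> real \<Rightarrow> bool" where
  "pser \<rho> f C \<longleftrightarrow> (\<exists>a S. S \<le> C \<and> ((\<lambda>i. norm (a i) * wt2 \<rho> i) has_sum S) UNIV \<and>
     (\<forall>z\<in>box2 \<rho>. ((\<lambda>i. monom2 i z *\<^sub>R a i) has_sum f z) UNIV))"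

lemma pserE:
  assumes "pser \<rho> f C"
  obtains a S where "S \<le> C" "((\<lambda>i. norm (a i) * wt2 \<rho> i) has_sum S) UNIV"
    "\<And>z. z \<in> box2 \<rho> \<Longrightarrow> ((\<lambda>i. monom2 i z *\<^sub>R a i) has_sum f z) UNIV"
proof -
  from assms obtain a S where *: "S \<le> C \<and> ((\<lambda>i. norm (a i) * wt2 \<rho> i) has_sum S) UNIV \<and>
     (\<forall>z\<in>box2 \<rho>. ((\<lambda>i. monom2 i z *\<^sub>R a i) has_sum f z) UNIV)"
    unfolding pser_def by (elim exE)
  show ?thesis by (rule that[of S a]) (use * in simp_all)
qed

lemma pserI:
  assumes "((\<lambda>i. norm (a i) * wt2 \<rho> i) has_sum S) UNIV" "S \<le> C"
    "\<And>z. z \<in> box2 \<rho> \<Longrightarrow> ((\<lambda>i. monom2 i z *\<^sub>R a i) has_sum f z) UNIV"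
  shows "pser \<rho> f C"
  unfolding pser_def by (intro exI[of _ a] exI[of _ S] conjI ballI) (use assms in simp_all)

lemma wt2_nonneg: "\<rho> \<ge> 0 \<Longrightarrow> wt2 \<rho> i \<ge> 0" by (simp add: wt2_def)
lemma wt2_pos: "\<rho> > 0 \<Longrightarrow> wt2 \<rho> i > 0" by (simp add: wt2_def)

lemma abs_monom2_le: "z \<in> box2 \<rho> \<Longrightarrow> \<bar>monom2 i z\<bar> \<le> wt2 \<rho> i"
  unfolding monom2_def wt2_def box2_def abs_mult power_abs power_add
  by (intro mult_mono power_mono) auto

lemma pser_nonneg: "\<rho> > 0 \<Longrightarrow> pser \<rho> f C \<Longrightarrow> C \<ge> 0"
  by (erule pserE) (meson has_sum_nonneg mult_nonneg_nonneg norm_ge_zero order.trans wt2_nonneg less_imp_le)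

lemma pser_mono: "pser \<rho> f C \<Longrightarrow> C \<le> D \<Longrightarrow> pser \<rho> f D"
  unfolding pser_def by (meson order.trans)

lemma pser_cong:
  assumes "pser \<rho> f C" "\<And>z. z \<in> box2 \<rho> \<Longrightarrow> f z = g z"
  shows "pser \<rho> g C"
  using assms unfolding pser_def by simp

lemma pser_norm_le:
  assumes "pser \<rho> f C" "z \<in> box2 \<rho>"
  shows "norm (f z) \<le> C"
proof -
  obtain a S where a: "S \<le> C" "((\<lambda>i. norm (a i) * wt2 \<rho> i) has_sum S) UNIV"
    "\<And>z. z \<in> box2 \<rho> \<Longrightarrow> ((\<lambda>i. monom2 i z *\<^sub>R a i) has_sum f z) UNIV"
    by (rule pserE[OF assms(1)]) (rule that)
  have "norm (monom2 i z *\<^sub>R a i) \<le> norm (a i) * wt2 \<rho> i" for i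
    using mult_right_mono[OF abs_monom2_le[OF assms(2)], of "norm (a i)" i] by (simp add: mult.commute)
  then have "norm (f z) \<le> S"
    by (intro norm_infsum_le[OF a(3)[OF assms(2)] a(2)])
  then show ?thesis using a(1) by simp
qed

lemma has_sum_single:
  assumes "\<And>j. j \<noteq> i \<Longrightarrow> f j = 0"
  shows "(f has_sum f i) UNIV"
proof -
  have "(f has_sum f i) {i}" using has_sum_finite[of "{i}" f] by simp
  also have "?this \<longleftrightarrow> (f has_sum f i) UNIV"
    by (rule has_sum_cong_neutral) (use assms in auto)
  finally show ?thesis .
qed

text \<open>Multiplication and division by a monomial shift the exponents by an injective map; sums
  are transferred along it.\<close>

lemma has_sum_shift:
  assumes "inj h" "\<And>i. g (h i) = f i" "\<And>i. i \<notin> range h \<Longrightarrow> g i = 0"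
  shows "(g has_sum s) UNIV \<longleftrightarrow> (f has_sum s) UNIV"
proof -
  have "(g has_sum s) UNIV \<longleftrightarrow> (g has_sum s) (range h)"
    by (rule has_sum_cong_neutral) (use assms in auto)
  also have "\<dots> \<longleftrightarrow> (f has_sum s) UNIV"
    by (subst has_sum_reindex[OF assms(1)]) (simp add: o_def assms(2))
  finally show ?thesis .
qed

lemma pser_const: "pser \<rho> (\<lambda>_. c) (norm c)"
proof (rule pserI)
  let ?a = "\<lambda>i. if i = (0,0) then c else 0"
  show "((\<lambda>i. norm (?a i) * wt2 \<rho> i) has_sum norm c) UNIV"
    using has_sum_single[of "(0,0)" "\<lambda>i. norm (?a i) * wt2 \<rho> i"] by (simp add: wt2_def)
  show "((\<lambda>i. monom2 i z *\<^sub>R ?a i) has_sum c) UNIV" for z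
    using has_sum_single[of "(0,0)" "\<lambda>i. monom2 i z *\<^sub>R ?a i"] by (simp add: monom2_def)
qed simp

lemma pser_zero: "pser \<rho> (\<lambda>_. 0) 0"
  using pser_const[of \<rho> 0] by simp

lemma pser_monom2:
  assumes "\<rho> \<ge> 0" "pser \<rho> f C"
  shows "pser \<rho> (\<lambda>z. monom2 j z *\<^sub>R f z) (wt2 \<rho> j * C)"
proof -
  obtain a S where a: "S \<le> C" "((\<lambda>i. norm (a i) * wt2 \<rho> i) has_sum S) UNIV"
    "\<And>z. z \<in> box2 \<rho> \<Longrightarrow> ((\<lambda>i. monom2 i z *\<^sub>R a i) has_sum f z) UNIV"
    by (rule pserE[OF assms(2)]) (rule that)
  define h where "h i = (fst i + fst j, snd i + snd j)" for i :: "nat \<times> nat"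
  have inj: "inj h" by (auto simp: h_def inj_def)
  define b where "b i = (if i \<in> range h then a (inv h i) else 0)" for i
  have b: "b (h i) = a i" for i by (simp add: b_def inv_f_f[OF inj])
  have b0: "i \<notin> range h \<Longrightarrow> b i = 0" for i by (simp add: b_def)
  have wh: "wt2 \<rho> (h i) = wt2 \<rho> j * wt2 \<rho> i" for i by (simp add: wt2_def h_def power_add)
  have mh: "monom2 (h i) z = monom2 j z * monom2 i z" for i z by (simp add: monom2_def h_def power_add)
  show ?thesis
  proof (rule pserI)
    have "((\<lambda>i. wt2 \<rho> j * (norm (a i) * wt2 \<rho> i)) has_sum (wt2 \<rho> j * S)) UNIV"
      by (rule has_sum_cmult_right[OF a(2)])
    then show "((\<lambda>i. norm (b i) * wt2 \<rho> i) has_sum (wt2 \<rho> j * S)) UNIV"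
      by (subst has_sum_shift[OF inj, where f = "\<lambda>i. wt2 \<rho> j * (norm (a i) * wt2 \<rho> i)"])
        (simp_all add: b b0 wh mult_ac)
    show "wt2 \<rho> j * S \<le> wt2 \<rho> j * C" using a(1) assms(1) by (simp add: mult_left_mono wt2_nonneg)
    fix z assume "z \<in> box2 \<rho>"
    from has_sum_scaleR[OF a(3)[OF this], of "monom2 j z"]
    show "((\<lambda>i. monom2 i z *\<^sub>R b i) has_sum (monom2 j z *\<^sub>R f z)) UNIV"
      by (subst has_sum_shift[OF inj, where f = "\<lambda>i. monom2 j z *\<^sub>R monom2 i z *\<^sub>R a i"])
        (simp_all add: b b0 mh)
  qed
qed

lemma pser_linear:
  assumes T: "bounded_linear T" "\<And>x. norm (T x) \<le> B * norm x" and "\<rho> > 0" "pser \<rho> f C" "B \<ge> 0"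
  shows "pser \<rho> (\<lambda>z. T (f z)) (B * C)"
proof -
  obtain a S where a: "S \<le> C" "((\<lambda>i. norm (a i) * wt2 \<rho> i) has_sum S) UNIV"
    "\<And>z. z \<in> box2 \<rho> \<Longrightarrow> ((\<lambda>i. monom2 i z *\<^sub>R a i) has_sum f z) UNIV"
    by (rule pserE[OF assms(4)]) (rule that)
  have le: "norm (T (a i)) * wt2 \<rho> i \<le> B * (norm (a i) * wt2 \<rho> i)" for i
    using mult_right_mono[OF T(2) wt2_nonneg[OF less_imp_le[OF \<open>\<rho> > 0\<close>]]] by (simp add: mult.assoc)
  have s: "((\<lambda>i. B * (norm (a i) * wt2 \<rho> i)) has_sum (B * S)) UNIV"
    by (rule has_sum_cmult_right[OF a(2)])
  have s': "(\<lambda>i. norm (T (a i)) * wt2 \<rho> i) summable_on UNIV"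
    by (rule summable_on_comparison_test[OF has_sum_imp_summable[OF s] le])
      (simp add: wt2_nonneg less_imp_le[OF \<open>\<rho> > 0\<close>])
  show ?thesis
  proof (rule pserI)
    show "((\<lambda>i. norm (T (a i)) * wt2 \<rho> i) has_sum infsum (\<lambda>i. norm (T (a i)) * wt2 \<rho> i) UNIV) UNIV"
      using s' by simp
    have "infsum (\<lambda>i. norm (T (a i)) * wt2 \<rho> i) UNIV \<le> B * S"
      by (rule has_sum_mono[OF has_sum_infsum[OF s'] s]) (rule le)
    moreover have "B * S \<le> B * C"
      using a(1) assms(5) by (rule mult_left_mono)
    ultimately show "infsum (\<lambda>i. norm (T (a i)) * wt2 \<rho> i) UNIV \<le> B * C" by linarith
    fix z assume "z \<in> box2 \<rho>"
    from has_sum_bounded_linear[OF T(1) a(3)[OF this]]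
    show "((\<lambda>i. monom2 i z *\<^sub>R T (a i)) has_sum T (f z)) UNIV"
      by (simp add: linear_simps[OF T(1)])
  qed
qed

text \<open>Fubini for the absolutely summable double family indexed by \<open>I\<close> and the
  exponents. Products, substitutions, multilinear terms and the limit of the iteration are all
  instances.\<close>

lemma pser_sum:
  assumes "\<rho> > 0" "\<And>n. n \<in> I \<Longrightarrow> pser \<rho> (f n) (C n)" "(C has_sum D) I"
    "\<And>z. z \<in> box2 \<rho> \<Longrightarrow> ((\<lambda>n. f n z) has_sum g z) I"
  shows "pser \<rho> g D"
proof -
  let ?P = "\<lambda>n aS. snd aS \<le> C n \<and> ((\<lambda>i. norm (fst aS i) * wt2 \<rho> i) has_sum snd aS) UNIV \<and>
     (\<forall>z\<in>box2 \<rho>. ((\<lambda>i. monom2 i z *\<^sub>R fst aS i) has_sum f n z) UNIV)"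
  have "\<forall>n\<in>I. \<exists>aS. ?P n aS"
  proof
    fix n assume "n \<in> I"
    from assms(2)[OF this] obtain a S where "S \<le> C n \<and> ((\<lambda>i. norm (a i) * wt2 \<rho> i) has_sum S) UNIV \<and>
     (\<forall>z\<in>box2 \<rho>. ((\<lambda>i. monom2 i z *\<^sub>R a i) has_sum f n z) UNIV)"
      unfolding pser_def by (elim exE)
    then show "\<exists>aS. ?P n aS" by (intro exI[of _ "(a, S)"]) simp
  qed
  from bchoice[OF this] obtain aS where aS: "\<forall>n\<in>I. ?P n (aS n)" ..
  define a where "a n = fst (aS n)" for n
  define S where "S n = snd (aS n)" for n
  have SC: "S n \<le> C n" and S: "((\<lambda>i. norm (a n i) * wt2 \<rho> i) has_sum S n) UNIV"
    and fz: "z \<in> box2 \<rho> \<Longrightarrow> ((\<lambda>i. monom2 i z *\<^sub>R a n i) has_sum f n z) UNIV" if "n \<in> I" for n z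
    using bspec[OF aS that] by (simp_all add: a_def S_def)
  have w0: "wt2 \<rho> i \<ge> 0" and w1: "wt2 \<rho> i > 0" for i
    using assms(1) by (simp_all add: wt2_nonneg wt2_pos)
  have S0: "S n \<ge> 0" if "n \<in> I" for n
    using has_sum_nonneg[OF S[OF that]] w0 by simp
  have Ssum: "S summable_on I"
    by (rule summable_on_comparison_test[OF has_sum_imp_summable[OF assms(3)]]) (use SC S0 in auto)
  have SD: "infsum S I \<le> D"
    by (rule has_sum_mono[OF has_sum_infsum[OF Ssum] assms(3)]) (rule SC)
  \<comment> \<open>Row \<open>n\<close> sums to \<open>S n\<close>, at most \<open>C n\<close>, so
    the double family is absolutely summable; summing the other way gives the coefficients
    \<open>A i\<close> of \<open>g\<close> and the bound \<open>D\<close>.\<close>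
  have sm: "(\<lambda>(n,i). norm (a n i) * wt2 \<rho> i) summable_on I \<times> UNIV"
    by (rule summable_on_SigmaI[where g = S]) (use S Ssum w0 in auto)
  have hsS: "((\<lambda>(n,i). norm (a n i) * wt2 \<rho> i) has_sum infsum S I) (I \<times> UNIV)"
    by (rule has_sum_SigmaI[where g = S]) (use S Ssum sm in auto)
  have hsS': "((\<lambda>(i,n). norm (a n i) * wt2 \<rho> i) has_sum infsum S I) (UNIV \<times> I)"
    using hsS by (subst (asm) has_sum_swap) (simp add: case_prod_unfold)
  have smi: "(\<lambda>n. norm (a n i) * wt2 \<rho> i) summable_on I" for i
    using summable_on_SigmaD1[OF has_sum_imp_summable[OF hsS'], of i] by simp
  define B where "B i = infsum (\<lambda>n. norm (a n i) * wt2 \<rho> i) I" for i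
  have hB: "(B has_sum infsum S I) UNIV"
    by (rule has_sum_SigmaD[OF hsS']) (use smi in \<open>simp add: B_def\<close>)
  have na: "(\<lambda>n. norm (a n i)) summable_on I" for i
    using summable_on_cmult_left[where c = "1 / wt2 \<rho> i", OF smi[of i]] w1[of i] by simp
  define A where "A i = infsum (\<lambda>n. a n i) I" for i
  have hA: "((\<lambda>n. a n i) has_sum A i) I" for i
    unfolding A_def using abs_summable_summable[OF na] by simp
  have AB: "norm (A i) * wt2 \<rho> i \<le> B i" for i
  proof -
    have "norm (A i) \<le> infsum (\<lambda>n. norm (a n i)) I"
      unfolding A_def by (rule norm_infsum_bound[OF na])
    then have "norm (A i) * wt2 \<rho> i \<le> infsum (\<lambda>n. norm (a n i)) I * wt2 \<rho> i"
      by (rule mult_right_mono) (rule w0)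
    also have "\<dots> = B i" unfolding B_def by (rule infsum_cmult_left[symmetric]) (rule na)
    finally show ?thesis .
  qed
  have As: "(\<lambda>i. norm (A i) * wt2 \<rho> i) summable_on UNIV"
    by (rule summable_on_comparison_test[OF has_sum_imp_summable[OF hB] AB]) (simp add: w0)
  show ?thesis
  proof (rule pserI)
    show "((\<lambda>i. norm (A i) * wt2 \<rho> i) has_sum infsum (\<lambda>i. norm (A i) * wt2 \<rho> i) UNIV) UNIV"
      using As by simp
    show "infsum (\<lambda>i. norm (A i) * wt2 \<rho> i) UNIV \<le> D"
      using has_sum_mono[OF has_sum_infsum[OF As] hB AB] SD by simp
    fix z assume z: "z \<in> box2 \<rho>"
    have le: "norm (monom2 i z *\<^sub>R a n i) \<le> norm (a n i) * wt2 \<rho> i" for n i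
      using mult_right_mono[OF abs_monom2_le[OF z], of "norm (a n i)" i] by (simp add: mult.commute)
    have "(\<lambda>p. norm ((\<lambda>(n,i). monom2 i z *\<^sub>R a n i) p)) summable_on I \<times> UNIV"
      by (rule Infinite_Sum.abs_summable_on_comparison_test'[OF sm]) (use le in auto)
    then have "(\<lambda>(n,i). monom2 i z *\<^sub>R a n i) summable_on I \<times> UNIV"
      by (rule abs_summable_summable)
    then have "((\<lambda>(n,i). monom2 i z *\<^sub>R a n i) has_sum g z) (I \<times> UNIV)"
      by (intro has_sum_SigmaI[OF _ assms(4)[OF z]]) (use fz z in auto)
    then have "((\<lambda>(i,n). monom2 i z *\<^sub>R a n i) has_sum g z) (UNIV \<times> I)"
      by (subst (asm) has_sum_swap) (simp add: case_prod_unfold)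
    then show "((\<lambda>i. monom2 i z *\<^sub>R A i) has_sum g z) UNIV"
      by (rule has_sum_SigmaD) (use has_sum_scaleR[OF hA] in simp)
  qed
qed

text \<open>An instance of \<open>pser_sum\<close> over the two-element index set
  \<open>bool\<close>.\<close>

lemma pser_add:
  assumes "\<rho> > 0" "pser \<rho> f C" "pser \<rho> g D"
  shows "pser \<rho> (\<lambda>z. f z + g z) (C + D)"
proof -
  have "pser \<rho> (\<lambda>z. f z + g z) (\<Sum>b\<in>UNIV. if b then C else D)"
  proof (rule pser_sum[OF assms(1), where I = "UNIV :: bool set" and f = "\<lambda>b. if b then f else g" and C = "\<lambda>b. if b then C else D"])
    show "pser \<rho> (if b then f else g) (if b then C else D)" for b using assms by simp
    show "((\<lambda>b. if b then C else D) has_sum (\<Sum>b\<in>UNIV. if b then C else D)) UNIV"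
      by (rule has_sum_finite) simp
    show "((\<lambda>n. (if n then f else g) z) has_sum f z + g z) UNIV" for z
      using has_sum_finite[of "UNIV :: bool set" "\<lambda>n. (if n then f else g) z"] by (simp add: UNIV_bool add.commute)
  qed
  then show ?thesis by (simp add: UNIV_bool add.commute)
qed

lemma pser_scale:
  assumes "\<rho> > 0" "pser \<rho> f C"
  shows "pser \<rho> (\<lambda>z. c *\<^sub>R f z) (\<bar>c\<bar> * C)"
  by (rule pser_linear[OF bounded_linear_scaleR_right _ assms]) simp_all

lemma pser_diff:
  assumes "\<rho> > 0" "pser \<rho> f C" "pser \<rho> g D"
  shows "pser \<rho> (\<lambda>z. f z - g z) (C + D)"
  using pser_add[OF assms(1,2) pser_scale[OF assms(1,3), of "-1"]] by simp

text \<open>The Cauchy product, summed over the monomials of \<open>f\<close> with \<open>g\<close>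
  kept whole, so that no convolution of coefficients has to be written down. The bound
  \<open>C * D\<close> is the submultiplicativity of the norm.\<close>

lemma pser_scaleR:
  assumes "\<rho> > 0" "pser \<rho> f C" "pser \<rho> g D"
  shows "pser \<rho> (\<lambda>z. f z *\<^sub>R g z) (C * D)"
proof -
  obtain a S where a: "S \<le> C" "((\<lambda>i. norm (a i) * wt2 \<rho> i) has_sum S) UNIV"
    "\<And>z. z \<in> box2 \<rho> \<Longrightarrow> ((\<lambda>i. monom2 i z *\<^sub>R a i) has_sum f z) UNIV"
    by (rule pserE[OF assms(2)]) (rule that)
  have "pser \<rho> (\<lambda>z. f z *\<^sub>R g z) (S * D)"
  proof (rule pser_sum[OF assms(1)])
    show "pser \<rho> (\<lambda>z. monom2 j z *\<^sub>R a j *\<^sub>R g z) (wt2 \<rho> j * (\<bar>a j\<bar> * D))" for j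
      by (rule pser_monom2[OF less_imp_le[OF assms(1)] pser_scale[OF assms(1,3)]])
    show "((\<lambda>j. wt2 \<rho> j * (\<bar>a j\<bar> * D)) has_sum S * D) UNIV"
      using has_sum_cmult_left[OF a(2), of D] by (simp add: mult_ac)
    show "((\<lambda>j. monom2 j z *\<^sub>R a j *\<^sub>R g z) has_sum f z *\<^sub>R g z) UNIV" if "z \<in> box2 \<rho>" for z
      using has_sum_bounded_linear[OF bounded_linear_scaleR_left a(3)[OF that], of "g z"] by simp
  qed
  then show ?thesis
    by (rule pser_mono) (use a(1) pser_nonneg[OF assms(1,3)] in \<open>simp add: mult_right_mono\<close>)
qed

lemma pser_mult:
  fixes f g :: "real \<times> real \<Rightarrow> real"
  shows "\<rho> > 0 \<Longrightarrow> pser \<rho> f C \<Longrightarrow> pser \<rho> g D \<Longrightarrow> pser \<rho> (\<lambda>z. f z * g z) (C * D)"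
  using pser_scaleR[of \<rho> f C g D] by simp

lemma pser_power:
  fixes f :: "real \<times> real \<Rightarrow> real"
  assumes "\<rho> > 0" "pser \<rho> f C"
  shows "pser \<rho> (\<lambda>z. f z ^ n) (C ^ n)"
proof (induction n)
  case 0
  then show ?case using pser_const[of \<rho> "1::real"] by simp
next
  case (Suc n)
  from pser_mult[OF assms(1,2) Suc] show ?case by simp
qed

lemma box2_mono: "\<rho>' \<le> \<rho> \<Longrightarrow> box2 \<rho>' \<subseteq> box2 \<rho>" by (auto simp: box2_def)
lemma zero_in_box2: "\<rho> \<ge> 0 \<Longrightarrow> (0,0) \<in> box2 \<rho>" by (simp add: box2_def)

text \<open>The coefficients are hidden inside \<open>pser\<close>, so the termwise comparison is
  demanded of every family with constant term \<open>f (0,0)\<close>; evaluation at the origin shows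
  that the hidden family is of this kind.\<close>

lemma pser_shrink_aux:
  assumes "pser \<rho> f C" "0 < \<rho>'" "\<rho>' \<le> \<rho>"
    "\<And>a i. a (0,0) = f (0,0) \<Longrightarrow> norm (a i) * wt2 \<rho>' i \<le> c * (norm (a i) * wt2 \<rho> i)" "c \<ge> 0"
  shows "pser \<rho>' f (c * C)"
proof -
  obtain a S where a: "S \<le> C" "((\<lambda>i. norm (a i) * wt2 \<rho> i) has_sum S) UNIV"
    "\<And>z. z \<in> box2 \<rho> \<Longrightarrow> ((\<lambda>i. monom2 i z *\<^sub>R a i) has_sum f z) UNIV"
    by (rule pserE[OF assms(1)]) (rule that)
  have m0: "monom2 j (0,0) = (if j = (0,0) then 1 else 0)" for j
    by (cases j) (simp add: monom2_def power_0_left)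
  have "((\<lambda>i. monom2 i (0,0) *\<^sub>R a i) has_sum a (0,0)) UNIV"
    using has_sum_single[of "(0,0)" "\<lambda>i. monom2 i (0,0) *\<^sub>R a i"] by (simp add: m0)
  then have a0: "a (0,0) = f (0,0)"
    by (rule has_sum_unique[OF _ a(3)[OF zero_in_box2]]) (use assms(2,3) in linarith)
  have le: "norm (a i) * wt2 \<rho>' i \<le> c * (norm (a i) * wt2 \<rho> i)" for i
    by (rule assms(4)[of a, OF a0])
  have s: "((\<lambda>i. c * (norm (a i) * wt2 \<rho> i)) has_sum (c * S)) UNIV"
    by (rule has_sum_cmult_right[OF a(2)])
  have s': "(\<lambda>i. norm (a i) * wt2 \<rho>' i) summable_on UNIV"
    by (rule summable_on_comparison_test[OF has_sum_imp_summable[OF s] le])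
      (simp add: wt2_nonneg less_imp_le[OF assms(2)])
  show ?thesis
  proof (rule pserI)
    show "((\<lambda>i. norm (a i) * wt2 \<rho>' i) has_sum infsum (\<lambda>i. norm (a i) * wt2 \<rho>' i) UNIV) UNIV"
      using s' by simp
    have "infsum (\<lambda>i. norm (a i) * wt2 \<rho>' i) UNIV \<le> c * S"
      by (rule has_sum_mono[OF has_sum_infsum[OF s'] s]) (rule le)
    moreover have "c * S \<le> c * C" using a(1) assms(5) by (rule mult_left_mono)
    ultimately show "infsum (\<lambda>i. norm (a i) * wt2 \<rho>' i) UNIV \<le> c * C" by linarith
    show "((\<lambda>i. monom2 i z *\<^sub>R a i) has_sum f z) UNIV" if "z \<in> box2 \<rho>'" for z
      using a(3) that box2_mono[OF assms(3)] by blast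
  qed
qed

lemma pser_shrink:
  assumes "pser \<rho> f C" "0 < \<rho>'" "\<rho>' \<le> \<rho>"
  shows "pser \<rho>' f C"
proof -
  have "wt2 \<rho>' i \<le> wt2 \<rho> i" for i
    unfolding wt2_def by (rule power_mono) (use assms in auto)
  then have "pser \<rho>' f (1 * C)"
    by (intro pser_shrink_aux[OF assms]) (auto intro: mult_left_mono)
  then show ?thesis by simp
qed

text \<open>Without a constant term every weight contains a factor \<open>\<rho>\<close>, so
  shrinking gains \<open>\<rho>' / \<rho>\<close>. This is how the inner functions of a composition
  are made small.\<close>

lemma pser_shrink_zero:
  assumes "pser \<rho> f C" "0 < \<rho>'" "\<rho>' \<le> \<rho>" "f (0,0) = 0"
  shows "pser \<rho>' f (\<rho>' / \<rho> * C)"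
proof (rule pser_shrink_aux[OF assms(1-3)])
  fix a :: "nat \<times> nat \<Rightarrow> 'a" and i assume a: "a (0,0) = f (0,0)"
  show "norm (a i) * wt2 \<rho>' i \<le> \<rho>' / \<rho> * (norm (a i) * wt2 \<rho> i)"
  proof (cases "i = (0,0)")
    case True then show ?thesis using a assms(4) by simp
  next
    case False
    then obtain n where n: "fst i + snd i = Suc n" by (cases i) (metis add_is_0 fst_conv not0_implies_Suc snd_conv)
    have "wt2 \<rho>' i = \<rho>' * \<rho>' ^ n" by (simp add: wt2_def n)
    also have "\<dots> \<le> \<rho>' * \<rho> ^ n" using assms by (intro mult_left_mono power_mono) auto
    also have "\<dots> = \<rho>' / \<rho> * wt2 \<rho> i" using assms by (simp add: wt2_def n)
    finally show ?thesis
      using mult_left_mono[of "wt2 \<rho>' i" "\<rho>' / \<rho> * wt2 \<rho> i" "norm (a i)"] by (simp add: mult_ac)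
  qed
qed (use assms in simp)

text \<open>Inner functions of norm at most \<open>\<rho>\<close> turn the monomial of index
  \<open>i\<close> into a series of norm at most \<open>wt2 \<rho> i\<close>, exactly the weight
  under which the coefficients of \<open>f\<close> are summable.\<close>

lemma pser_comp:
  assumes "\<rho> > 0" "\<sigma> > 0" "pser \<rho> f C" "pser \<sigma> g1 \<rho>" "pser \<sigma> g2 \<rho>"
  shows "pser \<sigma> (\<lambda>z. f (g1 z, g2 z)) C"
proof -
  obtain a S where a: "S \<le> C" "((\<lambda>i. norm (a i) * wt2 \<rho> i) has_sum S) UNIV"
    "\<And>z. z \<in> box2 \<rho> \<Longrightarrow> ((\<lambda>i. monom2 i z *\<^sub>R a i) has_sum f z) UNIV"
    by (rule pserE[OF assms(3)]) (rule that)
  have "pser \<sigma> (\<lambda>z. f (g1 z, g2 z)) S"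
  proof (rule pser_sum[OF assms(2)])
    show "pser \<sigma> (\<lambda>z. monom2 j (g1 z, g2 z) *\<^sub>R a j) (\<rho> ^ fst j * \<rho> ^ snd j * norm (a j))" for j
      unfolding monom2_def fst_conv snd_conv
      by (intro pser_scaleR pser_mult pser_power pser_const assms)
    show "((\<lambda>j. \<rho> ^ fst j * \<rho> ^ snd j * norm (a j)) has_sum S) UNIV"
      using a(2) by (simp add: wt2_def power_add mult_ac)
    show "((\<lambda>j. monom2 j (g1 z, g2 z) *\<^sub>R a j) has_sum f (g1 z, g2 z)) UNIV" if "z \<in> box2 \<sigma>" for z
      by (rule a(3)) (use pser_norm_le[OF assms(4) that] pser_norm_le[OF assms(5) that] in \<open>simp add: box2_def\<close>)
  qed
  then show ?thesis using a(1) by (rule pser_mono)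
qed

lemma pser_fst: "\<rho> \<ge> 0 \<Longrightarrow> pser \<rho> fst \<rho>"
  using pser_monom2[OF _ pser_const[of \<rho> "1::real"], of "(1,0)"] by (simp add: monom2_def wt2_def)

lemma pser_snd: "\<rho> \<ge> 0 \<Longrightarrow> pser \<rho> snd \<rho>"
  using pser_monom2[OF _ pser_const[of \<rho> "1::real"], of "(0,1)"] by (simp add: monom2_def wt2_def)

text \<open>The terms without a factor \<open>y\<close> form \<open>f (fst z, 0)\<close>; in the
  others one factor is cancelled, which divides each weight by \<open>\<rho>\<close> and gives
  \<open>C / \<rho>\<close>.\<close>

lemma pser_div_snd:
  assumes "\<rho> > 0" "pser \<rho> f C"
  shows "\<exists>g. pser \<rho> g (C / \<rho>) \<and> (\<forall>z\<in>box2 \<rho>. f z = f (fst z, 0) + snd z *\<^sub>R g z)"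
proof -
  obtain a S where a: "S \<le> C" "((\<lambda>i. norm (a i) * wt2 \<rho> i) has_sum S) UNIV"
    "\<And>z. z \<in> box2 \<rho> \<Longrightarrow> ((\<lambda>i. monom2 i z *\<^sub>R a i) has_sum f z) UNIV"
    by (rule pserE[OF assms(2)]) (rule that)
  define h where "h i = (fst i, Suc (snd i))" for i :: "nat \<times> nat"
  have inj: "inj h" by (auto simp: h_def inj_def)
  have rh: "i \<in> range h \<longleftrightarrow> snd i \<noteq> 0" for i
    by (cases i; cases "snd i") (auto simp: h_def image_iff)
  define b where "b i = a (h i)" for i
  have wh: "wt2 \<rho> (h i) = \<rho> * wt2 \<rho> i" for i by (simp add: wt2_def h_def)
  have mh: "monom2 (h i) z = snd z * monom2 i z" for i z by (simp add: monom2_def h_def)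
  have w0: "wt2 \<rho> i \<ge> 0" for i using assms(1) by (simp add: wt2_nonneg)
  have "(\<lambda>i. norm (a i) * wt2 \<rho> i) summable_on range h"
    by (rule summable_on_subset_banach[OF has_sum_imp_summable[OF a(2)]]) simp
  then have s1: "(\<lambda>i. \<rho> * (norm (b i) * wt2 \<rho> i)) summable_on UNIV"
    by (subst (asm) summable_on_reindex[OF inj]) (simp add: o_def b_def wh mult_ac)
  have s2: "(\<lambda>i. norm (b i) * wt2 \<rho> i) summable_on UNIV"
    using summable_on_cmult_right[OF s1, of "1 / \<rho>"] assms(1) by simp
  have "\<rho> * infsum (\<lambda>i. norm (b i) * wt2 \<rho> i) UNIV \<le> S"
  proof -
    have "\<rho> * infsum (\<lambda>i. norm (b i) * wt2 \<rho> i) UNIV = infsum (\<lambda>i. \<rho> * (norm (b i) * wt2 \<rho> i)) UNIV"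
      by (rule infsum_cmult_right[symmetric]) (rule s2)
    also have "\<dots> = infsum (\<lambda>i. norm (a i) * wt2 \<rho> i) (range h)"
      by (subst infsum_reindex[OF inj]) (simp add: o_def b_def wh mult_ac)
    also have "\<dots> \<le> S"
      by (rule has_sum_mono_neutral[OF has_sum_infsum a(2)]) (use \<open>_ summable_on range h\<close> w0 in auto)
    finally show ?thesis .
  qed
  then have le: "infsum (\<lambda>i. norm (b i) * wt2 \<rho> i) UNIV \<le> C / \<rho>"
    using a(1) assms(1) by (simp add: pos_le_divide_eq mult.commute)
  define g where "g z = infsum (\<lambda>i. monom2 i z *\<^sub>R b i) UNIV" for z
  have hg: "((\<lambda>i. monom2 i z *\<^sub>R b i) has_sum g z) UNIV" if z: "z \<in> box2 \<rho>" for z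
  proof -
    have "norm (monom2 i z *\<^sub>R b i) \<le> norm (b i) * wt2 \<rho> i" for i
      using mult_right_mono[OF abs_monom2_le[OF z], of "norm (b i)" i] by (simp add: mult.commute)
    then have "(\<lambda>i. norm (monom2 i z *\<^sub>R b i)) summable_on UNIV"
      by (intro Infinite_Sum.abs_summable_on_comparison_test'[OF s2])
    from abs_summable_summable[OF this] show ?thesis unfolding g_def by simp
  qed
  have "pser \<rho> g (C / \<rho>)"
    by (rule pserI[OF has_sum_infsum[OF s2] le hg])
  moreover have "f z = f (fst z, 0) + snd z *\<^sub>R g z" if z: "z \<in> box2 \<rho>" for z
  proof -
    have z': "(fst z, 0) \<in> box2 \<rho>" using z assms(1) by (simp add: box2_def)
    have "((\<lambda>i. monom2 i z *\<^sub>R a i - monom2 i (fst z, 0) *\<^sub>R a i) has_sum (f z - f (fst z, 0))) UNIV"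
      using has_sum_add[OF a(3)[OF z] has_sum_scaleR[OF a(3)[OF z'], of "-1"]] by simp
    moreover have "monom2 i z *\<^sub>R a i - monom2 i (fst z, 0) *\<^sub>R a i = 0" if "i \<notin> range h" for i
      using that by (simp add: rh monom2_def)
    moreover have "monom2 (h i) z *\<^sub>R a (h i) - monom2 (h i) (fst z, 0) *\<^sub>R a (h i) = snd z *\<^sub>R monom2 i z *\<^sub>R b i" for i
      by (simp add: mh b_def)
    ultimately have "((\<lambda>i. snd z *\<^sub>R monom2 i z *\<^sub>R b i) has_sum (f z - f (fst z, 0))) UNIV"
      by (subst (asm) has_sum_shift[OF inj, where f = "\<lambda>i. snd z *\<^sub>R monom2 i z *\<^sub>R b i"]) auto
    moreover have "((\<lambda>i. snd z *\<^sub>R monom2 i z *\<^sub>R b i) has_sum (snd z *\<^sub>R g z)) UNIV"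
      by (rule has_sum_scaleR[OF hg[OF z]])
    ultimately have "f z - f (fst z, 0) = snd z *\<^sub>R g z" by (rule has_sum_unique)
    then show ?thesis by (simp add: algebra_simps)
  qed
  ultimately show ?thesis by (intro exI[of _ g] conjI ballI)
qed

section \<open>Power series inserted into multilinear maps\<close>

lemma symmetric_multilinear_indep:
  assumes "symmetric_multilinear n m" "\<And>i. i < n \<Longrightarrow> x i = y i"
  shows "m x = m y"
  using conjunct1[OF assms(1)[unfolded symmetric_multilinear_def]] assms(2) by simp

lemma symmetric_multilinear_linear:
  assumes "symmetric_multilinear n m" "i < n"
  shows "linear (\<lambda>a. m (x(i := a)))"
  using conjunct1[OF conjunct2[OF assms(1)[unfolded symmetric_multilinear_def]]] assms(2) by simp

lemma multilinear_bounded_linear: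
  assumes "symmetric_multilinear n m" "i < n" "\<And>x. norm (m x) \<le> K * (\<Prod>i<n. norm (x i))"
  shows "bounded_linear (\<lambda>a. m (x(i := a)))"
proof -
  note lin = symmetric_multilinear_linear[OF assms(1,2), of x]
  show ?thesis
  proof (rule bounded_linear_intro[where K = "K * (\<Prod>j\<in>{..<n} - {i}. norm (x j))"])
    show "m (x(i := a + b)) = m (x(i := a)) + m (x(i := b))" for a b by (rule linear_add[OF lin])
    show "m (x(i := r *\<^sub>R a)) = r *\<^sub>R m (x(i := a))" for r a by (rule linear_scale[OF lin])
    fix a
    have "norm (m (x(i := a))) \<le> K * (\<Prod>j<n. norm ((x(i := a)) j))" by (rule assms(3))
    also have "(\<Prod>j<n. norm ((x(i := a)) j)) = norm ((x(i := a)) i) * (\<Prod>j\<in>{..<n} - {i}. norm ((x(i := a)) j))"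
      by (rule prod.remove) (use assms(2) in auto)
    also have "(\<Prod>j\<in>{..<n} - {i}. norm ((x(i := a)) j)) = (\<Prod>j\<in>{..<n} - {i}. norm (x j))"
      by (rule prod.cong) auto
    finally show "norm (m (x(i := a))) \<le> norm a * (K * (\<Prod>j\<in>{..<n} - {i}. norm (x j)))"
      by (simp add: mult_ac fun_upd_def)
  qed
qed

text \<open>One slot is expanded at a time, by induction on the number \<open>k\<close> of slots
  that carry series, while the later slots hold fixed vectors. A sum over several multi-indices at
  once never occurs.\<close>

lemma pser_multilinear:
  fixes m :: "(nat \<Rightarrow> 'a::banach) \<Rightarrow> 'b::banach"
  assumes "\<rho> > 0" "symmetric_multilinear n m" "K \<ge> 0"
    and bd: "\<And>x. norm (m x) \<le> K * (\<Prod>i<n. norm (x i))"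
    and g: "\<And>i. i < n \<Longrightarrow> pser \<rho> (g i) (C i)"
  shows "pser \<rho> (\<lambda>z. m (\<lambda>i. g i z)) (K * (\<Prod>i<n. C i))"
proof -
  have C0: "C i \<ge> 0" if "i < n" for i using pser_nonneg[OF assms(1) g[OF that]] .
  have main: "pser \<rho> (\<lambda>z. m (\<lambda>i. if i < k then g i z else x i))
      (K * (\<Prod>i<k. C i) * (\<Prod>i\<in>{k..<n}. norm (x i)))" if "k \<le> n" for k x
    using that
  proof (induction k arbitrary: x)
    case 0
    show ?case
      using pser_mono[OF pser_const[of \<rho> "m x"] bd[of x]] by (simp add: atLeast0LessThan)
  next
    case (Suc k)
    then have k: "k < n" by simp
    obtain a S where a: "S \<le> C k" "((\<lambda>i. norm (a i) * wt2 \<rho> i) has_sum S) UNIV"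
      "\<And>z. z \<in> box2 \<rho> \<Longrightarrow> ((\<lambda>i. monom2 i z *\<^sub>R a i) has_sum g k z) UNIV"
      by (rule pserE[OF g[OF k]]) (rule that)
    define R where "R = (\<Prod>i\<in>{Suc k..<n}. norm (x i))"
    have R0: "R \<ge> 0" unfolding R_def by (rule prod_nonneg) simp
    have P0: "(\<Prod>i<k. C i) \<ge> 0" by (rule prod_nonneg) (use C0 k in auto)
    have eqR: "(\<Prod>i\<in>{k..<n}. norm ((x(k := v)) i)) = norm v * R" for v
    proof -
      have "(\<Prod>i\<in>{k..<n}. norm ((x(k := v)) i)) = norm ((x(k := v)) k) * (\<Prod>i\<in>{Suc k..<n}. norm ((x(k := v)) i))"
        using k by (rule prod.atLeast_Suc_lessThan)
      also have "(\<Prod>i\<in>{Suc k..<n}. norm ((x(k := v)) i)) = R"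
        unfolding R_def by (rule prod.cong) auto
      finally show ?thesis by simp
    qed
    let ?y = "\<lambda>z i. if i < k then g i z else x i"
    have y1: "(\<lambda>i. if i < Suc k then g i z else x i) = (?y z)(k := g k z)" for z
      by (auto simp: less_Suc_eq)
    have y2: "(\<lambda>i. if i < k then g i z else (x(k := v)) i) = (?y z)(k := v)" for z v
      by auto
    have "pser \<rho> (\<lambda>z. m ((?y z)(k := g k z))) (S * (K * (\<Prod>i<k. C i) * R))"
    proof (rule pser_sum[OF assms(1)])
      fix j
      \<comment> \<open>The coefficient \<open>a j\<close> sits in slot \<open>k\<close> as a fixed
        vector, so the hypothesis for \<open>k\<close> applies; this is why \<open>x\<close> is
        arbitrary in the induction.\<close>
      have "pser \<rho> (\<lambda>z. m ((?y z)(k := a j))) (K * (\<Prod>i<k. C i) * (norm (a j) * R))"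
        using Suc.IH[of "x(k := a j)"] k unfolding y2 eqR by simp
      then show "pser \<rho> (\<lambda>z. monom2 j z *\<^sub>R m ((?y z)(k := a j))) (wt2 \<rho> j * (K * (\<Prod>i<k. C i) * (norm (a j) * R)))"
        by (rule pser_monom2[OF less_imp_le[OF assms(1)]])
      show "((\<lambda>j. wt2 \<rho> j * (K * (\<Prod>i<k. C i) * (norm (a j) * R))) has_sum S * (K * (\<Prod>i<k. C i) * R)) UNIV"
        using has_sum_cmult_left[OF a(2), of "K * (\<Prod>i<k. C i) * R"] by (simp add: mult_ac)
      fix z assume z: "z \<in> box2 \<rho>"
      note bl = multilinear_bounded_linear[OF assms(2) k bd, of "?y z"]
      show "((\<lambda>j. monom2 j z *\<^sub>R m ((?y z)(k := a j))) has_sum m ((?y z)(k := g k z))) UNIV"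
        using has_sum_bounded_linear[OF bl a(3)[OF z]]
        by (simp only: linear_scale[OF bounded_linear.linear[OF bl]])
    qed
    then have "pser \<rho> (\<lambda>z. m ((?y z)(k := g k z))) (C k * (K * (\<Prod>i<k. C i) * R))"
      by (rule pser_mono) (use a(1) assms(3) P0 R0 in \<open>intro mult_right_mono; simp\<close>)
    then show ?case unfolding y1 R_def by (simp add: mult_ac)
  qed
  have "m (\<lambda>i. if i < n then g i z else 0) = m (\<lambda>i. g i z)" for z
    by (rule symmetric_multilinear_indep[OF assms(2)]) simp
  then show ?thesis using main[of n "\<lambda>_. 0"] by simp
qed

text \<open>Telescoping: \<open>m(g,\<dots>,g) - m(h,\<dots>,h)\<close> is the sum of the terms in which the first \<open>i\<close> entries
  are \<open>g\<close>, the \<open>i\<close>-th is \<open>g - h\<close> and the remaining ones are \<open>h\<close>.\<close>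

lemma pser_multilinear_diff:
  fixes m :: "(nat \<Rightarrow> 'a::banach) \<Rightarrow> 'b::banach"
  assumes "\<rho> > 0" "symmetric_multilinear n m" "K \<ge> 0"
    and bd: "\<And>x. norm (m x) \<le> K * (\<Prod>i<n. norm (x i))"
    and g: "pser \<rho> g R" and h: "pser \<rho> h R" and d: "pser \<rho> (\<lambda>z. g z - h z) D"
  shows "pser \<rho> (\<lambda>z. m (\<lambda>_. g z) - m (\<lambda>_. h z)) (real n * K * R ^ (n - 1) * D)"
proof -
  have "pser \<rho> (\<lambda>z. m (\<lambda>i. if i < k then g z else h z) - m (\<lambda>_. h z)) (real k * K * R ^ (n - 1) * D)"
    if "k \<le> n" for k
    using that
  proof (induction k)
    case 0
    then show ?case using pser_zero by simp
  next
    case (Suc k)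
    then have k: "k < n" by simp
    let ?e = "\<lambda>i z. if i < k then g z else if i = k then g z - h z else h z"
    have "pser \<rho> (\<lambda>z. m (\<lambda>i. ?e i z)) (K * (\<Prod>i<n. if i = k then D else R))"
    proof (rule pser_multilinear[OF assms(1-4)])
      show "pser \<rho> (?e i) (if i = k then D else R)" for i
        by (cases "i < k"; cases "i = k") (simp_all add: g h d)
    qed
    also have "(\<Prod>i<n. if i = k then D else R) = D * R ^ (n - 1)"
      by (subst prod.remove[of _ k]) (use k in auto)
    finally have 1: "pser \<rho> (\<lambda>z. m (\<lambda>i. ?e i z)) (K * (D * R ^ (n - 1)))" .
    have eq: "m (\<lambda>i. if i < Suc k then g z else h z) = m (\<lambda>i. ?e i z) + m (\<lambda>i. if i < k then g z else h z)" for z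
    proof -
      let ?y = "\<lambda>i. if i < k then g z else h z"
      have e1: "(\<lambda>i. if i < Suc k then g z else h z) = ?y(k := (g z - h z) + h z)" by (auto simp: less_Suc_eq)
      have e2: "(\<lambda>i. ?e i z) = ?y(k := g z - h z)" by auto
      have e3: "?y(k := h z) = ?y" by auto
      show ?thesis unfolding e1 e2
        using linear_add[OF symmetric_multilinear_linear[OF assms(2) k, of ?y], of "g z - h z" "h z"]
        unfolding e3 .
    qed
    have "pser \<rho> (\<lambda>z. m (\<lambda>i. ?e i z) + (m (\<lambda>i. if i < k then g z else h z) - m (\<lambda>_. h z)))
        (K * (D * R ^ (n - 1)) + real k * K * R ^ (n - 1) * D)"
      by (rule pser_add[OF assms(1) 1 Suc.IH]) (use k in simp)
    then show ?case unfolding eq by (simp add: algebra_simps)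
  qed
  from this[of n] have *: "pser \<rho> (\<lambda>z. m (\<lambda>i. if i < n then g z else h z) - m (\<lambda>_. h z)) (real n * K * R ^ (n - 1) * D)"
    by simp
  have "m (\<lambda>i. if i < n then g z else h z) = m (\<lambda>i. g z)" for z
    by (rule symmetric_multilinear_indep[OF assms(2)]) simp
  with * show ?thesis by simp
qed

section \<open>From power series in the plane to analytic maps\<close>

lemma analytic_map_at_translate:
  assumes "analytic_map_at (\<lambda>h. f (x0 + h)) 0"
  shows "analytic_map_at f x0"
proof -
  obtain m \<epsilon> r M where m: "\<epsilon> > 0" "r > 0" "\<forall>k. symmetric_multilinear k (m k)"
    "\<forall>k x. r ^ k * norm (m k x) \<le> M * (\<Prod>i<k. norm (x i))"
    "\<forall>x \<in> ball 0 \<epsilon>. (\<lambda>k. m k (\<lambda>_. x - 0)) sums f (x0 + x)"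
    by (rule analytic_map_atE[OF assms])
  have "\<forall>x \<in> ball x0 \<epsilon>. (\<lambda>k. m k (\<lambda>_. x - x0)) sums f x"
  proof
    fix x assume "x \<in> ball x0 \<epsilon>"
    then have "x - x0 \<in> ball 0 \<epsilon>" by (simp add: dist_norm norm_minus_commute)
    from bspec[OF m(5) this] show "(\<lambda>k. m k (\<lambda>_. x - x0)) sums f x" by simp
  qed
  with m(1-4) show ?thesis unfolding analytic_map_at_def
    by (intro exI[of _ m] exI[of _ \<epsilon>] exI[of _ r] exI[of _ M] conjI)
qed

text \<open>Serves to reparametrise curves: the expansion is precomposed with \<open>A\<close>, and
  both radii are divided by a bound \<open>B\<close> for \<open>A\<close>.\<close>

lemma analytic_map_at_affine:
  assumes f: "analytic_map_at f (c + A x0)" and A: "bounded_linear A"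
  shows "analytic_map_at (\<lambda>x. f (c + A x)) x0"
proof -
  obtain m \<epsilon> r M where m: "\<epsilon> > 0" "r > 0" "\<forall>k. symmetric_multilinear k (m k)"
    "\<forall>k x. r ^ k * norm (m k x) \<le> M * (\<Prod>i<k. norm (x i))"
    "\<forall>x \<in> ball (c + A x0) \<epsilon>. (\<lambda>k. m k (\<lambda>_. x - (c + A x0))) sums f x"
    by (rule analytic_map_atE[OF f])
  obtain B where B: "B > 0" "\<And>x. norm (A x) \<le> norm x * B"
    using bounded_linear.pos_bounded[OF A] by blast
  have M: "M \<ge> 0" using spec[OF spec[OF m(4), of 0], of "\<lambda>_. 0"] norm_ge_zero[of "m 0 (\<lambda>_. 0)"] by (simp del: norm_ge_zero)
  have lin: "linear A" using A by (rule bounded_linear.linear)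
  have sm: "symmetric_multilinear k (\<lambda>x. m k (\<lambda>i. A (x i)))" for k
  proof -
    note smk = spec[OF m(3), of k]
    have 1: "m k (\<lambda>i. A (x i)) = m k (\<lambda>i. A (y i))" if "\<forall>i<k. x i = y i" for x y
      by (rule symmetric_multilinear_indep[OF smk]) (use that in simp)
    have 2: "linear (\<lambda>a. m k (\<lambda>j. A ((x(i := a)) j)))" if "i < k" for i x
    proof -
      have "(\<lambda>a. m k (\<lambda>j. A ((x(i := a)) j))) = (\<lambda>b. m k ((\<lambda>j. A (x j))(i := b))) \<circ> A"
        by (rule ext) (simp add: fun_upd_def if_distrib cong: if_cong)
      then show ?thesis
        using linear_compose[OF lin symmetric_multilinear_linear[OF smk that, of "\<lambda>j. A (x j)"]] by simp
    qed
    have 3: "m k (\<lambda>i. A ((x \<circ> p) i)) = m k (\<lambda>i. A (x i))" if "p permutes {..<k}" for p x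
    proof -
      have "m k ((\<lambda>i. A (x i)) \<circ> p) = m k (\<lambda>i. A (x i))"
        using conjunct2[OF conjunct2[OF smk[unfolded symmetric_multilinear_def]]] that by blast
      then show ?thesis by (simp add: o_def)
    qed
    show ?thesis unfolding symmetric_multilinear_def using 1 2 3 by simp
  qed
  have bd: "(r / B) ^ k * norm (m k (\<lambda>i. A (x i))) \<le> M * (\<Prod>i<k. norm (x i))" for k x
  proof -
    have "r ^ k * norm (m k (\<lambda>i. A (x i))) \<le> M * (\<Prod>i<k. norm (A (x i)))"
      using spec[OF spec[OF m(4), of k], of "\<lambda>i. A (x i)"] .
    also have "\<dots> \<le> M * (\<Prod>i<k. norm (x i) * B)"
      by (intro mult_left_mono prod_mono conjI B M norm_ge_zero)
    also have "\<dots> = M * (\<Prod>i<k. norm (x i)) * B ^ k" by (simp add: prod.distrib)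
    finally show ?thesis using B(1) by (simp add: power_divide divide_simps mult_ac)
  qed
  have sums: "\<forall>x\<in>ball x0 (\<epsilon> / B). (\<lambda>k. m k (\<lambda>i. A (x - x0))) sums f (c + A x)"
  proof
    fix x assume x: "x \<in> ball x0 (\<epsilon> / B)"
    have "norm (A (x - x0)) \<le> norm (x - x0) * B" by (rule B)
    also have "\<dots> < \<epsilon>" using x B(1) by (simp add: dist_norm norm_minus_commute pos_less_divide_eq)
    finally have "c + A x \<in> ball (c + A x0) \<epsilon>"
      by (simp add: dist_norm norm_minus_commute linear_diff[OF lin])
    from bspec[OF m(5) this] show "(\<lambda>k. m k (\<lambda>i. A (x - x0))) sums f (c + A x)"
      by (simp add: linear_diff[OF lin])
  qed
  show ?thesis unfolding analytic_map_at_def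
    by (intro exI[of _ "\<lambda>k x. m k (\<lambda>i. A (x i))"] exI[of _ "\<epsilon> / B"] exI[of _ "r / B"] exI[of _ M] conjI allI)
      (use m(1,2) B(1) sm bd sums in simp_all)
qed

text \<open>Analyticity asks for symmetric multilinear forms, so the homogeneous part of degree
  \<open>k\<close> is polarised: \<open>x^j y^(k-j)\<close> becomes the average, over the subsets
  \<open>J\<close> of \<open>{..<k}\<close> with \<open>j\<close> elements, of the product of the
  first coordinates on \<open>J\<close> and the second coordinates off \<open>J\<close>.\<close>

lemma pser_imp_analytic_at_zero:
  assumes "\<rho> > 0" "pser \<rho> f C"
  shows "analytic_map_at f 0"
proof -
  obtain a S where a: "S \<le> C" "((\<lambda>i. norm (a i) * wt2 \<rho> i) has_sum S) UNIV"
    "\<And>z. z \<in> box2 \<rho> \<Longrightarrow> ((\<lambda>i. monom2 i z *\<^sub>R a i) has_sum f z) UNIV"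
    by (rule pserE[OF assms(2)]) (rule that)
  define P where "P k J x = (\<Prod>i\<in>J. fst (x i)) * (\<Prod>i\<in>{..<k} - J. snd (x i))"
    for k :: nat and J and x :: "nat \<Rightarrow> real \<times> real"
  \<comment> \<open>Division by the number of subsets of this size turns the sum over
    \<open>J\<close> into an average.\<close>
  define v where "v k J = (1 / real (k choose card J)) *\<^sub>R a (card J, k - card J)" for k :: nat and J :: "nat set"
  define m where "m k x = (\<Sum>J\<in>Pow {..<k}. P k J x *\<^sub>R v k J)" for k x
  have fin: "J \<in> Pow {..<k} \<Longrightarrow> finite J" for J and k :: nat using finite_subset[of J "{..<k}"] by simp
  have S0: "S \<ge> 0" using has_sum_nonneg[OF a(2)] assms(1) by (simp add: wt2_nonneg)
  have aS: "norm (a i) * wt2 \<rho> i \<le> S" for i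
  proof -
    have "sum (\<lambda>i. norm (a i) * wt2 \<rho> i) {i} \<le> S"
      by (rule finite_sum_le_has_sum[OF a(2)]) (use assms(1) in \<open>auto simp: wt2_nonneg\<close>)
    then show ?thesis by simp
  qed
  have sm: "symmetric_multilinear k (m k)" for k
  proof -
    have 1: "m k x = m k y" if xy: "\<forall>i<k. x i = y i" for x y
    proof -
      have "P k J x = P k J y" if "J \<in> Pow {..<k}" for J
        unfolding P_def by (intro arg_cong2[where f = "(*)"] prod.cong) (use xy that in auto)
      then show ?thesis unfolding m_def by (intro sum.cong) simp_all
    qed
    have 2: "linear (\<lambda>b. m k (x(i := b)))" if i: "i < k" for i x
    proof -
      have "linear (\<lambda>b. P k J (x(i := b)) *\<^sub>R v k J)" if J: "J \<in> Pow {..<k}" for J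
      proof (cases "i \<in> J")
        case True
        have "P k J (x(i := b)) = fst b * ((\<Prod>j\<in>J - {i}. fst (x j)) * (\<Prod>j\<in>{..<k} - J. snd (x j)))" for b
        proof -
          have "(\<Prod>j\<in>J. fst ((x(i := b)) j)) = fst ((x(i := b)) i) * (\<Prod>j\<in>J - {i}. fst ((x(i := b)) j))"
            by (rule prod.remove[OF fin[OF J] True])
          moreover have "(\<Prod>j\<in>J - {i}. fst ((x(i := b)) j)) = (\<Prod>j\<in>J - {i}. fst (x j))" by (rule prod.cong) auto
          moreover have "(\<Prod>j\<in>{..<k} - J. snd ((x(i := b)) j)) = (\<Prod>j\<in>{..<k} - J. snd (x j))"
            by (rule prod.cong) (use True in auto)
          ultimately show ?thesis unfolding P_def by simp
        qed
        then show ?thesis by (intro linearI) (simp_all add: algebra_simps)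
      next
        case False
        have "P k J (x(i := b)) = snd b * ((\<Prod>j\<in>J. fst (x j)) * (\<Prod>j\<in>{..<k} - J - {i}. snd (x j)))" for b
        proof -
          have "(\<Prod>j\<in>{..<k} - J. snd ((x(i := b)) j)) = snd ((x(i := b)) i) * (\<Prod>j\<in>{..<k} - J - {i}. snd ((x(i := b)) j))"
            by (rule prod.remove) (use False i in auto)
          moreover have "(\<Prod>j\<in>{..<k} - J - {i}. snd ((x(i := b)) j)) = (\<Prod>j\<in>{..<k} - J - {i}. snd (x j))" by (rule prod.cong) auto
          moreover have "(\<Prod>j\<in>J. fst ((x(i := b)) j)) = (\<Prod>j\<in>J. fst (x j))"
            by (rule prod.cong) (use False in auto)
          ultimately show ?thesis unfolding P_def by simp
        qed
        then show ?thesis by (intro linearI) (simp_all add: algebra_simps)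
      qed
      then show ?thesis unfolding m_def by (rule linear_compose_sum[rule_format])
    qed
    have 3: "m k (x \<circ> p) = m k x" if p: "p permutes {..<k}" for p x
    proof -
      have injp: "inj_on p A" for A using permutes_inj_on[OF p] .
      \<comment> \<open>A permutation of the slots permutes the subsets and preserves their size, so
        it only reorders the sum.\<close>
      have bij: "bij_betw ((`) p) (Pow {..<k}) (Pow {..<k})"
        by (rule bij_betw_Pow) (rule permutes_imp_bij[OF p])
      have "P k (p ` J) x *\<^sub>R v k (p ` J) = P k J (x \<circ> p) *\<^sub>R v k J" if J: "J \<in> Pow {..<k}" for J
      proof -
        have "{..<k} - p ` J = p ` ({..<k} - J)"
          using J by (simp add: image_set_diff[OF permutes_inj[OF p]] permutes_image[OF p])
        then have "P k (p ` J) x = P k J (x \<circ> p)"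
          unfolding P_def by (simp add: prod.reindex[OF injp])
        moreover have "v k (p ` J) = v k J" unfolding v_def by (simp add: card_image[OF injp])
        ultimately show ?thesis by simp
      qed
      then have "(\<Sum>J\<in>Pow {..<k}. P k J (x \<circ> p) *\<^sub>R v k J) = (\<Sum>J\<in>Pow {..<k}. P k (p ` J) x *\<^sub>R v k (p ` J))"
        by (intro sum.cong) simp_all
      also have "\<dots> = (\<Sum>J\<in>Pow {..<k}. P k J x *\<^sub>R v k J)"
        by (rule sum.reindex_bij_betw[OF bij])
      finally show ?thesis unfolding m_def .
    qed
    show ?thesis unfolding symmetric_multilinear_def using 1 2 3 by simp
  qed
  have bd: "(\<rho> / 2) ^ k * norm (m k x) \<le> S * (\<Prod>i<k. norm (x i))" for k x
  proof -
    have "norm (P k J x *\<^sub>R v k J) \<le> (\<Prod>i<k. norm (x i)) * (S / \<rho> ^ k)" if J: "J \<in> Pow {..<k}" for J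
    proof -
      have "\<bar>P k J x\<bar> = (\<Prod>i\<in>J. \<bar>fst (x i)\<bar>) * (\<Prod>i\<in>{..<k} - J. \<bar>snd (x i)\<bar>)"
        unfolding P_def by (simp add: abs_mult abs_prod)
      also have "\<dots> \<le> (\<Prod>i\<in>J. norm (x i)) * (\<Prod>i\<in>{..<k} - J. norm (x i))"
        by (intro mult_mono prod_mono prod_nonneg)
          (auto simp: norm_fst_le[of "fst (x _)" "snd (x _)", simplified] norm_prod_def)
      also have "\<dots> = (\<Prod>i<k. norm (x i))"
        using prod.subset_diff[of J "{..<k}" "\<lambda>i. norm (x i)"] J by (simp add: mult.commute)
      finally have 1: "\<bar>P k J x\<bar> \<le> (\<Prod>i<k. norm (x i))" .
      have "card J \<le> k" using J card_mono[of "{..<k}" J] by simp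
      then have ch: "real (k choose card J) \<ge> 1" by (simp add: Suc_leI binomial_eq_0_iff)
      then have ch': "1 / real (k choose card J) \<le> 1" by (simp only: divide_le_eq_1_pos)
      have "norm (a (card J, k - card J)) * \<rho> ^ k \<le> S"
        using aS[of "(card J, k - card J)"] \<open>card J \<le> k\<close> by (simp add: wt2_def)
      then have "norm (a (card J, k - card J)) \<le> S / \<rho> ^ k" using assms(1) by (simp add: pos_le_divide_eq)
      moreover have "norm (v k J) \<le> norm (a (card J, k - card J))"
        unfolding v_def using mult_right_mono[of "1 / real (k choose card J)" 1 "norm (a (card J, k - card J))"] ch' by simp
      ultimately have 2: "norm (v k J) \<le> S / \<rho> ^ k" by linarith
      show ?thesis unfolding norm_scaleR by (rule mult_mono[OF 1 2]) (auto intro: prod_nonneg)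
    qed
    \<comment> \<open>There are \<open>2 ^ k\<close> subsets, hence the radius
      \<open>\<rho> / 2\<close> in the bound.\<close>
    then have "norm (m k x) \<le> (\<Sum>J\<in>Pow {..<k}. (\<Prod>i<k. norm (x i)) * (S / \<rho> ^ k))"
      unfolding m_def by (intro order.trans[OF norm_sum] sum_mono)
    also have "\<dots> = 2 ^ k * ((\<Prod>i<k. norm (x i)) * (S / \<rho> ^ k))" by (simp add: card_Pow)
    finally show ?thesis using assms(1) by (simp add: power_divide divide_simps mult_ac)
  qed
  have sums: "\<forall>z\<in>ball 0 \<rho>. (\<lambda>k. m k (\<lambda>_. z - 0)) sums f z"
  proof
    fix z :: "real \<times> real" assume z: "z \<in> ball 0 \<rho>"
    have "\<bar>fst z\<bar> \<le> norm z" "\<bar>snd z\<bar> \<le> norm z"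
      using norm_fst_le[of "fst z" "snd z"] norm_snd_le[of "snd z" "fst z"] by simp_all
    then have "z \<in> box2 \<rho>" using z unfolding box2_def by simp
    note hs = a(3)[OF this]
    have mk: "m k (\<lambda>_. z) = (\<Sum>j\<le>k. monom2 (j, k - j) z *\<^sub>R a (j, k - j))" for k
    proof -
      let ?h = "\<lambda>j. (monom2 (j, k - j) z / real (k choose j)) *\<^sub>R a (j, k - j)"
      have "P k J (\<lambda>_. z) *\<^sub>R v k J = ?h (card J)" if J: "J \<in> Pow {..<k}" for J
        unfolding P_def v_def monom2_def using J fin[OF J] by (simp add: card_Diff_subset)
      then have "m k (\<lambda>_. z) = (\<Sum>J\<in>Pow {..<k}. ?h (card J))" unfolding m_def by (intro sum.cong) simp_all
      \<comment> \<open>On the diagonal the terms depend on \<open>J\<close> only through its size;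
        grouping by size cancels the binomial coefficient.\<close>
      also have "\<dots> = (\<Sum>j\<le>k. \<Sum>J\<in>{J \<in> Pow {..<k}. card J = j}. ?h (card J))"
        by (rule sum.group[symmetric]) (auto intro: card_mono[of "{..<k}", simplified] simp: subset_eq_atLeast0_lessThan_card)
      also have "\<dots> = (\<Sum>j\<le>k. monom2 (j, k - j) z *\<^sub>R a (j, k - j))"
      proof (rule sum.cong)
        fix j assume j: "j \<in> {..k}"
        have "(\<Sum>J\<in>{J \<in> Pow {..<k}. card J = j}. ?h (card J)) = (\<Sum>J\<in>{J \<in> Pow {..<k}. card J = j}. ?h j)"
          by (rule sum.cong) auto
        also have "\<dots> = real (card {J \<in> Pow {..<k}. card J = j}) *\<^sub>R ?h j" by (simp only: sum_constant_scaleR)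
        also have "card {J \<in> Pow {..<k}. card J = j} = k choose j"
          using n_subsets[of "{..<k}" j] by (simp add: Pow_def)
        also have "real (k choose j) *\<^sub>R ?h j = monom2 (j, k - j) z *\<^sub>R a (j, k - j)"
          using j by (simp add: binomial_eq_0_iff)
        finally show "(\<Sum>J\<in>{J \<in> Pow {..<k}. card J = j}. ?h (card J)) = monom2 (j, k - j) z *\<^sub>R a (j, k - j)" .
      qed simp
      finally show ?thesis .
    qed
    have bij: "bij_betw (\<lambda>(k,j). (j, k - j)) (Sigma UNIV (\<lambda>k. {..k})) (UNIV :: (nat \<times> nat) set)"
      by (rule bij_betwI[where g = "\<lambda>(i,j). (i + j, i)"]) auto
    have "((\<lambda>(k,j). monom2 (j, k - j) z *\<^sub>R a (j, k - j)) has_sum f z) (Sigma UNIV (\<lambda>k. {..k}))"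
      using hs has_sum_reindex_bij_betw[OF bij, of "\<lambda>i. monom2 i z *\<^sub>R a i" "f z"] by (simp add: case_prod_unfold)
    then have "((\<lambda>k. m k (\<lambda>_. z)) has_sum f z) UNIV"
      by (rule has_sum_SigmaD) (simp add: mk has_sum_finite)
    then show "(\<lambda>k. m k (\<lambda>_. z - 0)) sums f z" by (simp add: has_sum_imp_sums)
  qed
  show ?thesis unfolding analytic_map_at_def
    by (intro exI[of _ m] exI[of _ \<rho>] exI[of _ "\<rho> / 2"] exI[of _ S] conjI allI)
      (use assms(1) sm bd sums in simp_all)
qed

text \<open>Re-expansion at \<open>(x, y)\<close>: on radius \<open>\<sigma>\<close> the translated
  coordinates have norm at most \<open>\<bar>x\<bar> + \<sigma>\<close> and
  \<open>\<bar>y\<bar> + \<sigma>\<close>, neither of which exceeds \<open>\<rho>\<close>.\<close>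

lemma pser_imp_analytic_at:
  assumes "pser \<rho> f C" "\<bar>x\<bar> < \<rho>" "\<bar>y\<bar> < \<rho>"
  shows "analytic_map_at f (x, y)"
proof -
  define \<sigma> where "\<sigma> = \<rho> - max \<bar>x\<bar> \<bar>y\<bar>"
  have s: "\<sigma> > 0" "\<bar>x\<bar> + \<sigma> \<le> \<rho>" "\<bar>y\<bar> + \<sigma> \<le> \<rho>" and r: "\<rho> > 0" using assms unfolding \<sigma>_def by auto
  have "pser \<sigma> (\<lambda>z. x + fst z) \<rho>" "pser \<sigma> (\<lambda>z. y + snd z) \<rho>"
    using pser_mono[OF pser_add[OF s(1) pser_const[of \<sigma> x] pser_fst]] s
      pser_mono[OF pser_add[OF s(1) pser_const[of \<sigma> y] pser_snd]] by auto
  from pser_comp[OF r s(1) assms(1) this]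
  have "analytic_map_at (\<lambda>z. f (x + fst z, y + snd z)) 0"
    by (rule pser_imp_analytic_at_zero[OF s(1)])
  then have "analytic_map_at (\<lambda>h. f ((x, y) + h)) 0" by (simp add: plus_prod_def)
  then show ?thesis by (rule analytic_map_at_translate)
qed

section \<open>Bordered Fredholm operators\<close>

definition sublinear :: "('a::real_vector \<Rightarrow> real) \<Rightarrow> bool" where
  "sublinear p \<longleftrightarrow> (\<forall>x y. p (x + y) \<le> p x + p y) \<and> (\<forall>c x. c \<ge> 0 \<longrightarrow> p (c *\<^sub>R x) = c * p x)"

lemma sublinearD:
  assumes "sublinear p"
  shows "p (x + y) \<le> p x + p y" "c \<ge> 0 \<Longrightarrow> p (c *\<^sub>R x) = c * p x" "p 0 = 0" "- p (- x) \<le> p x"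
proof -
  show 1: "p (x + y) \<le> p x + p y" for x y using assms by (simp add: sublinear_def)
  show 2: "c \<ge> 0 \<Longrightarrow> p (c *\<^sub>R x) = c * p x" for c x using assms by (simp add: sublinear_def)
  show 3: "p 0 = 0" using 2[of 0 0] by simp
  show "- p (- x) \<le> p x" using 1[of x "- x"] 3 by simp
qed

text \<open>Lowering a sublinear functional in the direction \<open>y\<close>; a functional that cannot be lowered in
  any direction is superadditive, hence linear.\<close>

definition lower_at :: "('a::real_vector \<Rightarrow> real) \<Rightarrow> 'a \<Rightarrow> 'a \<Rightarrow> real" where
  "lower_at p y x = (INF t\<in>{0..}. p (x + t *\<^sub>R y) - t * p y)"

text \<open>Subadditivity bounds every term of the infimum below by \<open>- p (- x)\<close>, so the
  infimum is a genuine one.\<close>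

lemma lower_at:
  assumes p: "sublinear p"
  shows lower_at_le: "t \<ge> 0 \<Longrightarrow> lower_at p y x \<le> p (x + t *\<^sub>R y) - t * p y"
    and sublinear_lower_at: "sublinear (lower_at p y)"
proof -
  note P = sublinearD[OF p]
  have lb: "- p (- x) \<le> p (x + t *\<^sub>R y) - t * p y" if "t \<ge> 0" for x t
    using P(1)[of "x + t *\<^sub>R y" "- x"] P(2)[OF that, of y] by simp
  have bdd: "bdd_below ((\<lambda>t. p (x + t *\<^sub>R y) - t * p y) ` {0..})" for x
    by (rule bdd_belowI2[where m = "- p (- x)"]) (use lb in simp)
  have le: "lower_at p y x \<le> p (x + t *\<^sub>R y) - t * p y" if "t \<ge> 0" for x t
    unfolding lower_at_def by (rule cINF_lower[OF bdd]) (use that in simp)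
  then show "t \<ge> 0 \<Longrightarrow> lower_at p y x \<le> p (x + t *\<^sub>R y) - t * p y" by simp
  have ge: "lower_at p y x \<ge> b" if "\<And>t. t \<ge> 0 \<Longrightarrow> b \<le> p (x + t *\<^sub>R y) - t * p y" for b x
    unfolding lower_at_def by (rule cINF_greatest) (use that in auto)
  have add: "lower_at p y (x1 + x2) \<le> lower_at p y x1 + lower_at p y x2" for x1 x2
  proof -
    have "lower_at p y (x1 + x2) - (p (x2 + t2 *\<^sub>R y) - t2 * p y) \<le> lower_at p y x1" if t2: "t2 \<ge> 0" for t2
    proof (rule ge)
      fix t1 :: real assume t1: "t1 \<ge> 0"
      have "lower_at p y (x1 + x2) \<le> p ((x1 + x2) + (t1 + t2) *\<^sub>R y) - (t1 + t2) * p y"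
        by (rule le) (use t1 t2 in simp)
      also have "(x1 + x2) + (t1 + t2) *\<^sub>R y = (x1 + t1 *\<^sub>R y) + (x2 + t2 *\<^sub>R y)" by (simp add: algebra_simps)
      finally show "lower_at p y (x1 + x2) - (p (x2 + t2 *\<^sub>R y) - t2 * p y) \<le> p (x1 + t1 *\<^sub>R y) - t1 * p y"
        using P(1)[of "x1 + t1 *\<^sub>R y" "x2 + t2 *\<^sub>R y"] by (simp add: algebra_simps)
    qed
    then have "lower_at p y (x1 + x2) - lower_at p y x1 \<le> lower_at p y x2"
      by (intro ge) (simp add: algebra_simps)
    then show ?thesis by simp
  qed
  \<comment> \<open>One inequality suffices: applied to \<open>1 / c\<close> it gives the
    reverse.\<close>
  have hom_le: "lower_at p y (c *\<^sub>R x) \<le> c * lower_at p y x" if c: "c > 0" for c x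
  proof -
    have "lower_at p y (c *\<^sub>R x) / c \<le> lower_at p y x"
    proof (rule ge)
      fix t :: real assume t: "t \<ge> 0"
      have "lower_at p y (c *\<^sub>R x) \<le> p (c *\<^sub>R x + (c * t) *\<^sub>R y) - (c * t) * p y"
        by (rule le) (use c t in simp)
      also have "c *\<^sub>R x + (c * t) *\<^sub>R y = c *\<^sub>R (x + t *\<^sub>R y)" by (simp add: algebra_simps)
      also have "p \<dots> = c * p (x + t *\<^sub>R y)" using c by (intro P(2)) simp
      finally show "lower_at p y (c *\<^sub>R x) / c \<le> p (x + t *\<^sub>R y) - t * p y"
        unfolding pos_divide_le_eq[OF c] by (simp add: algebra_simps)
    qed
    then show ?thesis using c by (simp add: divide_le_eq mult.commute)
  qed
  have z: "lower_at p y 0 = 0"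
    unfolding lower_at_def using P(2) by (simp add: cong: INF_cong_simp)
  have hom: "lower_at p y (c *\<^sub>R x) = c * lower_at p y x" if "c \<ge> 0" for c x
  proof (cases "c = 0")
    case True then show ?thesis using z by simp
  next
    case False
    then have c: "c > 0" using that by simp
    have "lower_at p y ((1/c) *\<^sub>R (c *\<^sub>R x)) \<le> (1/c) * lower_at p y (c *\<^sub>R x)"
      by (rule hom_le) (use c in simp)
    then have "c * lower_at p y x \<le> lower_at p y (c *\<^sub>R x)" using c by (simp add: field_simps)
    with hom_le[OF c, of x] show ?thesis by simp
  qed
  show "sublinear (lower_at p y)" unfolding sublinear_def using add hom by simp
qed

text \<open>Zorn's lemma for the reversed order; the lower bound of a chain is its pointwise
  infimum.\<close>

lemma minimal_sublinear_exists:
  assumes q: "sublinear q"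
  shows "\<exists>p. sublinear p \<and> p \<le> q \<and> (\<forall>p'. sublinear p' \<and> p' \<le> p \<longrightarrow> p' = p)"
proof -
  define A where "A = {p. sublinear p \<and> p \<le> q}"
  have "\<exists>m\<in>A. \<forall>a\<in>A. a \<le> m \<longrightarrow> a = m"
  proof (rule predicate_Zorn)
    show "partial_order_on A (relation_of (\<lambda>a b. b \<le> a) A)"
      unfolding partial_order_on_def preorder_on_def
      by (auto simp: relation_of_def refl_on_def trans_def antisym_def)
    fix C assume C: "C \<in> Chains (relation_of (\<lambda>a b. b \<le> a) A)"
    show "\<exists>u\<in>A. \<forall>a\<in>C. u \<le> a"
    proof (cases "C = {}")
      case True then show ?thesis using q unfolding A_def by (intro bexI[of _ q]) auto
    next
      case False
      have CA: "sublinear c" "c \<le> q" if "c \<in> C" for c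
        using Chains_relation_of[OF C] that unfolding A_def by auto
      have tot: "c \<le> d \<or> d \<le> c" if "c \<in> C" "d \<in> C" for c d
        using C that unfolding Chains_def relation_of_def by fastforce
      define u where "u x = (INF c\<in>C. c x)" for x
      have bdd: "bdd_below ((\<lambda>c. c x) ` C)" for x
      proof (rule bdd_belowI2[where m = "- q (- x)"])
        fix c assume c: "c \<in> C"
        show "- q (- x) \<le> c x"
          using sublinearD(4)[OF CA(1)[OF c], of x] le_funD[OF CA(2)[OF c], of "- x"] by linarith
      qed
      have ule: "u x \<le> c x" if "c \<in> C" for c x unfolding u_def by (rule cINF_lower[OF bdd that])
      have uge: "b \<le> u x" if "\<And>c. c \<in> C \<Longrightarrow> b \<le> c x" for b x
        unfolding u_def by (rule cINF_greatest[OF False]) (rule that)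
      have uadd: "u (x + y) \<le> u x + u y" for x y
      proof -
        \<comment> \<open>Of two members of the chain the smaller one can be used at both points,
          which makes the infimum subadditive.\<close>
        have *: "u (x + y) \<le> c x + d y" if c: "c \<in> C" and d: "d \<in> C" for c d
          using tot[OF c d]
        proof
          assume "c \<le> d"
          then show ?thesis using ule[OF c, of "x + y"] sublinearD(1)[OF CA(1)[OF c], of x y] le_funD[of c d y] by linarith
        next
          assume "d \<le> c"
          then show ?thesis using ule[OF d, of "x + y"] sublinearD(1)[OF CA(1)[OF d], of x y] le_funD[of d c x] by linarith
        qed
        have "u (x + y) - d y \<le> u x" if d: "d \<in> C" for d
          by (rule uge) (use *[OF _ d] in \<open>simp add: algebra_simps\<close>)
        then have "u (x + y) - u x \<le> u y" by (intro uge) (simp add: algebra_simps)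
        then show ?thesis by simp
      qed
      have uhom1: "u (c *\<^sub>R x) \<le> c * u x" if c: "c > 0" for c x
      proof -
        have "u (c *\<^sub>R x) / c \<le> u x"
        proof (rule uge)
          fix d assume d: "d \<in> C"
          have "u (c *\<^sub>R x) \<le> c * d x"
            using ule[OF d, of "c *\<^sub>R x"] sublinearD(2)[OF CA(1)[OF d], of c x] c by simp
          then show "u (c *\<^sub>R x) / c \<le> d x" using c by (simp add: divide_le_eq mult.commute)
        qed
        then show ?thesis using c by (simp add: divide_le_eq mult.commute)
      qed
      have u0: "u 0 = 0"
      proof -
        have "u 0 = (INF c\<in>C. 0)" unfolding u_def by (rule INF_cong) (simp_all add: sublinearD(3)[OF CA(1)])
        then show ?thesis using cINF_const[OF False] by simp
      qed
      have uhom: "u (c *\<^sub>R x) = c * u x" if "c \<ge> 0" for c x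
      proof (cases "c = 0")
        case True then show ?thesis using u0 by simp
      next
        case c: False
        then have c: "c > 0" using that by simp
        have "u ((1/c) *\<^sub>R (c *\<^sub>R x)) \<le> (1/c) * u (c *\<^sub>R x)" by (rule uhom1) (use c in simp)
        then have "c * u x \<le> u (c *\<^sub>R x)" using c by (simp add: field_simps)
        with uhom1[OF c, of x] show ?thesis by simp
      qed
      have "sublinear u" unfolding sublinear_def using uadd uhom by simp
      moreover obtain c where c: "c \<in> C" using False by blast
      have "u \<le> q" by (rule le_funI) (use ule[OF c] le_funD[OF CA(2)[OF c]] order.trans in blast)
      ultimately have "u \<in> A" by (simp add: A_def)
      then show ?thesis using ule by (intro bexI[of _ u]) (auto simp: le_fun_def)
    qed
  qed
  then obtain m where m: "m \<in> A" "\<forall>a\<in>A. a \<le> m \<longrightarrow> a = m" by blast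
  have "p' = m" if "sublinear p'" "p' \<le> m" for p'
  proof -
    have "p' \<in> A" using that m(1) unfolding A_def by (simp add: order.trans)
    then show ?thesis using m(2) that(2) by simp
  qed
  then show ?thesis using m(1) unfolding A_def by (intro exI[of _ m]) simp
qed

text \<open>The norm lowered at \<open>\<phi>\<close> is at most \<open>- norm \<phi>\<close> at
  \<open>- \<phi>\<close>. A minimal sublinear functional below it is linear and bounded by the
  norm, and its value at \<open>\<phi>\<close> is at least \<open>norm \<phi>\<close>; it remains to
  normalise.\<close>

lemma bounded_functional_exists:
  fixes \<phi> :: "'a::real_normed_vector"
  assumes "\<phi> \<noteq> 0"
  shows "\<exists>l :: 'a \<Rightarrow> real. bounded_linear l \<and> l \<phi> = 1"
proof -
  have nrm: "sublinear (norm :: 'a \<Rightarrow> real)" unfolding sublinear_def by (simp add: norm_triangle_ineq)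
  define q where "q = lower_at norm \<phi>"
  have q: "sublinear q" unfolding q_def by (rule sublinear_lower_at[OF nrm])
  have q1: "q x \<le> norm x" for x using lower_at_le[OF nrm, of 0 \<phi> x] by (simp add: q_def)
  have q2: "q (- \<phi>) \<le> - norm \<phi>" using lower_at_le[OF nrm, of 1 \<phi> "- \<phi>"] by (simp add: q_def)
  obtain p where p: "sublinear p" "p \<le> q" "\<forall>p'. sublinear p' \<and> p' \<le> p \<longrightarrow> p' = p"
    using minimal_sublinear_exists[OF q] by (elim exE conjE) (rule that)
  note P = sublinearD[OF p(1)]
  have add: "p (x + y) = p x + p y" for x y
  proof -
    \<comment> \<open>By minimality, lowering at \<open>y\<close> changes nothing; the choice
      \<open>t = 1\<close> then gives superadditivity.\<close>
    have "lower_at p y \<le> p"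
      by (rule le_funI) (use lower_at_le[OF p(1), of 0 y] in simp)
    then have "lower_at p y = p" using p(3) sublinear_lower_at[OF p(1)] by simp
    then have "p x \<le> p (x + y) - p y" using lower_at_le[OF p(1), of 1 y x] by simp
    then show ?thesis using P(1)[of x y] by simp
  qed
  have neg: "p (- x) = - p x" for x using add[of x "- x"] P(3) by simp
  have scale: "p (c *\<^sub>R x) = c * p x" for c x
  proof (cases "c \<ge> 0")
    case False
    then have "p ((- c) *\<^sub>R x) = (- c) * p x" by (intro P(2)) simp
    then show ?thesis using neg[of "c *\<^sub>R x"] by simp
  qed (rule P(2))
  have ple: "p x \<le> norm x" for x using le_funD[OF p(2), of x] q1[of x] by simp
  have abs: "\<bar>p x\<bar> \<le> norm x" for x using ple[of x] ple[of "- x"] neg[of x] by simp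
  have "bounded_linear p"
    by (rule bounded_linear_intro[where K = 1]) (use add scale abs in simp_all)
  moreover have "p \<phi> > 0"
    using le_funD[OF p(2), of "- \<phi>"] q2 neg[of \<phi>] assms zero_less_norm_iff[of \<phi>] by linarith
  ultimately show ?thesis
    by (intro exI[of _ "\<lambda>x. p x / p \<phi>"]) (simp add: bounded_linear_compose[OF bounded_linear_divide])
qed

section \<open>The bounded inverse theorem\<close>

lemma approx_preimage:
  fixes T :: "'a::banach \<Rightarrow> 'b::banach"
  assumes T: "bounded_linear T" and surj: "surj T"
  shows "\<exists>K\<ge>0. \<forall>v e. e > 0 \<longrightarrow> (\<exists>u. norm u \<le> K * norm v \<and> norm (T u - v) < e)"
proof -
  have lin: "linear T" using T by (rule bounded_linear.linear)
  \<comment> \<open>Surjectivity makes these closed sets cover the target, so by Baire one of them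
    has interior points.\<close>
  define \<T> where "\<T> = range (\<lambda>n::nat. closure (T ` cball 0 (real n)))"
  have "\<Union>\<T> = UNIV"
  proof -
    have "v \<in> \<Union>\<T>" for v
    proof -
      obtain u where u: "v = T u" using surj by (rule surjE)
      obtain n :: nat where "norm u \<le> real n" using real_arch_simple by blast
      then have "v \<in> T ` cball 0 (real n)" using u by simp
      then have "v \<in> closure (T ` cball 0 (real n))" by (rule subsetD[OF closure_subset])
      moreover have "closure (T ` cball 0 (real n)) \<in> \<T>" unfolding \<T>_def by (rule rangeI)
      ultimately show ?thesis by (rule UnionI[rotated])
    qed
    then show ?thesis by (intro UNIV_eq_I[symmetric])
  qed
  then have "interior (\<Union>\<T>) \<noteq> {}" by simp
  moreover have "countable \<T>" "\<And>S. S \<in> \<T> \<Longrightarrow> closed S" unfolding \<T>_def by auto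
  ultimately obtain S where S: "S \<in> \<T>" "interior S \<noteq> {}"
    by (metis Baire_closed_interior)
  then obtain n :: nat where n: "interior (closure (T ` cball 0 (real n))) \<noteq> {}" unfolding \<T>_def by blast
  then obtain y0 d where d: "d > 0" "ball y0 d \<subseteq> closure (T ` cball 0 (real n))"
    by (meson all_not_in_conv mem_interior)
  \<comment> \<open>Both \<open>y0 + v\<close> and \<open>y0\<close> are nearly attained on the ball
    of radius \<open>n\<close>; the difference of the approximate preimages has norm at most
    \<open>2 n\<close>.\<close>
  have small: "\<exists>u. norm u \<le> 2 * real n \<and> norm (T u - v) < e" if v: "norm v < d" and e: "e > 0" for v e
  proof -
    have 1: "y0 + v \<in> closure (T ` cball 0 (real n))" and 2: "y0 \<in> closure (T ` cball 0 (real n))"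
      using d v by (auto simp: dist_norm subset_iff)
    obtain a where a: "a \<in> cball 0 (real n)" "dist (T a) (y0 + v) < e / 2"
      using 1[unfolded closure_approachable, rule_format, of "e / 2"] e by auto
    obtain b where b: "b \<in> cball 0 (real n)" "dist (T b) y0 < e / 2"
      using 2[unfolded closure_approachable, rule_format, of "e / 2"] e by auto
    have "norm (a - b) \<le> 2 * real n" using a(1) b(1) norm_triangle_ineq4[of a b] by simp
    moreover have "T (a - b) - v = (T a - (y0 + v)) - (T b - y0)" by (simp add: linear_diff[OF lin])
    then have "norm (T (a - b) - v) \<le> norm (T a - (y0 + v)) + norm (T b - y0)"
      using norm_triangle_ineq4[of "T a - (y0 + v)" "T b - y0"] by (simp only:)
    then have "norm (T (a - b) - v) < e" using a(2) b(2) by (simp add: dist_norm)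
    ultimately show ?thesis by blast
  qed
  show ?thesis
  proof (intro exI[of _ "4 * real n / d"] conjI allI impI)
    show "0 \<le> 4 * real n / d" using d by simp
    fix v :: 'b and e :: real assume e: "e > 0"
    show "\<exists>u. norm u \<le> 4 * real n / d * norm v \<and> norm (T u - v) < e"
    proof (cases "v = 0")
      case True then show ?thesis using e linear_0[OF lin] by (intro exI[of _ 0]) simp
    next
      case False
      \<comment> \<open>Scaling brings \<open>v\<close> to norm \<open>d / 2\<close>, inside the
        ball; undoing it turns \<open>2 n\<close> into \<open>4 n / d * norm v\<close>.\<close>
      define c where "c = d / (2 * norm v)"
      have c: "c > 0" using d False by (simp add: c_def)
      have "norm (c *\<^sub>R v) < d" using False d by (simp add: c_def)
      then obtain u where u: "norm u \<le> 2 * real n" "norm (T u - c *\<^sub>R v) < c * e"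
        using small[of "c *\<^sub>R v" "c * e"] c e by auto
      have "norm (u /\<^sub>R c) = norm u / c" using c by (simp add: divide_inverse mult.commute)
      also have "\<dots> \<le> 2 * real n / c" using u(1) c by (simp add: divide_right_mono)
      also have "\<dots> = 4 * real n / d * norm v" using False d by (simp add: c_def)
      finally have 1: "norm (u /\<^sub>R c) \<le> 4 * real n / d * norm v" .
      have "T (u /\<^sub>R c) - v = (T u - c *\<^sub>R v) /\<^sub>R c" using c by (simp add: linear_scale[OF lin] algebra_simps)
      then have "norm (T (u /\<^sub>R c) - v) = norm (T u - c *\<^sub>R v) / c" using c by (simp add: divide_inverse mult.commute)
      then have "norm (T (u /\<^sub>R c) - v) < e" using u(2) c by (simp add: divide_less_eq mult.commute)
      with 1 show ?thesis by blast
    qed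
  qed
qed

text \<open>Repeated approximate solving halves the residual each time, so the corrections form a
  series of total norm at most \<open>2 * K * norm v\<close> whose sum is the exact
  preimage.\<close>

lemma bounded_inverse_theorem:
  fixes T :: "'a::banach \<Rightarrow> 'b::banach"
  assumes T: "bounded_linear T" and bij: "bij T"
  shows "bounded_linear (inv T)"
proof -
  have lin: "linear T" using T by (rule bounded_linear.linear)
  obtain K where K: "K \<ge> 0" "\<forall>v e. e > 0 \<longrightarrow> (\<exists>u. norm u \<le> K * norm v \<and> norm (T u - v) < e)"
    using approx_preimage[OF T bij_is_surj[OF bij]] by blast
  have "\<exists>u. norm u \<le> K * norm v \<and> norm (v - T u) \<le> norm v / 2" for v
  proof (cases "v = 0")
    case True then show ?thesis using linear_0[OF lin] by (intro exI[of _ 0]) simp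
  next
    case False
    then obtain u where "norm u \<le> K * norm v" "norm (T u - v) < norm v / 2"
      using K(2)[rule_format, of "norm v / 2" v] by auto
    then show ?thesis by (intro exI[of _ u]) (simp add: norm_minus_commute)
  qed
  then have "\<forall>v. \<exists>u. norm u \<le> K * norm v \<and> norm (v - T u) \<le> norm v / 2" by blast
  from choice[OF this] obtain s where s: "\<forall>v. norm (s v) \<le> K * norm v \<and> norm (v - T (s v)) \<le> norm v / 2" ..
  have bound: "norm (inv T v) \<le> norm v * (2 * K)" for v
  proof -
    define r where "r k = ((\<lambda>w. w - T (s w)) ^^ k) v" for k
    have r0: "r 0 = v" and rS: "r (Suc k) = r k - T (s (r k))" for k by (simp_all add: r_def)
    have rn: "norm (r k) \<le> norm v * (1/2) ^ k" for k
    proof (induction k)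
      case (Suc k)
      have "norm (r (Suc k)) \<le> norm (r k) / 2" using spec[OF s, of "r k"] by (simp add: rS)
      with Suc show ?case by simp
    qed (simp add: r0)
    have sn: "norm (s (r k)) \<le> K * norm v * (1/2) ^ k" for k
      using spec[OF s, of "r k"] mult_left_mono[OF rn K(1), of k] by (simp add: mult.assoc)
    have g: "(\<lambda>k. K * norm v * (1/2) ^ k) sums (K * norm v * (1 / (1 - 1/2)))"
      by (rule sums_mult, rule geometric_sums) simp
    have sum: "summable (\<lambda>k. norm (s (r k)))"
      by (rule summable_comparison_test[OF _ sums_summable[OF g]]) (use sn in auto)
    define u where "u = (\<Sum>k. s (r k))"
    have su: "(\<lambda>k. s (r k)) sums u" unfolding u_def using summable_norm_cancel[OF sum] by (rule summable_sums)
    have "(\<lambda>k. T (s (r k))) sums T u" by (rule bounded_linear.sums[OF T su])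
    moreover have "(\<lambda>k. T (s (r k))) sums (v - 0)"
    proof -
      have "r \<longlonglongrightarrow> 0"
        by (rule Lim_null_comparison[where g = "\<lambda>k. norm v * (1/2) ^ k"])
          (auto intro!: always_eventually rn tendsto_mult_right_zero LIMSEQ_power_zero)
      from telescope_sums'[OF this] show ?thesis by (simp add: rS r0)
    qed
    ultimately have "T u = v" using sums_unique2 by fastforce
    then have "inv T v = u" using bij by (metis bij_inv_eq_iff)
    moreover have "norm u \<le> (\<Sum>k. norm (s (r k)))" unfolding u_def by (rule summable_norm[OF sum])
    moreover have "(\<Sum>k. norm (s (r k))) \<le> K * norm v * (1 / (1 - 1/2))"
      unfolding sums_unique[OF g] by (rule suminf_le[OF sn sum sums_summable[OF g]])
    ultimately show ?thesis by (simp add: mult_ac)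
  qed
  have injT: "inj T" and surjT: "surj T" using bij by (simp_all add: bij_def)
  show ?thesis
  proof (rule bounded_linear_intro[where K = "2 * K"])
    show "inv T (x + y) = inv T x + inv T y" for x y
      by (rule inv_f_eq[OF injT]) (simp add: linear_add[OF lin] surj_f_inv_f[OF surjT])
    show "inv T (c *\<^sub>R x) = c *\<^sub>R inv T x" for c x
      by (rule inv_f_eq[OF injT]) (simp add: linear_scale[OF lin] surj_f_inv_f[OF surjT])
  qed (rule bound)
qed

text \<open>\<open>codim\<close> refers to an arbitrarily chosen complement, while the Fredholm
  property only names some finite-dimensional one. Projection along \<open>W\<close> embeds the span
  of \<open>B\<close> into the latter.\<close>

lemma linear_complement_basis_finite:
  fixes W :: "'a::real_vector set"
  assumes W: "subspace W" and C: "linear_complement W C" and C0: "linear_complement W C0" "finite_dim C0"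
    and B: "independent B" "B \<subseteq> C"
  shows "finite B"
proof -
  obtain B0 where B0: "finite B0" "C0 \<subseteq> span B0" using C0(2) unfolding finite_dim_def by blast
  have "\<forall>b. \<exists>c. c \<in> C0 \<and> b - c \<in> W"
  proof
    fix b
    obtain w c where "w \<in> W" "c \<in> C0" "b = w + c" using C0(1) unfolding linear_complement_def by blast
    then show "\<exists>c. c \<in> C0 \<and> b - c \<in> W" by (intro exI[of _ c]) simp
  qed
  from choice[OF this] obtain c where c: "\<forall>b. c b \<in> C0 \<and> b - c b \<in> W" ..
  obtain g where g: "linear g" "\<forall>b\<in>B. g b = c b" using linear_independent_extend[OF B(1)] by blast
  \<comment> \<open>\<open>g\<close> changes vectors only by elements of \<open>W\<close>, so its
    kernel on the span of \<open>B\<close> lies in \<open>W \<inter> C = {0}\<close>.\<close>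
  have gW: "x - g x \<in> W" if "x \<in> span B" for x
    using that
  proof (induction rule: span_induct)
    case base
    show ?case unfolding subspace_def
    proof (intro conjI ballI allI)
      show "0 \<in> {a. a - g a \<in> W}" using subspace_0[OF W] linear_0[OF g(1)] by simp
      show "x + y \<in> {a. a - g a \<in> W}" if "x \<in> {a. a - g a \<in> W}" "y \<in> {a. a - g a \<in> W}" for x y
        using subspace_add[OF W, of "x - g x" "y - g y"] that by (simp add: linear_add[OF g(1)] algebra_simps)
      show "k *\<^sub>R x \<in> {a. a - g a \<in> W}" if "x \<in> {a. a - g a \<in> W}" for k x
        using subspace_scale[OF W, of "x - g x" k] that by (simp add: linear_scale[OF g(1)] algebra_simps)
    qed
  next
    case (step x)
    then show ?case using c g(2) by simp
  qed
  have sp: "span B \<subseteq> C" using C B(2) unfolding linear_complement_def by (simp add: span_minimal)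
  have "inj_on g (span B)"
  proof (rule inj_onI)
    fix x y assume xy: "x \<in> span B" "y \<in> span B" "g x = g y"
    then have d: "x - y \<in> span B" by (simp add: span_diff)
    have "x - y \<in> W" using gW[OF d] xy(3) by (simp add: linear_diff[OF g(1)])
    then have "x - y \<in> W \<inter> C" using d sp by blast
    then show "x = y" using C unfolding linear_complement_def by simp
  qed
  note inj = this
  have ind: "independent (g ` B)" by (rule linear_independent_injective_image[OF g(1) B(1) inj])
  have "g ` B \<subseteq> span B0"
  proof
    fix y assume "y \<in> g ` B"
    then obtain b where "b \<in> B" "y = g b" by (rule imageE)
    then show "y \<in> span B0" using g(2) c B0(2) by auto
  qed
  then have "finite (g ` B)" using independent_span_bound[OF B0(1) ind] by simp
  then show ?thesis using finite_imageD[OF _ inj_on_subset[OF inj span_superset]] by simp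
qed

text \<open>When the kernel is trivial, \<open>l = 0\<close> and \<open>\<psi> = 0\<close>; otherwise \<open>l\<close> is nonzero on the kernel and \<open>\<psi>\<close>
  spans a complement of the range.\<close>

lemma fredholm_index_zero_bordered:
  fixes L :: "'u::banach \<Rightarrow> 'v::banach"
  assumes F: "fredholm L" "fredholm_index L = 0" and N: "dim (null_space L) \<in> {0, 1}"
  shows "\<exists>(l :: 'u \<Rightarrow> real) \<psi> K. bounded_linear l \<and> bounded_linear K \<and>
    (\<forall>w. K (L w + l w *\<^sub>R \<psi>) = w) \<and> (\<forall>v. L (K v) + l (K v) *\<^sub>R \<psi> = v)"
proof -
  have L: "bounded_linear L" and fin: "finite_dim (null_space L)" using F(1) unfolding fredholm_def by auto
  have lin: "linear L" using L by (rule bounded_linear.linear)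
  obtain C0 where C0: "linear_complement (range L) C0" "finite_dim C0"
    using F(1) unfolding fredholm_def by blast
  have W: "subspace (range L)" using linear_subspace_image[OF lin subspace_UNIV] .
  define C where "C = (SOME C. linear_complement (range L) C)"
  have C: "linear_complement (range L) C" unfolding C_def by (rule someI, rule C0(1))
  have dC: "dim C = dim (null_space L)" using F(2) unfolding fredholm_index_def codim_def C_def by simp
  obtain B where B: "B \<subseteq> C" "independent B" "C \<subseteq> span B" "card B = dim C" by (rule basis_exists)
  \<comment> \<open>\<open>card\<close> is 0 on infinite sets, so \<open>card B = dim C\<close>
    describes the size of \<open>B\<close> only once \<open>B\<close> is known to be finite.\<close>
  have fB: "finite B" by (rule linear_complement_basis_finite[OF W C C0 B(2,1)])
  obtain E where E: "E \<subseteq> null_space L" "independent E" "null_space L \<subseteq> span E" "card E = dim (null_space L)"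
    by (rule basis_exists)
  obtain E0 where "finite E0" "null_space L \<subseteq> span E0" using fin unfolding finite_dim_def by blast
  then have fE: "finite E" using independent_span_bound[of E0 E] E(1,2) by blast
  have border: ?thesis
    if l: "bounded_linear l" and inj: "\<And>w. L w + l w *\<^sub>R \<psi> = 0 \<Longrightarrow> w = 0"
      and surj: "\<And>v. \<exists>w. v = L w + l w *\<^sub>R \<psi>" for l :: "'u \<Rightarrow> real" and \<psi>
  proof -
    define T where "T w = L w + l w *\<^sub>R \<psi>" for w
    have T: "bounded_linear T"
      unfolding T_def by (intro bounded_linear_add L bounded_linear_compose[OF bounded_linear_scaleR_left l])
    have "inj T" using inj unfolding linear_injective_0[OF bounded_linear.linear[OF T]] T_def by blast
    moreover have "surj T" using surj unfolding T_def surj_def by blast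
    ultimately have bij: "bij T" by (simp add: bij_def)
    show ?thesis
      using l bounded_inverse_theorem[OF T bij] bij
      by (intro exI[of _ l] exI[of _ \<psi>] exI[of _ "inv T"])
        (simp add: T_def[symmetric] bij_is_inj bij_is_surj surj_f_inv_f inv_f_f)
  qed
  show ?thesis
  proof (cases "dim (null_space L) = 0")
    case True
    then have "E = {}" "B = {}" using fE fB E(4) B(4) dC by auto
    then have nul: "null_space L \<subseteq> {0}" and "C \<subseteq> {0}" using E(3) B(3) by auto
    then have surj: "\<exists>w. v = L w" for v
    proof -
      obtain w c where "w \<in> range L" and c: "c \<in> C" and v: "v = w + c"
        using C unfolding linear_complement_def by blast
      then obtain w' where "w = L w'" by blast
      moreover have "c = 0" using c \<open>C \<subseteq> {0}\<close> by blast
      ultimately show ?thesis using v by (intro exI[of _ w']) simp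
    qed
    show ?thesis
      by (rule border[of "\<lambda>_. 0" 0]) (use nul surj in \<open>auto simp: null_space_def\<close>)
  next
    case False
    then have one: "dim (null_space L) = 1" using N by auto
    obtain \<phi> where \<phi>: "E = {\<phi>}" using E(4) one card_1_singletonE by metis
    obtain \<psi> where \<psi>: "B = {\<psi>}" using B(4) dC one card_1_singletonE by metis
    have \<phi>0: "\<phi> \<noteq> 0" "L \<phi> = 0" using E(1,2) \<phi> by (auto simp: null_space_def)
    have \<psi>0: "\<psi> \<noteq> 0" using B(2) \<psi> by auto
    have nul: "\<exists>c. w = c *\<^sub>R \<phi>" if "L w = 0" for w
      using E(3) \<phi> that by (auto simp: null_space_def span_singleton)
    have subC: "subspace C" and trivial: "range L \<inter> C = {0}" using C unfolding linear_complement_def by auto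
    obtain l where l: "bounded_linear l" "l \<phi> = (1::real)" using bounded_functional_exists[OF \<phi>0(1)] by blast
    note ll = bounded_linear.linear[OF l(1)]
    show ?thesis
    proof (rule border[OF l(1), of \<psi>])
      fix w assume w: "L w + l w *\<^sub>R \<psi> = 0"
      have "\<psi> \<in> C" using B(1) \<psi> by simp
      then have "- (l w *\<^sub>R \<psi>) \<in> C" by (intro subspace_neg[OF subC] subspace_scale[OF subC])
      moreover have "L w = - (l w *\<^sub>R \<psi>)" using w by (simp add: eq_neg_iff_add_eq_0)
      ultimately have "L w \<in> C" by simp
      then have "L w \<in> range L \<inter> C" by (rule IntI[OF rangeI])
      then have Lw: "L w = 0" using trivial by blast
      then have "l w = 0" using w \<psi>0 by simp
      then show "w = 0" using nul[OF Lw] l(2) linear_scale[OF ll] by auto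
    next
      fix v
      obtain w c where wc: "v = L w + c" "c \<in> C" using C unfolding linear_complement_def by blast
      then obtain k where k: "c = k *\<^sub>R \<psi>" using B(3) \<psi> by (auto simp: span_singleton)
      \<comment> \<open>Moving along the kernel direction sets \<open>l\<close> to the required
        \<open>k\<close> without changing the value of \<open>L\<close>.\<close>
      have "v = L (w + (k - l w) *\<^sub>R \<phi>) + l (w + (k - l w) *\<^sub>R \<phi>) *\<^sub>R \<psi>"
        using wc(1) k \<phi>0(2) l(2) by (simp add: linear_add[OF lin] linear_scale[OF lin] linear_add[OF ll] linear_scale[OF ll])
      then show "\<exists>w. v = L w + l w *\<^sub>R \<psi>" by blast
    qed
  qed
qed

section \<open>The implicit function as a fixed point in the power series norm\<close>

text \<open>The nonlinear part of an expansion; by \<open>mtail_has_sum\<close> the sum exists for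
  \<open>norm g < r\<close>.\<close>

definition mtail :: "(nat \<Rightarrow> (nat \<Rightarrow> 'a::real_normed_vector) \<Rightarrow> 'b::real_normed_vector) \<Rightarrow> 'a \<Rightarrow> 'b" where
  "mtail m g = infsum (\<lambda>j. m (j + 2) (\<lambda>_. g)) UNIV"

lemma has_sum_geometric_real:
  fixes q :: real
  assumes "0 \<le> q" "q < 1"
  shows "((\<lambda>j. q ^ j) has_sum (1 / (1 - q))) UNIV"
  by (rule norm_summable_imp_has_sum) (use assms geometric_sums[of q] in \<open>auto simp: summable_geometric\<close>)

lemma mtail_has_sum:
  fixes m :: "nat \<Rightarrow> (nat \<Rightarrow> 'a::banach) \<Rightarrow> 'b::banach"
  assumes "r > 0" "\<forall>k x. r ^ k * norm (m k x) \<le> M * (\<Prod>i<k. norm (x i))" "norm g < r"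
  shows "((\<lambda>j. m (j + 2) (\<lambda>_. g)) has_sum mtail m g) UNIV"
proof -
  define q where "q = norm g / r"
  have q: "0 \<le> q" "q < 1" using assms(1,3) by (simp_all add: q_def)
  have "((\<lambda>j. M * q^2 * q ^ j) has_sum (M * q^2 * (1 / (1 - q)))) UNIV"
    by (rule has_sum_cmult_right[OF has_sum_geometric_real[OF q]])
  then have "(\<lambda>j. norm (m (j + 2) (\<lambda>_. g))) summable_on UNIV"
  proof (intro Infinite_Sum.abs_summable_on_comparison_test'[OF has_sum_imp_summable])
    fix j
    show "norm (m (j + 2) (\<lambda>_. g)) \<le> M * q^2 * q ^ j"
      using multilinear_term_bound[OF assms(1,2), of "j + 2" g] unfolding q_def power_add by (simp only: mult_ac)
  qed
  from abs_summable_summable[OF this] show ?thesis unfolding mtail_def by simp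
qed

text \<open>The series starts in degree two, so its Lipschitz constant on series of norm
  \<open>R\<close> is proportional to \<open>R\<close> and can be made small.\<close>

lemma mtail_contraction:
  fixes m :: "nat \<Rightarrow> (nat \<Rightarrow> 'a::banach) \<Rightarrow> 'b::banach"
  assumes "r > 0" and sm: "\<forall>k. symmetric_multilinear k (m k)"
    and bd: "\<forall>k x. r ^ k * norm (m k x) \<le> M * (\<Prod>i<k. norm (x i))"
    and R: "R > 0" "R \<le> r / 4" and "\<rho> > 0"
    and g: "pser \<rho> g R" and h: "pser \<rho> h R" and d: "pser \<rho> (\<lambda>z. g z - h z) D"
  shows "pser \<rho> (\<lambda>z. mtail m (g z) - mtail m (h z)) (8 * M * R / r^2 * D)"
proof -
  have M: "M \<ge> 0"
    using spec[OF spec[OF bd, of 0], of "\<lambda>_. 0"] norm_ge_zero[of "m 0 (\<lambda>_. 0)"] by (simp del: norm_ge_zero)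
  have D: "D \<ge> 0" by (rule pser_nonneg[OF \<open>\<rho> > 0\<close> d])
  define q where "q = R / r"
  have q: "0 \<le> q" "q \<le> 1/4" using R assms(1) by (simp_all add: q_def pos_divide_le_eq)
  have bdk: "norm (m k x) \<le> (M / r ^ k) * (\<Prod>i<k. norm (x i))" for k x
    using spec[OF spec[OF bd, of k], of x] assms(1) by (simp add: field_simps)
  have "pser \<rho> (\<lambda>z. mtail m (g z) - mtail m (h z)) ((2 * M / r * D * (2 * q)) * (1 / (1 - 2 * q)))"
  proof (rule pser_sum[OF \<open>\<rho> > 0\<close>])
    fix j :: nat
    let ?k = "j + 2"
    have "pser \<rho> (\<lambda>z. m ?k (\<lambda>_. g z) - m ?k (\<lambda>_. h z)) (real ?k * (M / r ^ ?k) * R ^ (?k - 1) * D)"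
      by (rule pser_multilinear_diff[OF \<open>\<rho> > 0\<close> spec[OF sm] _ bdk g h d]) (use M assms(1) in simp)
    moreover have "real ?k * (M / r ^ ?k) * R ^ (?k - 1) * D \<le> (2 * M / r * D * (2 * q)) * (2 * q) ^ j"
    proof -
      \<comment> \<open>The factor \<open>?k\<close> from the telescoping is absorbed by
        \<open>2 ^ ?k\<close>; the ratio becomes \<open>2 * q\<close>, at most 1/2 because
        \<open>R \<le> r / 4\<close>.\<close>
      have "real ?k \<le> 2 ^ ?k" using less_exp[of ?k] by (metis less_imp_le of_nat_le_iff of_nat_numeral of_nat_power)
      then have "real ?k * ((M / r * D) * q ^ (j + 1)) \<le> 2 ^ ?k * ((M / r * D) * q ^ (j + 1))"
        using M assms(1) D q by (intro mult_right_mono) auto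
      moreover have eq: "(M / r ^ ?k) * R ^ (?k - 1) = M / r * q ^ (j + 1)"
        using assms(1) by (simp add: q_def power_divide)
      have "real ?k * (M / r ^ ?k) * R ^ (?k - 1) * D = real ?k * ((M / r * D) * q ^ (j + 1))"
        using arg_cong[OF eq, of "\<lambda>t. real ?k * t * D"] by (simp only: mult_ac)
      moreover have "2 ^ ?k * ((M / r * D) * q ^ (j + 1)) = (2 * M / r * D * (2 * q)) * (2 * q) ^ j"
        by (simp add: mult_ac power_mult_distrib power_add)
      ultimately show ?thesis by (simp only:)
    qed
    ultimately show "pser \<rho> (\<lambda>z. m ?k (\<lambda>_. g z) - m ?k (\<lambda>_. h z)) ((2 * M / r * D * (2 * q)) * (2 * q) ^ j)"
      by (rule pser_mono)
    show "((\<lambda>j. (2 * M / r * D * (2 * q)) * (2 * q) ^ j) has_sum (2 * M / r * D * (2 * q)) * (1 / (1 - 2 * q))) UNIV"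
      by (rule has_sum_cmult_right[OF has_sum_geometric_real]) (use q in auto)
    fix z assume z: "z \<in> box2 \<rho>"
    have "norm (g z) < r" "norm (h z) < r"
      using pser_norm_le[OF g z] pser_norm_le[OF h z] R assms(1) by auto
    from has_sum_add[OF mtail_has_sum[OF assms(1) bd this(1)] has_sum_scaleR[OF mtail_has_sum[OF assms(1) bd this(2)], of "-1"]]
    show "((\<lambda>j. m (j + 2) (\<lambda>_. g z) - m (j + 2) (\<lambda>_. h z)) has_sum (mtail m (g z) - mtail m (h z))) UNIV"
      by simp
  qed
  then show ?thesis
  proof (rule pser_mono)
    have "1 / (1 - 2 * q) \<le> 2" using q by (simp add: divide_le_eq)
    then have "(2 * M / r * D * (2 * q)) * (1 / (1 - 2 * q)) \<le> (2 * M / r * D * (2 * q)) * 2"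
      using M assms(1) D q by (intro mult_left_mono) auto
    then show "2 * M / r * D * (2 * q) * (1 / (1 - 2 * q)) \<le> 8 * M * R / r^2 * D"
      by (simp add: q_def power2_eq_square mult_ac)
  qed
qed

lemma D_u_eq:
  fixes F :: "real \<times> 'u::real_normed_vector \<Rightarrow> 'v::real_normed_vector"
  assumes "\<epsilon> > 0" "r > 0" "\<forall>k. symmetric_multilinear k (m k)"
    "\<forall>k x. r ^ k * norm (m k x) \<le> M * (\<Prod>i<k. norm (x i))"
    "\<forall>x \<in> ball (l0, u0) \<epsilon>. (\<lambda>k. m k (\<lambda>_. x - (l0, u0))) sums F x"
  shows "D_u F l0 u0 = (\<lambda>w. m 1 (\<lambda>_. (0, w)))"
proof -
  have "((\<lambda>w. (l0, w)) has_derivative (\<lambda>w. (0, w))) (at u0)"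
    by (intro has_derivative_Pair has_derivative_const has_derivative_ident)
  moreover have "(F has_derivative (\<lambda>h. m 1 (\<lambda>_. h))) (at ((\<lambda>w. (l0, w)) u0))"
    using power_series_has_derivative(1)[OF assms] by simp
  ultimately have "(F \<circ> (\<lambda>w. (l0, w)) has_derivative (\<lambda>h. m 1 (\<lambda>_. h)) \<circ> (\<lambda>w. (0, w))) (at u0)"
    by (rule diff_chain_at)
  then have "((\<lambda>w. F (l0, w)) has_derivative (\<lambda>w. m 1 (\<lambda>_. (0, w)))) (at u0)" by (simp add: o_def)
  from frechet_derivative_at[OF this] show ?thesis unfolding D_u_def by simp
qed

text \<open>Applying \<open>K\<close> turns the equation into \<open>h = T z h\<close>, where
  \<open>h\<close> enters \<open>T\<close> only through the nonlinear part of \<open>F\<close>.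
  Iteration on whole power series makes the solution a power series; the same estimate for constant
  series gives a contraction at each point, hence uniqueness.\<close>

lemma bordered_implicit_function:
  fixes F :: "real \<times> 'u::banach \<Rightarrow> 'v::banach" and l :: "'u \<Rightarrow> real"
  assumes F: "analytic_map_at F (l0, u0)" "F (l0, u0) = 0"
    and l: "bounded_linear l" and K: "bounded_linear K"
    and KL: "\<And>w. K (D_u F l0 u0 w + l w *\<^sub>R \<psi>) = w"
    and LK: "\<And>v. D_u F l0 u0 (K v) + l (K v) *\<^sub>R \<psi> = v"
  shows "\<exists>\<rho> R w. \<rho> > 0 \<and> R > 0 \<and> pser \<rho> w R \<and> w (0, 0) = 0 \<and>
    (\<forall>z\<in>box2 \<rho>. \<forall>h. norm h \<le> R \<longrightarrow>
      (F (l0 + fst z, u0 + h) + l h *\<^sub>R \<psi> = snd z *\<^sub>R \<psi> \<longleftrightarrow> h = w z))"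
proof -
  obtain m \<epsilon> r M where m: "\<epsilon> > 0" "r > 0" "\<forall>k. symmetric_multilinear k (m k)"
    "\<forall>k x. r ^ k * norm (m k x) \<le> M * (\<Prod>i<k. norm (x i))"
    "\<forall>x \<in> ball (l0, u0) \<epsilon>. (\<lambda>k. m k (\<lambda>_. x - (l0, u0))) sums F x"
    by (rule analytic_map_atE[OF F(1)])
  define L where "L w = m 1 (\<lambda>_. (0, w))" for w
  define e where "e = m 1 (\<lambda>_. (1, 0))"
  have DL: "D_u F l0 u0 = L" unfolding L_def by (rule D_u_eq[OF m])
  have M: "M \<ge> 0"
    using spec[OF spec[OF m(4), of 0], of "\<lambda>_. 0"] norm_ge_zero[of "m 0 (\<lambda>_. 0)"] by (simp del: norm_ge_zero)
  note der = power_series_has_derivative[OF m]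
  have lin1: "linear (\<lambda>h. m 1 (\<lambda>_. h))" using has_derivative_bounded_linear[OF der(1)] by (rule bounded_linear.linear)
  have m1: "m 1 (\<lambda>_. (x, h)) = x *\<^sub>R e + L h" for x h
    using linear_add[OF lin1, of "x *\<^sub>R (1, 0)" "(0, h)"] linear_scale[OF lin1, of x "(1, 0)"]
    by (simp add: e_def L_def)
  have linL: "linear L"
    using linear_compose[of "\<lambda>w. (0::real, w)" "\<lambda>h. m 1 (\<lambda>_. h)", OF _ lin1]
    by (simp add: o_def L_def[abs_def] linear_iff)
  have linK: "linear K" and linl: "linear l" using K l by (simp_all add: bounded_linear.linear)
  obtain B where B: "B > 0" "\<And>v. norm (K v) \<le> B * norm v"
    using bounded_linear.pos_bounded[OF K] by (metis mult.commute)
  \<comment> \<open>The first bound is required by \<open>mtail_contraction\<close>, the second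
    keeps the arguments in the ball of convergence, the third gives
    \<open>B * \<kappa> \<le> 1/2\<close>; \<open>M + 1\<close> avoids a zero denominator.\<close>
  define R where "R = Min {r / 4, \<epsilon> / 2, r^2 / (16 * (M + 1) * B)}"
  have R: "R > 0" "R \<le> r / 4" "R < \<epsilon>" and R3: "R \<le> r^2 / (16 * (M + 1) * B)"
  proof -
    show "R > 0" unfolding R_def using m(1,2) M B(1) by (subst Min_gr_iff) (auto intro!: divide_pos_pos mult_pos_pos)
    have "R \<le> \<epsilon> / 2" unfolding R_def by (rule Min_le) auto
    then show "R < \<epsilon>" using m(1) by simp
  qed (unfold R_def, (rule Min_le; simp)+)
  define \<kappa> where "\<kappa> = 8 * M * R / r^2"
  have \<kappa>: "B * \<kappa> \<le> 1/2" "\<kappa> \<ge> 0"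
  proof -
    have "R * (16 * (M + 1) * B) \<le> r^2" using R3 M B(1) by (simp add: pos_le_divide_eq)
    moreover have "R * (16 * M * B) \<le> R * (16 * (M + 1) * B)" using R(1) B(1) by simp
    ultimately have "16 * M * R * B \<le> r^2" by (simp add: mult_ac)
    then show "B * \<kappa> \<le> 1/2" unfolding \<kappa>_def using m(2) by (simp add: field_simps)
    show "\<kappa> \<ge> 0" unfolding \<kappa>_def using M R(1) by simp
  qed
  define N where "N = mtail m"
  have N0: "N 0 = 0"
  proof -
    have "m (j + 2) (\<lambda>_. 0) = 0" for j using multilinear_term_bound[OF m(2,4), of "j + 2" 0] by simp
    then show ?thesis unfolding N_def mtail_def by simp
  qed
  have Fexp: "F (l0 + x, u0 + h) = x *\<^sub>R e + L h + N (x, h)" if "norm (x, h) \<le> R" for x h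
  proof -
    have "(l0 + x, u0 + h) \<in> ball (l0, u0) \<epsilon>" using that R(3) norm_minus_cancel[of "(x, h)"] by (simp add: dist_norm)
    from bspec[OF m(5) this] have s: "(\<lambda>k. m k (\<lambda>_. (x, h))) sums F (l0 + x, u0 + h)" by simp
    have "m 0 (\<lambda>_. (x, h)) = m 0 (\<lambda>_. 0)" by (rule symmetric_multilinear_indep[OF spec[OF m(3)]]) simp
    then have m0: "m 0 (\<lambda>_. (x, h)) = 0" using der(2) F(2) by simp
    have "(\<Sum>k<2. m k (\<lambda>_. (x, h))) = x *\<^sub>R e + L h" using m1[of x h] by (simp add: numeral_2_eq_2 m0)
    with sums_split_initial_segment[OF s, of 2]
    have "(\<lambda>k. m (k + 2) (\<lambda>_. (x, h))) sums (F (l0 + x, u0 + h) - (x *\<^sub>R e + L h))" by (simp only:)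
    moreover have "(\<lambda>k. m (k + 2) (\<lambda>_. (x, h))) sums N (x, h)"
      unfolding N_def by (rule has_sum_imp_sums, rule mtail_has_sum[OF m(2,4)]) (use that R m(2) in linarith)
    ultimately have "F (l0 + x, u0 + h) - (x *\<^sub>R e + L h) = N (x, h)" by (rule sums_unique2)
    then show ?thesis by (simp add: algebra_simps)
  qed
  define T where "T z h = snd z *\<^sub>R K \<psi> - fst z *\<^sub>R K e - K (N (fst z, h))" for z h
  have eqT: "F (l0 + fst z, u0 + h) + l h *\<^sub>R \<psi> = snd z *\<^sub>R \<psi> \<longleftrightarrow> h = T z h"
    if "norm (fst z, h) \<le> R" for z h
  proof -
    have "K (F (l0 + fst z, u0 + h) + l h *\<^sub>R \<psi>) = K ((L h + l h *\<^sub>R \<psi>) + (fst z *\<^sub>R e + N (fst z, h)))"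
      using Fexp[OF that] by (simp add: algebra_simps)
    also have "\<dots> = h + (fst z *\<^sub>R K e + K (N (fst z, h)))"
      using KL[of h] unfolding DL by (simp only: linear_add[OF linK] linear_scale[OF linK])
    finally have *: "K (F (l0 + fst z, u0 + h) + l h *\<^sub>R \<psi>) = h + (fst z *\<^sub>R K e + K (N (fst z, h)))" .
    \<comment> \<open>\<open>LK\<close> makes \<open>K\<close> injective, so applying it to both
      sides is an equivalence.\<close>
    have inj: "a = b" if "K a = K b" for a b
      by (rule trans[OF LK[of a, symmetric]]) (simp only: that LK)
    have "F (l0 + fst z, u0 + h) + l h *\<^sub>R \<psi> = snd z *\<^sub>R \<psi> \<longleftrightarrow>
        K (F (l0 + fst z, u0 + h) + l h *\<^sub>R \<psi>) = K (snd z *\<^sub>R \<psi>)"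
      by (rule iffI, erule arg_cong, erule inj)
    also have "\<dots> \<longleftrightarrow> h = T z h" unfolding * T_def linear_scale[OF linK] by (auto simp: algebra_simps)
    finally show ?thesis .
  qed
  \<comment> \<open>Chosen so that the first iterate has norm at most \<open>R / 4\<close>; the
    summand 1 pays for the nonlinear part, since
    \<open>B * \<kappa> * \<rho> \<le> \<rho>\<close>.\<close>
  define c0 where "c0 = norm (K \<psi>) + norm (K e) + 1"
  have c0: "c0 \<ge> 1" by (simp add: c0_def)
  define \<rho> where "\<rho> = R / (4 * c0)"
  have \<rho>: "\<rho> > 0" "\<rho> \<le> R / 2" and \<rho>c: "\<rho> * c0 = R / 4"
  proof -
    show "\<rho> > 0" using R(1) c0 by (simp add: \<rho>_def)
    show "\<rho> * c0 = R / 4" using c0 by (simp add: \<rho>_def)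
    have "\<rho> * 1 \<le> \<rho> * c0" using \<open>\<rho> > 0\<close> c0 by (intro mult_left_mono) auto
    then show "\<rho> \<le> R / 2" using \<open>\<rho> * c0 = R / 4\<close> R(1) by simp
  qed
  have pfst: "pser \<rho> (\<lambda>z. (fst z, 0::'u)) (1 * \<rho>)"
    by (rule pser_linear[OF bounded_linear_Pair[OF bounded_linear_ident bounded_linear_zero] _ \<rho>(1) pser_fst])
      (use \<rho>(1) in simp_all)
  have pair: "pser \<rho> (\<lambda>z. (fst z, w z)) R" if "pser \<rho> w C" "C \<le> R / 2" for w :: "real \<times> real \<Rightarrow> 'u" and C
  proof -
    have "pser \<rho> (\<lambda>z. (0::real, w z)) (1 * C)"
      by (rule pser_linear[OF bounded_linear_Pair[OF bounded_linear_zero bounded_linear_ident] _ \<rho>(1) that(1)]) simp_all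
    from pser_add[OF \<rho>(1) pfst this] have "pser \<rho> (\<lambda>z. (fst z, w z)) (1 * \<rho> + 1 * C)" by simp
    then show ?thesis by (rule pser_mono) (use that(2) \<rho>(2) in simp)
  qed
  have contr: "pser \<rho> (\<lambda>z. T z (w z) - T z (w' z)) (D / 2)"
    if w: "pser \<rho> w C" "C \<le> R / 2" "pser \<rho> w' C'" "C' \<le> R / 2" and d: "pser \<rho> (\<lambda>z. w z - w' z) D" for w w' C C' D
  proof -
    have "pser \<rho> (\<lambda>z. (0::real, w z - w' z)) (1 * D)"
      by (rule pser_linear[OF bounded_linear_Pair[OF bounded_linear_zero bounded_linear_ident] _ \<rho>(1) d]) simp_all
    then have "pser \<rho> (\<lambda>z. (fst z, w z) - (fst z, w' z)) D" by simp
    from mtail_contraction[OF m(2-4) R(1,2) \<rho>(1) pair[OF w(1,2)] pair[OF w(3,4)] this]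
    have "pser \<rho> (\<lambda>z. N (fst z, w z) - N (fst z, w' z)) (\<kappa> * D)" unfolding N_def \<kappa>_def .
    from pser_scale[OF \<rho>(1) pser_linear[OF K B(2) \<rho>(1) this], of "-1"] B(1)
    have "pser \<rho> (\<lambda>z. T z (w z) - T z (w' z)) (B * (\<kappa> * D))"
      unfolding T_def by (simp add: linear_diff[OF linK])
    then show ?thesis
    proof (rule pser_mono)
      show "B * (\<kappa> * D) \<le> D / 2"
        using mult_right_mono[OF \<kappa>(1) pser_nonneg[OF \<rho>(1) d]] by (simp add: mult.assoc)
    qed
  qed
  have T0: "pser \<rho> (\<lambda>z. T z 0) (R / 4)"
  proof -
    have 1: "pser \<rho> (\<lambda>z. (fst z, 0::'u)) R" by (rule pser_mono[OF pfst]) (use \<rho>(2) R(1) in simp)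
    have 2: "pser \<rho> (\<lambda>z. 0 :: real \<times> 'u) R" by (rule pser_mono[OF pser_zero]) (use R(1) in simp)
    have 3: "pser \<rho> (\<lambda>z. (fst z, 0::'u) - 0) (1 * \<rho>)" using pfst by simp
    from mtail_contraction[OF m(2-4) R(1,2) \<rho>(1) 1 2 3]
    have "pser \<rho> (\<lambda>z. N (fst z, 0)) (\<kappa> * \<rho>)" using N0 unfolding N_def \<kappa>_def by simp
    from pser_linear[OF K B(2) \<rho>(1) this] B(1)
    have 1: "pser \<rho> (\<lambda>z. K (N (fst z, 0))) (B * (\<kappa> * \<rho>))" by simp
    have "pser \<rho> (\<lambda>z. snd z *\<^sub>R K \<psi> - fst z *\<^sub>R K e - K (N (fst z, 0)))
        (\<rho> * norm (K \<psi>) + \<rho> * norm (K e) + B * (\<kappa> * \<rho>))"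
      by (intro pser_diff pser_scaleR \<rho>(1) pser_fst pser_snd pser_const 1) (use \<rho>(1) in simp_all)
    then show ?thesis unfolding T_def
    proof (rule pser_mono)
      have "B * (\<kappa> * \<rho>) \<le> \<rho>" using mult_right_mono[OF \<kappa>(1), of \<rho>] \<rho>(1) by (simp add: mult.assoc)
      then show "\<rho> * norm (K \<psi>) + \<rho> * norm (K e) + B * (\<kappa> * \<rho>) \<le> R / 4"
        using \<rho>c unfolding c0_def by (simp add: algebra_simps)
    qed
  qed
  define W where "W n z = ((T z) ^^ n) 0" for n z
  have W0: "W 0 z = 0" and WS: "W (Suc n) z = T z (W n z)" for n z by (simp_all add: W_def)
  have half: "R / 2 * (1 - (1/2) ^ n) \<le> R / 2" for n using R(1) by simp
  \<comment> \<open>The differences halve, so the norms stay below \<open>R / 2\<close>, the range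
    in which \<open>contr\<close> applies.\<close>
  have ind: "pser \<rho> (W n) (R / 2 * (1 - (1/2) ^ n)) \<and> pser \<rho> (\<lambda>z. W (Suc n) z - W n z) (R / 4 * (1/2) ^ n)" for n
  proof (induction n)
    case 0
    show ?case using T0 pser_zero[of \<rho>] by (simp add: W0[abs_def] WS W0)
  next
    case (Suc n)
    have "pser \<rho> (\<lambda>z. W n z + (W (Suc n) z - W n z)) (R / 2 * (1 - (1/2) ^ n) + R / 4 * (1/2) ^ n)"
      using pser_add[OF \<rho>(1)] Suc by blast
    then have 1: "pser \<rho> (W (Suc n)) (R / 2 * (1 - (1/2) ^ Suc n))" by (simp add: algebra_simps)
    have "pser \<rho> (\<lambda>z. T z (W (Suc n) z) - T z (W n z)) (R / 4 * (1/2) ^ n / 2)"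
      by (rule contr[OF 1 half conjunct1[OF Suc] half conjunct2[OF Suc]])
    then have "pser \<rho> (\<lambda>z. W (Suc (Suc n)) z - W (Suc n) z) (R / 4 * (1/2) ^ n / 2)" by (simp only: WS[symmetric])
    then show ?case using 1 by simp
  qed
  define w where "w z = infsum (\<lambda>n. W (Suc n) z - W n z) UNIV" for z
  have gs: "((\<lambda>n. R / 4 * (1/2) ^ n) has_sum (R / 4 * (1 / (1 - 1/2)))) UNIV"
    by (rule has_sum_cmult_right[OF has_sum_geometric_real]) auto
  have hw: "((\<lambda>n. W (Suc n) z - W n z) has_sum w z) UNIV" if z: "z \<in> box2 \<rho>" for z
  proof -
    have "(\<lambda>n. norm (W (Suc n) z - W n z)) summable_on UNIV"
      by (rule Infinite_Sum.abs_summable_on_comparison_test'[OF has_sum_imp_summable[OF gs]])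
        (use pser_norm_le[OF conjunct2[OF ind] z] in simp)
    from abs_summable_summable[OF this] show ?thesis unfolding w_def by simp
  qed
  have "pser \<rho> w (R / 4 * (1 / (1 - 1/2)))"
    by (rule pser_sum[OF \<rho>(1) conjunct2[OF ind] gs hw])
  then have pw: "pser \<rho> w (R / 2)" by simp
  have lim: "(\<lambda>n. W n z) \<longlonglongrightarrow> w z" if z: "z \<in> box2 \<rho>" for z
  proof -
    have "(\<Sum>k<n. W (Suc k) z - W k z) = W n z" for n
      using sum_lessThan_telescope[of "\<lambda>k. W k z" n] by (simp add: W0)
    then have "(\<lambda>n. \<Sum>k<n. W (Suc k) z - W k z) = (\<lambda>n. W n z)" by (rule ext)
    with has_sum_imp_sums[OF hw[OF z], unfolded sums_def] show ?thesis by (simp only:)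
  qed
  have pw_contr: "norm (T z h - T z h') \<le> norm (h - h') / 2"
    if "z \<in> box2 \<rho>" "norm h \<le> R / 2" "norm h' \<le> R / 2" for z h h'
  proof -
    have "pser \<rho> (\<lambda>z. T z h - T z h') (norm (h - h') / 2)"
      by (rule contr[OF pser_const that(2) pser_const that(3) pser_const])
    then show ?thesis by (rule pser_norm_le[OF _ that(1)])
  qed
  have wfix: "w z = T z (w z)" if z: "z \<in> box2 \<rho>" for z
  proof -
    have h1: "norm (W (Suc n) z - T z (w z)) \<le> norm (W n z - w z) / 2" for n
      unfolding WS using pser_norm_le[OF conjunct1[OF ind] z, of n] half[of n] pser_norm_le[OF pw z]
      by (intro pw_contr z) auto
    have h2: "(\<lambda>n. norm (W n z - w z) / 2) \<longlonglongrightarrow> 0"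
      using tendsto_divide[OF tendsto_norm_zero[OF LIM_zero[OF lim[OF z]]] tendsto_const[of 2]] by simp
    have "(\<lambda>n. W (Suc n) z - T z (w z)) \<longlonglongrightarrow> 0"
      by (rule Lim_null_comparison[OF always_eventually[OF allI[OF h1]] h2])
    then have "(\<lambda>n. W (Suc n) z) \<longlonglongrightarrow> T z (w z)" by (rule LIM_zero_cancel)
    with LIMSEQ_Suc[OF lim[OF z]] show ?thesis by (rule LIMSEQ_unique)
  qed
  have uniq: "h = w z" if z: "z \<in> box2 \<rho>" and h: "norm h \<le> R / 2" "h = T z h" for z h
  proof -
    have "norm (h - w z) \<le> norm (h - w z) / 2"
      using pw_contr[OF z h(1) pser_norm_le[OF pw z]] h(2) wfix[OF z] by simp
    then show ?thesis by simp
  qed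
  have nR: "norm (fst z, h) \<le> R" if "z \<in> box2 \<rho>" "norm h \<le> R / 2" for z h
    using that \<rho>(2) norm_Pair_le[of "fst z" h] unfolding box2_def by simp
  have "w (0, 0) = 0"
    using uniq[of "(0, 0)" 0] \<rho>(1) R(1) N0 linear_0[OF linK] by (simp add: zero_in_box2 T_def zero_prod_def)
  moreover have "F (l0 + fst z, u0 + h) + l h *\<^sub>R \<psi> = snd z *\<^sub>R \<psi> \<longleftrightarrow> h = w z"
    if z: "z \<in> box2 \<rho>" and h: "norm h \<le> R / 2" for z h
    unfolding eqT[OF nR[OF z h]] using uniq[OF z h] wfix[OF z] by metis
  ultimately show ?thesis
    using \<rho>(1) R(1) pw by (intro exI[of _ \<rho>] exI[of _ "R / 2"] exI[of _ w]) simp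
qed

section \<open>Germs of analytic functions at the origin of the plane\<close>

definition germ :: "(real \<times> real \<Rightarrow> 'w::banach) \<Rightarrow> bool" where
  "germ f \<longleftrightarrow> (\<exists>\<rho> C. \<rho> > 0 \<and> pser \<rho> f C)"

text \<open>A function of one variable is viewed as a function on the plane that ignores the second
  coordinate, so that one calculus serves both.\<close>

abbreviation germ1 :: "(real \<Rightarrow> 'w::banach) \<Rightarrow> bool" where
  "germ1 h \<equiv> germ (\<lambda>z. h (fst z))"

lemma germI: "\<rho> > 0 \<Longrightarrow> pser \<rho> f C \<Longrightarrow> germ f"
  unfolding germ_def by blast

lemma germE:
  assumes "germ f" obtains \<rho> C where "\<rho> > 0" "pser \<rho> f C"
  using assms unfolding germ_def by blast

lemma germ2E:
  assumes "germ f" "germ g"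
  obtains \<rho> C D where "\<rho> > 0" "pser \<rho> f C" "pser \<rho> g D"
proof -
  obtain \<rho>1 C where 1: "\<rho>1 > 0" "pser \<rho>1 f C" by (rule germE[OF assms(1)])
  obtain \<rho>2 D where 2: "\<rho>2 > 0" "pser \<rho>2 g D" by (rule germE[OF assms(2)])
  show ?thesis
    by (rule that[of "min \<rho>1 \<rho>2" C D])
      (use 1 2 pser_shrink[OF 1(2), of "min \<rho>1 \<rho>2"] pser_shrink[OF 2(2), of "min \<rho>1 \<rho>2"] in auto)
qed

lemma eventually_nhds_zero2:
  "eventually P (nhds ((0::real), (0::real))) \<longleftrightarrow> (\<exists>\<delta>>0. \<forall>x y. \<bar>x\<bar> < \<delta> \<longrightarrow> \<bar>y\<bar> < \<delta> \<longrightarrow> P (x, y))"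
proof
  assume "eventually P (nhds ((0::real), (0::real)))"
  then obtain d where d: "d > 0" "\<And>z. dist z (0,0) < d \<Longrightarrow> P z" unfolding eventually_nhds_metric by blast
  have "P (x, y)" if "\<bar>x\<bar> < d / 2" "\<bar>y\<bar> < d / 2" for x y
  proof (rule d(2))
    have "dist (x, y) (0, 0) \<le> \<bar>x\<bar> + \<bar>y\<bar>" using norm_Pair_le[of x y] by (simp add: dist_norm)
    then show "dist (x, y) (0, 0) < d" using that by linarith
  qed
  then show "\<exists>\<delta>>0. \<forall>x y. \<bar>x\<bar> < \<delta> \<longrightarrow> \<bar>y\<bar> < \<delta> \<longrightarrow> P (x, y)" using d(1) by (intro exI[of _ "d / 2"]) simp
next
  assume "\<exists>\<delta>>0. \<forall>x y. \<bar>x\<bar> < \<delta> \<longrightarrow> \<bar>y\<bar> < \<delta> \<longrightarrow> P (x, y)"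
  then obtain d where d: "d > 0" "\<forall>x y. \<bar>x\<bar> < d \<longrightarrow> \<bar>y\<bar> < d \<longrightarrow> P (x, y)" by blast
  have "P z" if "dist z (0, 0) < d" for z
  proof -
    have "\<bar>fst z\<bar> \<le> dist z (0, 0)" "\<bar>snd z\<bar> \<le> dist z (0, 0)"
      using norm_fst_le[of "fst z" "snd z"] norm_snd_le[of "snd z" "fst z"] by (simp_all add: dist_norm zero_prod_def[symmetric])
    then show ?thesis using d(2)[rule_format, of "fst z" "snd z"] that by simp
  qed
  then show "eventually P (nhds (0, 0))" unfolding eventually_nhds_metric using d(1) by blast
qed

lemma eventually_nhds_zero1:
  "eventually P (nhds (0::real)) \<longleftrightarrow> (\<exists>\<delta>>0. \<forall>x. \<bar>x\<bar> < \<delta> \<longrightarrow> P x)"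
  unfolding eventually_nhds_metric by (simp add: dist_norm)

lemma germ_const: "germ (\<lambda>_. c)" by (rule germI[OF zero_less_one pser_const])
lemma germ_fst: "germ fst" by (rule germI[OF zero_less_one pser_fst]) simp
lemma germ_snd: "germ snd" by (rule germI[OF zero_less_one pser_snd]) simp

lemma germ_add: "germ f \<Longrightarrow> germ g \<Longrightarrow> germ (\<lambda>z. f z + g z)"
  by (erule (1) germ2E) (rule germI, assumption, rule pser_add)
lemma germ_diff: "germ f \<Longrightarrow> germ g \<Longrightarrow> germ (\<lambda>z. f z - g z)"
  by (erule (1) germ2E) (rule germI, assumption, rule pser_diff)
lemma germ_scaleR: "germ f \<Longrightarrow> germ g \<Longrightarrow> germ (\<lambda>z. f z *\<^sub>R g z)"
  by (erule (1) germ2E) (rule germI, assumption, rule pser_scaleR)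
lemma germ_mult:
  fixes f g :: "real \<times> real \<Rightarrow> real"
  shows "germ f \<Longrightarrow> germ g \<Longrightarrow> germ (\<lambda>z. f z * g z)"
  using germ_scaleR[of f g] by simp
lemma germ_power:
  fixes f :: "real \<times> real \<Rightarrow> real"
  shows "germ f \<Longrightarrow> germ (\<lambda>z. f z ^ n)"
  by (erule germE) (rule germI, assumption, rule pser_power)
lemma germ_sum:
  assumes "finite A" "\<And>k. k \<in> A \<Longrightarrow> germ (f k)"
  shows "germ (\<lambda>z. \<Sum>k\<in>A. f k z)"
  using assms by (induction A rule: finite_induct) (simp_all add: germ_const germ_add)
lemma germ_linear:
  assumes "bounded_linear T" "germ f" shows "germ (\<lambda>z. T (f z))"
proof -
  obtain \<rho> C where p: "\<rho> > 0" "pser \<rho> f C" by (rule germE[OF assms(2)])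
  obtain B where "B > 0" "\<And>x. norm (T x) \<le> B * norm x"
    using bounded_linear.pos_bounded[OF assms(1)] by (metis mult.commute)
  from germI[OF p(1) pser_linear[OF assms(1) this(2) p less_imp_le[OF this(1)]]] show ?thesis .
qed

lemma germ_comp:
  assumes "germ f" "germ g1" "germ g2" "g1 (0,0) = 0" "g2 (0,0) = 0"
  shows "germ (\<lambda>z. f (g1 z, g2 z))"
proof -
  obtain \<rho> C where p: "\<rho> > 0" "pser \<rho> f C" by (rule germE[OF assms(1)])
  obtain \<sigma> D1 D2 where s: "\<sigma> > 0" "pser \<sigma> g1 D1" "pser \<sigma> g2 D2" by (rule germ2E[OF assms(2,3)])
  have D: "D1 \<ge> 0" "D2 \<ge> 0" using pser_nonneg[OF s(1)] s(2,3) by auto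
  \<comment> \<open>Shrinking the radius by \<open>c\<close> multiplies both inner norms by
    \<open>c\<close>, as the inner functions vanish at the origin; this \<open>c\<close> brings them
    down to at most \<open>\<rho>\<close>.\<close>
  define c where "c = \<rho> / (\<rho> + D1 + D2)"
  have c: "c > 0" "c \<le> 1" "c * D1 \<le> \<rho>" "c * D2 \<le> \<rho>"
  proof -
    have *: "\<rho> + D1 + D2 > 0" using p(1) D by simp
    show "c > 0" "c \<le> 1" unfolding c_def using p(1) D * by simp_all
    have "\<rho> * D1 \<le> \<rho> * (\<rho> + D1 + D2)" "\<rho> * D2 \<le> \<rho> * (\<rho> + D1 + D2)"
      using p(1) D by (auto intro!: mult_left_mono)
    then show "c * D1 \<le> \<rho>" "c * D2 \<le> \<rho>" unfolding c_def using * by (simp_all add: divide_le_eq)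
  qed
  define \<tau> where "\<tau> = c * \<sigma>"
  have t: "\<tau> > 0" "\<tau> \<le> \<sigma>" "\<tau> / \<sigma> = c" using c s(1) by (simp_all add: \<tau>_def mult_left_le_one_le)
  have "pser \<tau> g1 \<rho>" "pser \<tau> g2 \<rho>"
    using pser_mono[OF pser_shrink_zero[OF s(2) t(1,2) assms(4)]] pser_mono[OF pser_shrink_zero[OF s(3) t(1,2) assms(5)]] c(3,4)
    unfolding t(3) by auto
  from germI[OF t(1) pser_comp[OF p(1) t(1) p(2) this]] show ?thesis .
qed

lemma germ1_comp:
  assumes "germ1 f" "germ g" "g (0,0) = 0"
  shows "germ (\<lambda>z. f (g z))"
  using germ_comp[OF assms(1,2) germ_const[of 0] assms(3)] by simp

lemma germ_restrict_fst: "germ f \<Longrightarrow> germ1 (\<lambda>x. f (x, 0))"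
  using germ_comp[of f fst "\<lambda>_. 0"] germ_fst germ_const[of 0] by simp

lemma pser_isCont:
  assumes "pser \<rho> f C" "\<bar>fst z\<bar> < \<rho>" "\<bar>snd z\<bar> < \<rho>"
  shows "isCont f z"
  using analytic_map_at_imp_isCont[OF pser_imp_analytic_at[OF assms]] by simp

lemma germ_isCont: "germ f \<Longrightarrow> isCont f (0,0)"
  by (erule germE) (rule pser_isCont, assumption, simp_all)

lemma germ1_isCont: "germ1 h \<Longrightarrow> isCont h 0"
proof -
  assume "germ1 h"
  from germ_isCont[OF this] have 1: "isCont (\<lambda>z::real \<times> real. h (fst z)) (0, 0)" .
  have 2: "isCont (\<lambda>x. (x, 0::real)) (0::real)" by (intro continuous_intros)
  from isCont_o2[OF 2 1] show ?thesis by simp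
qed

lemma germ_tendsto_nhds: "germ f \<Longrightarrow> (f \<longlongrightarrow> f (0,0)) (nhds (0,0))"
  using germ_isCont[of f] by (simp add: isCont_def tendsto_nhds_iff)

lemma germ1_tendsto_nhds: "germ1 h \<Longrightarrow> (h \<longlongrightarrow> h 0) (nhds 0)"
  using germ1_isCont[of h] by (simp add: isCont_def tendsto_nhds_iff)

lemma germ_div_snd:
  assumes "germ f"
  shows "\<exists>g. germ g \<and> (\<forall>\<^sub>F z in nhds (0,0). f z = f (fst z, 0) + snd z *\<^sub>R g z)"
proof -
  obtain \<rho> C where p: "\<rho> > 0" "pser \<rho> f C" by (rule germE[OF assms])
  obtain g where g: "pser \<rho> g (C / \<rho>)" "\<forall>z\<in>box2 \<rho>. f z = f (fst z, 0) + snd z *\<^sub>R g z"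
    using pser_div_snd[OF p] by (elim exE conjE) (rule that)
  have "\<forall>\<^sub>F z in nhds (0,0). f z = f (fst z, 0) + snd z *\<^sub>R g z"
    unfolding eventually_nhds_zero2
    by (intro exI[of _ \<rho>] conjI allI impI p(1) bspec[OF g(2)]) (simp add: box2_def)
  then show ?thesis using germI[OF p(1) g(1)] by blast
qed

section \<open>Order of vanishing in one variable\<close>

lemma pser1_div:
  assumes "\<rho> > 0" "pser \<rho> (\<lambda>z. h (fst z)) C"
  shows "\<exists>g. pser \<rho> (\<lambda>z. g (fst z)) (C / \<rho>) \<and> (\<forall>x. \<bar>x\<bar> \<le> \<rho> \<longrightarrow> h x = h 0 + x *\<^sub>R g x)"
proof -
  have r0: "\<rho> \<ge> 0" using assms(1) by simp
  \<comment> \<open>The coordinates are exchanged, since division is available for the second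
    one.\<close>
  have "pser \<rho> (\<lambda>z. h (snd z)) C"
    using pser_comp[OF assms(1) assms(1) assms(2) pser_snd[OF r0] pser_fst[OF r0]] by simp
  from pser_div_snd[OF assms(1) this] obtain g where
    g: "pser \<rho> g (C / \<rho>)" "\<forall>z\<in>box2 \<rho>. h (snd z) = h (snd (fst z, 0::real)) + snd z *\<^sub>R g z" by (elim exE conjE) (rule that)
  have "pser \<rho> (\<lambda>z. g (0, fst z)) (C / \<rho>)"
    by (rule pser_comp[OF assms(1) assms(1) g(1) pser_mono[OF pser_zero r0] pser_fst[OF r0]])
  moreover have "h x = h 0 + x *\<^sub>R g (0, x)" if "\<bar>x\<bar> \<le> \<rho>" for x
    using bspec[OF g(2), of "(0, x)"] that r0 by (simp add: box2_def)
  ultimately show ?thesis by (intro exI[of _ "\<lambda>x. g (0, x)"] conjI allI impI)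
qed

text \<open>Repeated division by \<open>x\<close> produces \<open>G n\<close> of norm at most
  \<open>C / \<rho> ^ n\<close> on the same radius. If all \<open>G n 0\<close> vanish,
  \<open>norm (h x)\<close> is at most \<open>C * (\<bar>x\<bar> / \<rho>) ^ n\<close> for every
  \<open>n\<close>; otherwise the first nonzero one is the leading coefficient. As the alternative
  holds on the full radius, a single nonzero value of \<open>h\<close> there excludes the first
  case.\<close>

lemma pser1_order:
  fixes h :: "real \<Rightarrow> 'w::banach"
  assumes "\<rho> > 0" "pser \<rho> (\<lambda>z. h (fst z)) C"
  shows "(\<forall>x. \<bar>x\<bar> < \<rho> \<longrightarrow> h x = 0) \<or>
    (\<exists>k g D. pser \<rho> (\<lambda>z. g (fst z)) D \<and> g 0 \<noteq> 0 \<and> (\<forall>x. \<bar>x\<bar> \<le> \<rho> \<longrightarrow> h x = x ^ k *\<^sub>R g x))"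
proof -
  let ?P = "\<lambda>n g. pser \<rho> (\<lambda>z. g (fst z)) (C / \<rho> ^ n) \<and> (n = 0 \<longrightarrow> g = h)"
  let ?Q = "\<lambda>n g g'. \<forall>x. \<bar>x\<bar> \<le> \<rho> \<longrightarrow> g x = g 0 + x *\<^sub>R g' x"
  have "\<exists>G. \<forall>n. ?P n (G n) \<and> ?Q n (G n) (G (Suc n))"
  proof (rule dependent_nat_choice)
    show "\<exists>g. ?P 0 g" using assms(2) by (intro exI[of _ h]) simp
    fix g :: "real \<Rightarrow> 'w" and n assume "?P n g"
    from pser1_div[OF assms(1) conjunct1[OF this]] obtain g' where
      g': "pser \<rho> (\<lambda>z. g' (fst z)) (C / \<rho> ^ n / \<rho>)" "?Q n g g'" by (elim exE conjE) (rule that)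
    have "pser \<rho> (\<lambda>z. g' (fst z)) (C / \<rho> ^ Suc n)" using g'(1) by (simp add: mult.commute)
    then show "\<exists>g'. ?P (Suc n) g' \<and> ?Q n g g'"
      by (intro exI[of _ g'] conjI g'(2) impI) simp_all
  qed
  then obtain G where G0: "\<forall>n. ?P n (G n) \<and> ?Q n (G n) (G (Suc n))" ..
  have G: "\<And>n. pser \<rho> (\<lambda>z. G n (fst z)) (C / \<rho> ^ n)" "G 0 = h"
    "\<And>n x. \<bar>x\<bar> \<le> \<rho> \<Longrightarrow> G n x = G n 0 + x *\<^sub>R G (Suc n) x"
  proof -
    show "pser \<rho> (\<lambda>z. G n (fst z)) (C / \<rho> ^ n)" for n by (rule conjunct1[OF conjunct1[OF spec[OF G0]]])
    show "G 0 = h" by (rule mp[OF conjunct2[OF conjunct1[OF spec[OF G0, of 0]]] refl])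
    show "\<bar>x\<bar> \<le> \<rho> \<Longrightarrow> G n x = G n 0 + x *\<^sub>R G (Suc n) x" for n x
      by (rule mp[OF spec[OF conjunct2[OF spec[OF G0]]]])
  qed
  have pow: "h x = x ^ n *\<^sub>R G n x" if x: "\<bar>x\<bar> \<le> \<rho>" and z: "\<And>k. k < n \<Longrightarrow> G k 0 = 0" for x n
    using z
  proof (induction n)
    case (Suc n)
    then have "h x = x ^ n *\<^sub>R G n x" by simp
    also have "G n x = x *\<^sub>R G (Suc n) x" using G(3)[OF x, of n] Suc.prems[of n] by simp
    finally show ?case by (simp add: mult.commute)
  qed (simp add: G(2))
  show ?thesis
  proof (cases "\<forall>n. G n 0 = 0")
    case True
    have "h x = 0" if x: "\<bar>x\<bar> < \<rho>" for x
    proof -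
      define q where "q = \<bar>x\<bar> / \<rho>"
      have q: "0 \<le> q" "q < 1" using x assms(1) by (simp_all add: q_def)
      have "norm (h x) \<le> C * q ^ n" for n
      proof -
        have "norm (G n x) \<le> C / \<rho> ^ n"
          using pser_norm_le[OF G(1), of "(x, 0)" n] x assms(1) by (simp add: box2_def)
        then have "norm (h x) \<le> \<bar>x\<bar> ^ n * (C / \<rho> ^ n)"
          using pow[of x n] True x mult_left_mono[of "norm (G n x)" "C / \<rho> ^ n" "\<bar>x\<bar> ^ n"] by (simp add: power_abs)
        then show ?thesis by (simp add: q_def power_divide mult_ac)
      qed
      moreover have "(\<lambda>n. C * q ^ n) \<longlonglongrightarrow> 0" using q by (intro tendsto_mult_right_zero LIMSEQ_realpow_zero)
      ultimately have "norm (h x) \<le> 0" by (intro LIMSEQ_le_const[of "\<lambda>n. C * q ^ n"]) auto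
      then show ?thesis by simp
    qed
    then show ?thesis by blast
  next
    case False
    define k where "k = (LEAST n. G n 0 \<noteq> 0)"
    have k: "G k 0 \<noteq> 0" unfolding k_def using False by (metis (mono_tags, lifting) LeastI)
    have "G j 0 = 0" if "j < k" for j using that not_less_Least unfolding k_def by blast
    then have "\<forall>x. \<bar>x\<bar> \<le> \<rho> \<longrightarrow> h x = x ^ k *\<^sub>R G k x" using pow by blast
    then show ?thesis using G(1)[of k] k by blast
  qed
qed

lemma germ1_order:
  fixes h :: "real \<Rightarrow> 'w::banach"
  assumes "germ1 h"
  shows "(\<forall>\<^sub>F x in nhds 0. h x = 0) \<or>
    (\<exists>k g. germ1 g \<and> g 0 \<noteq> 0 \<and> (\<forall>\<^sub>F x in nhds 0. h x = x ^ k *\<^sub>R g x))"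
proof -
  obtain \<rho> C where p: "\<rho> > 0" "pser \<rho> (\<lambda>z. h (fst z)) C" by (rule germE[OF assms])
  from pser1_order[OF p] show ?thesis
  proof
    assume "\<forall>x. \<bar>x\<bar> < \<rho> \<longrightarrow> h x = 0"
    then show ?thesis unfolding eventually_nhds_zero1 using p(1) by blast
  next
    assume "\<exists>k g D. pser \<rho> (\<lambda>z. g (fst z)) D \<and> g 0 \<noteq> 0 \<and> (\<forall>x. \<bar>x\<bar> \<le> \<rho> \<longrightarrow> h x = x ^ k *\<^sub>R g x)"
    then obtain k g D where g: "pser \<rho> (\<lambda>z. g (fst z)) D" "g 0 \<noteq> 0" "\<forall>x. \<bar>x\<bar> \<le> \<rho> \<longrightarrow> h x = x ^ k *\<^sub>R g x"
      by (elim exE conjE) (rule that)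
    have "\<forall>\<^sub>F x in nhds 0. h x = x ^ k *\<^sub>R g x"
      unfolding eventually_nhds_zero1 using p(1) g(3) by (intro exI[of _ \<rho>]) simp
    then show ?thesis using germI[OF p(1) g(1)] g(2) by blast
  qed
qed

section \<open>Derivatives and implicit functions of germs\<close>

lemma germ_deriv_snd:
  fixes f :: "real \<times> real \<Rightarrow> real"
  assumes "germ f"
  shows "\<exists>f'. germ f' \<and> (\<forall>\<^sub>F z in nhds (0,0). ((\<lambda>y. f (fst z, y)) has_real_derivative f' z) (at (snd z)))"
proof -
  obtain \<rho> C where p: "\<rho> > 0" "pser \<rho> f C" by (rule germE[OF assms])
  obtain a S where a: "S \<le> C" "((\<lambda>i. norm (a i) * wt2 \<rho> i) has_sum S) UNIV"
    "\<And>z. z \<in> box2 \<rho> \<Longrightarrow> ((\<lambda>i. monom2 i z *\<^sub>R a i) has_sum f z) UNIV"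
    by (rule pserE[OF p(2)]) (rule that)
  define h where "h i = (fst i, Suc (snd i))" for i :: "nat \<times> nat"
  have inj: "inj h" by (auto simp: h_def inj_def)
  \<comment> \<open>On half the radius the factor \<open>Suc (snd i)\<close> from differentiation is
    absorbed by a power of 2.\<close>
  define \<sigma> where "\<sigma> = \<rho> / 2"
  have s: "\<sigma> > 0" "\<sigma> < \<rho>" using p(1) by (simp_all add: \<sigma>_def)
  define b where "b i = real (Suc (snd i)) * a (h i)" for i
  have "(\<lambda>i. norm (a i) * wt2 \<rho> i) summable_on range h"
    by (rule summable_on_subset_banach[OF has_sum_imp_summable[OF a(2)]]) simp
  then have s1: "(\<lambda>i. norm (a (h i)) * wt2 \<rho> (h i)) summable_on UNIV"
    by (subst (asm) summable_on_reindex[OF inj]) (simp add: o_def)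
  have s2: "(\<lambda>i. 2 / \<rho> * (norm (a (h i)) * wt2 \<rho> (h i))) summable_on UNIV"
    by (rule summable_on_cmult_right[OF s1])
  have bb: "norm (b i) * wt2 \<sigma> i \<le> 2 / \<rho> * (norm (a (h i)) * wt2 \<rho> (h i))" for i
  proof -
    have "real (Suc (snd i)) \<le> 2 ^ Suc (snd i)" using less_exp[of "Suc (snd i)"]
      by (metis less_imp_le of_nat_le_iff of_nat_numeral of_nat_power)
    also have "\<dots> \<le> 2 * 2 ^ (fst i + snd i)" by simp
    finally have "real (Suc (snd i)) * (norm (a (h i)) * wt2 \<sigma> i) \<le> 2 * 2 ^ (fst i + snd i) * (norm (a (h i)) * wt2 \<sigma> i)"
      using s(1) by (intro mult_right_mono) (simp_all add: wt2_nonneg)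
    also have "\<dots> = 2 * norm (a (h i)) * (2 ^ (fst i + snd i) * wt2 \<sigma> i)" by (simp only: mult_ac)
    also have "2 ^ (fst i + snd i) * wt2 \<sigma> i = wt2 \<rho> i" by (simp add: wt2_def \<sigma>_def power_divide)
    also have "2 * norm (a (h i)) * wt2 \<rho> i = 2 / \<rho> * (norm (a (h i)) * wt2 \<rho> (h i))" using p(1) by (simp add: wt2_def h_def)
    finally show ?thesis by (simp add: b_def abs_mult mult.assoc)
  qed
  have s3: "(\<lambda>i. norm (b i) * wt2 \<sigma> i) summable_on UNIV"
    by (rule summable_on_comparison_test[OF s2 bb]) (simp add: wt2_nonneg less_imp_le[OF s(1)])
  define f' where "f' z = infsum (\<lambda>i. monom2 i z *\<^sub>R b i) UNIV" for z
  have hf': "((\<lambda>i. monom2 i z *\<^sub>R b i) has_sum f' z) UNIV" if z: "z \<in> box2 \<sigma>" for z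
  proof -
    have "norm (monom2 i z *\<^sub>R b i) \<le> norm (b i) * wt2 \<sigma> i" for i
      unfolding norm_scaleR using mult_right_mono[OF abs_monom2_le[OF z], of "norm (b i)" i] by (simp add: mult.commute)
    then have "(\<lambda>i. norm (monom2 i z *\<^sub>R b i)) summable_on UNIV"
      by (intro Infinite_Sum.abs_summable_on_comparison_test'[OF s3])
    from abs_summable_summable[OF this] show ?thesis unfolding f'_def by simp
  qed
  have "pser \<sigma> f' (infsum (\<lambda>i. norm (b i) * wt2 \<sigma> i) UNIV)"
    by (rule pserI[OF has_sum_infsum[OF s3] order.refl hf'])
  moreover have "((\<lambda>y. f (x, y)) has_real_derivative f' (x, y)) (at y)" if xy: "\<bar>x\<bar> < \<sigma>" "\<bar>y\<bar> < \<sigma>" for x y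
  proof -
    \<comment> \<open>The coefficients of \<open>f (x, y)\<close> as a power series in
      \<open>y\<close> for fixed \<open>x\<close>, so that termwise differentiation in one variable
      applies.\<close>
    define c where "c k = infsum (\<lambda>j. x ^ j * a (j, k)) UNIV" for k
    have na: "(\<lambda>(k,j). norm (a (j, k)) * wt2 \<rho> (j, k)) summable_on UNIV \<times> UNIV"
    proof -
      have "(\<lambda>(j,k). norm (a (j, k)) * wt2 \<rho> (j, k)) summable_on UNIV \<times> UNIV"
        using has_sum_imp_summable[OF a(2)] by (simp add: case_prod_unfold)
      then show ?thesis by (subst (asm) summable_on_swap) (simp add: case_prod_unfold)
    qed
    have hc: "((\<lambda>j. x ^ j * a (j, k)) has_sum c k) UNIV" for k
    proof -
      have "(\<lambda>j. norm (a (j, k)) * wt2 \<rho> (j, k)) summable_on UNIV"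
        using summable_on_SigmaD1[OF na, of k] by simp
      then have "(\<lambda>j. norm (a (j, k)) * wt2 \<rho> (j, k) * (1 / \<rho> ^ k)) summable_on UNIV"
        by (rule summable_on_cmult_left)
      then have "(\<lambda>j. norm (x ^ j * a (j, k))) summable_on UNIV"
      proof (rule Infinite_Sum.abs_summable_on_comparison_test')
        fix j
        have "\<bar>x\<bar> ^ j \<le> \<rho> ^ j" using xy s by (intro power_mono) auto
        then have "\<bar>x\<bar> ^ j * \<bar>a (j, k)\<bar> \<le> \<rho> ^ j * \<bar>a (j, k)\<bar>" by (rule mult_right_mono) simp
        then show "norm (x ^ j * a (j, k)) \<le> norm (a (j, k)) * wt2 \<rho> (j, k) * (1 / \<rho> ^ k)"
          using p(1) by (simp add: wt2_def power_add abs_mult power_abs mult_ac)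
      qed
      from abs_summable_summable[OF this] show ?thesis unfolding c_def by simp
    qed
    have fc: "(\<lambda>k. c k * y' ^ k) sums f (x, y')" if y': "\<bar>y'\<bar> \<le> \<rho>" for y'
    proof -
      have "((\<lambda>(j,k). monom2 (j,k) (x, y') *\<^sub>R a (j,k)) has_sum f (x, y')) (UNIV \<times> UNIV)"
        using a(3)[of "(x, y')"] y' xy s by (simp add: box2_def case_prod_unfold)
      then have "((\<lambda>(k,j). monom2 (j,k) (x, y') *\<^sub>R a (j,k)) has_sum f (x, y')) (UNIV \<times> UNIV)"
        by (subst (asm) has_sum_swap) (simp add: case_prod_unfold)
      then have "((\<lambda>k. c k * y' ^ k) has_sum f (x, y')) UNIV"
      proof (rule has_sum_SigmaD)
        show "((\<lambda>j. case (k, j) of (k, j) \<Rightarrow> monom2 (j, k) (x, y') *\<^sub>R a (j, k)) has_sum c k * y' ^ k) UNIV" for k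
          using has_sum_cmult_left[OF hc[of k], of "y' ^ k"] by (simp add: monom2_def mult_ac)
      qed
      then show ?thesis by (rule has_sum_imp_sums)
    qed
    have "((\<lambda>y. \<Sum>k. c k * y ^ k) has_real_derivative (\<Sum>k. diffs c k * y ^ k)) (at y)"
      by (rule termdiffs_strong[OF sums_summable[OF fc[of \<rho>]]]) (use p(1) xy s in auto)
    then have D: "((\<lambda>y. f (x, y)) has_real_derivative (\<Sum>k. diffs c k * y ^ k)) (at y)"
    proof (rule has_field_derivative_transform_within_open)
      show "open {-\<rho><..<\<rho>}" "y \<in> {-\<rho><..<\<rho>}" using xy s by auto
      show "(\<Sum>k. c k * y' ^ k) = f (x, y')" if "y' \<in> {-\<rho><..<\<rho>}" for y'
        using sums_unique[OF fc[of y']] that by auto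
    qed
    have "((\<lambda>(j,k). monom2 (j,k) (x, y) *\<^sub>R b (j,k)) has_sum f' (x, y)) (UNIV \<times> UNIV)"
      using hf'[of "(x, y)"] xy by (simp add: box2_def case_prod_unfold)
    then have "((\<lambda>(k,j). monom2 (j,k) (x, y) *\<^sub>R b (j,k)) has_sum f' (x, y)) (UNIV \<times> UNIV)"
      by (subst (asm) has_sum_swap) (simp add: case_prod_unfold)
    then have "((\<lambda>k. diffs c k * y ^ k) has_sum f' (x, y)) UNIV"
    proof (rule has_sum_SigmaD)
      show "((\<lambda>j. case (k, j) of (k, j) \<Rightarrow> monom2 (j, k) (x, y) *\<^sub>R b (j, k)) has_sum diffs c k * y ^ k) UNIV" for k
        using has_sum_cmult_left[OF hc[of "Suc k"], of "real (Suc k) * y ^ k"]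
        by (simp add: monom2_def b_def h_def diffs_def mult_ac del: of_nat_Suc)
    qed
    from sums_unique[OF has_sum_imp_sums[OF this]] D show ?thesis by simp
  qed
  then have "\<forall>\<^sub>F z in nhds (0,0). ((\<lambda>y. f (fst z, y)) has_real_derivative f' z) (at (snd z))"
    unfolding eventually_nhds_zero2 using s(1) by (intro exI[of _ \<sigma>]) simp
  ultimately show ?thesis using germI[OF s(1)] by blast
qed

text \<open>A scalar instance of \<open>bordered_implicit_function\<close>: the derivative is
  multiplication by \<open>\<beta>\<close>, inverted by division, with the border
  \<open>l = 0\<close> and \<open>\<psi> = 0\<close>; the solution is taken at second coordinate
  0.\<close>

lemma germ_implicit:
  fixes G :: "real \<times> real \<Rightarrow> real"
  assumes G: "germ G" "G (0,0) = 0" and d: "((\<lambda>y. G (0, y)) has_real_derivative \<beta>) (at 0)" "\<beta> \<noteq> 0"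
  shows "\<exists>h. germ1 h \<and> h 0 = 0 \<and> (\<forall>\<^sub>F x in nhds 0. G (x, h x) = 0)"
proof -
  obtain \<rho> C where p: "\<rho> > 0" "pser \<rho> G C" by (rule germE[OF G(1)])
  have an: "analytic_map_at G (0, 0)" by (rule pser_imp_analytic_at[OF p(2)]) (use p(1) in simp_all)
  have "((\<lambda>w. G (0, w)) has_derivative (*) \<beta>) (at 0)" using d(1) unfolding has_field_derivative_def .
  from frechet_derivative_at[OF this] have D: "D_u G 0 0 = (*) \<beta>" unfolding D_u_def by simp
  obtain \<sigma> R w where w: "\<sigma> > 0" "R > 0" "pser \<sigma> w R" "w (0, 0) = 0"
    "\<forall>z\<in>box2 \<sigma>. \<forall>h. norm h \<le> R \<longrightarrow> (G (0 + fst z, 0 + h) + 0 *\<^sub>R 0 = snd z *\<^sub>R 0 \<longleftrightarrow> h = w z)"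
    using bordered_implicit_function[OF an G(2) bounded_linear_zero, of "\<lambda>v. v / \<beta>" 0] d(2)
    by (auto simp: D bounded_linear_divide)
  have "G (x, w (x, 0)) = 0" if "\<bar>x\<bar> < \<sigma>" for x
  proof -
    have z: "(x, 0) \<in> box2 \<sigma>" using that w(1) by (simp add: box2_def)
    from w(5)[rule_format, OF z pser_norm_le[OF w(3) z]] show ?thesis by simp
  qed
  then have "\<forall>\<^sub>F x in nhds 0. G (x, w (x, 0)) = 0" unfolding eventually_nhds_zero1 using w(1) by blast
  then show ?thesis using germ_restrict_fst[OF germI[OF w(1,3)]] w(4) by (intro exI[of _ "\<lambda>x. w (x, 0)"]) simp
qed

section \<open>Branches of a plane analytic curve\<close>

text \<open>The order of \<open>f (0, y)\<close> at \<open>y = 0\<close>, expressed by a limit so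
  that no expansion has to be chosen.\<close>

definition regular_order :: "nat \<Rightarrow> (real \<times> real \<Rightarrow> real) \<Rightarrow> bool" where
  "regular_order m f \<longleftrightarrow> (\<exists>v0. v0 \<noteq> 0 \<and> ((\<lambda>y. f (0, y) / y ^ m) \<longlongrightarrow> v0) (at 0))"

section \<open>Taylor coefficients and the shift of the second variable\<close>

lemma eventually_nhds_zero2_snd:
  assumes "eventually P (nhds ((0::real), (0::real)))"
  shows "\<forall>\<^sub>F y in at 0. P (0, y)"
proof -
  obtain d where d: "d > 0" "\<forall>x y. \<bar>x\<bar> < d \<longrightarrow> \<bar>y\<bar> < d \<longrightarrow> P (x, y)"
    using assms unfolding eventually_nhds_zero2 by (elim exE conjE) (rule that)
  then have "\<forall>\<^sub>F y in nhds 0. P (0, y)" unfolding eventually_nhds_zero1 by (intro exI[of _ d]) simp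
  then show ?thesis unfolding eventually_at_filter by (rule eventually_mono) simp
qed

lemma eventually_bounded_of_tendsto:
  fixes v :: "'a \<Rightarrow> real"
  assumes "(v \<longlongrightarrow> l) F"
  shows "\<forall>\<^sub>F y in F. \<bar>v y\<bar> \<le> \<bar>l\<bar> + 1"
  using tendstoD[OF assms zero_less_one] by (rule eventually_mono) (simp add: dist_norm)

text \<open>Letting \<open>y\<close> tend to 0 kills the constant term, after which a factor
  \<open>y\<close> cancels. It serves as uniqueness of expansions modulo a bounded multiple of
  \<open>y ^ m\<close>.\<close>

lemma poly_bigo_zero:
  fixes c :: "nat \<Rightarrow> real"
  assumes "\<forall>\<^sub>F y in at 0. (\<Sum>k<m. c k * y ^ k) = y ^ m * v y" "\<forall>\<^sub>F y in at (0::real). \<bar>v y\<bar> \<le> B" "k < m"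
  shows "c k = 0"
  using assms(1,3)
proof (induction m arbitrary: c k)
  case 0
  then show ?case by simp
next
  case (Suc m)
  have "((\<lambda>y. \<Sum>k<Suc m. c k * y ^ k) \<longlongrightarrow> (\<Sum>k<Suc m. c k * 0 ^ k)) (at 0)"
    by (intro tendsto_intros)
  moreover have "(\<Sum>k<Suc m. c k * 0 ^ k) = c 0" unfolding sum.lessThan_Suc_shift by simp
  ultimately have 1: "((\<lambda>y. \<Sum>k<Suc m. c k * y ^ k) \<longlongrightarrow> c 0) (at 0)" by simp
  have "((\<lambda>y. y ^ Suc m * v y) \<longlongrightarrow> 0) (at 0)"
  proof (rule Lim_null_comparison)
    show "\<forall>\<^sub>F y in at 0. norm (y ^ Suc m * v y) \<le> \<bar>y\<bar> ^ Suc m * B"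
      using assms(2) by (rule eventually_mono) (simp add: abs_mult power_abs mult_left_mono)
    have "((\<lambda>y. \<bar>y\<bar> ^ Suc m * B) \<longlongrightarrow> \<bar>0\<bar> ^ Suc m * B) (at 0)" by (intro tendsto_intros)
    then show "((\<lambda>y. \<bar>y\<bar> ^ Suc m * B) \<longlongrightarrow> 0) (at 0)" by simp
  qed
  then have "((\<lambda>y. \<Sum>k<Suc m. c k * y ^ k) \<longlongrightarrow> 0) (at 0)"
    by (rule Lim_transform_eventually) (use Suc.prems(1) in \<open>rule eventually_mono; simp\<close>)
  with 1 have c0: "c 0 = 0" by (rule tendsto_unique[OF trivial_limit_at])
  have "\<forall>\<^sub>F y in at 0. (\<Sum>k<m. c (Suc k) * y ^ k) = y ^ m * v y"
    using Suc.prems(1) eventually_neq_at_within[of 0 0 UNIV]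
  proof eventually_elim
    case (elim y)
    have "y * (\<Sum>k<m. c (Suc k) * y ^ k) = (\<Sum>k<Suc m. c k * y ^ k)"
      unfolding sum.lessThan_Suc_shift c0 by (simp add: sum_distrib_left mult_ac)
    then have "y * (\<Sum>k<m. c (Suc k) * y ^ k) = y * (y ^ m * v y)" using elim(1) by (simp add: mult.assoc)
    then show ?case using elim(2) by simp
  qed
  from Suc.IH[OF this] c0 Suc.prems(2) show ?case by (cases k) auto
qed

text \<open>Both the given expansion and Taylor's formula leave a bounded multiple of
  \<open>y ^ n\<close>, so \<open>poly_bigo_zero\<close> identifies their coefficients. The centre
  \<open>b\<close> is free because the formula is used along the graph of \<open>h\<close> as well
  as at the origin.\<close>

lemma taylor_coefficient:
  fixes d :: "nat \<Rightarrow> real \<Rightarrow> real"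
  assumes "\<delta> > 0" "n > 0"
    and der: "\<And>k y. k < n \<Longrightarrow> \<bar>y - b\<bar> < \<delta> \<Longrightarrow> (d k has_real_derivative d (Suc k) y) (at y)"
    and bdd: "\<And>y. \<bar>y - b\<bar> < \<delta> \<Longrightarrow> \<bar>d n y\<bar> \<le> B"
    and ex: "\<forall>\<^sub>F y in at 0. d 0 (b + y) = (\<Sum>k<n. c k * y ^ k) + y ^ n * v y"
    and vb: "\<forall>\<^sub>F y in at 0. \<bar>v y\<bar> \<le> B'" and "k < n"
  shows "c k = d k b / fact k"
proof -
  define r where "r y = (d 0 (b + y) - (\<Sum>k<n. d k b / fact k * y ^ k)) / y ^ n" for y
  have rb: "\<bar>r y\<bar> \<le> B" if y: "y \<noteq> 0" "\<bar>y\<bar> < \<delta>" for y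
  proof -
    have "\<exists>t. (if b + y < b then b + y < t \<and> t < b else b < t \<and> t < b + y) \<and>
      d 0 (b + y) = (\<Sum>k<n. d k b / fact k * (b + y - b) ^ k) + d n t / fact n * (b + y - b) ^ n"
    proof (rule Taylor[OF assms(2) refl, of "b - \<bar>y\<bar>" "b + \<bar>y\<bar>"])
      show "\<forall>k t. k < n \<and> b - \<bar>y\<bar> \<le> t \<and> t \<le> b + \<bar>y\<bar> \<longrightarrow> (d k has_real_derivative d (Suc k) t) (at t)"
      proof (intro allI impI)
        fix k t assume "k < n \<and> b - \<bar>y\<bar> \<le> t \<and> t \<le> b + \<bar>y\<bar>"
        then show "(d k has_real_derivative d (Suc k) t) (at t)" using y by (intro der) auto
      qed
    qed (use y in auto)
    then obtain t where t: "if b + y < b then b + y < t \<and> t < b else b < t \<and> t < b + y"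
      "d 0 (b + y) = (\<Sum>k<n. d k b / fact k * (b + y - b) ^ k) + d n t / fact n * (b + y - b) ^ n"
      by (elim exE conjE) (rule that)
    have "\<bar>t - b\<bar> < \<delta>" using t(1) y by (auto split: if_splits)
    then have "\<bar>d n t\<bar> \<le> B" by (rule bdd)
    moreover have "\<bar>d n t / fact n\<bar> \<le> \<bar>d n t\<bar>"
      using fact_ge_1[of n, where 'a = real] by (simp add: divide_le_eq mult_le_cancel_left1)
    moreover have "r y = d n t / fact n" unfolding r_def t(2) using y by simp
    ultimately show ?thesis by linarith
  qed
  have "\<forall>\<^sub>F y in at 0. y \<noteq> 0 \<and> \<bar>y\<bar> < \<delta>"
    unfolding eventually_at using assms(1) by (intro exI[of _ \<delta>]) (simp add: dist_norm)
  then have near2: "\<forall>\<^sub>F y in at 0. \<bar>r y\<bar> \<le> B" by (rule eventually_mono) (simp add: rb)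
  have near1: "\<forall>\<^sub>F y in at (0::real). y \<noteq> 0" by (rule eventually_neq_at_within)
  have "c k - d k b / fact k = 0"
  proof (rule poly_bigo_zero[where m = n and v = "\<lambda>y. r y - v y" and B = "B + B'"])
    show "\<forall>\<^sub>F y in at 0. (\<Sum>k<n. (c k - d k b / fact k) * y ^ k) = y ^ n * (r y - v y)"
      using near1 ex
    proof eventually_elim
      case (elim y)
      have "y ^ n * r y = d 0 (b + y) - (\<Sum>k<n. d k b / fact k * y ^ k)" unfolding r_def using elim(1) by simp
      then show ?case using elim(2) by (simp add: algebra_simps sum_subtractf)
    qed
    show "\<forall>\<^sub>F y in at 0. \<bar>r y - v y\<bar> \<le> B + B'" using near2 vb by eventually_elim linarith
  qed (rule \<open>k < n\<close>)
  then show ?thesis by simp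
qed

lemma germ_expansion:
  fixes f :: "real \<times> real \<Rightarrow> real"
  assumes "germ f"
  shows "\<exists>c u. (\<forall>k. germ1 (c k)) \<and> germ u \<and>
    (\<forall>\<^sub>F z in nhds (0,0). f z = (\<Sum>k<m. c k (fst z) * snd z ^ k) + snd z ^ m * u z)"
proof (induction m)
  case 0
  show ?case by (intro exI[of _ "\<lambda>_ _. 0"] exI[of _ f]) (simp add: assms germ_const)
next
  case (Suc m)
  then obtain c u where cu: "\<forall>k. germ1 (c k)" "germ u"
    "\<forall>\<^sub>F z in nhds (0,0). f z = (\<Sum>k<m. c k (fst z) * snd z ^ k) + snd z ^ m * u z"
    by (elim exE conjE) (rule that)
  obtain g where g: "germ g" "\<forall>\<^sub>F z in nhds (0,0). u z = u (fst z, 0) + snd z *\<^sub>R g z"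
    using germ_div_snd[OF cu(2)] by (elim exE conjE) (rule that)
  define c' where "c' k = (if k = m then (\<lambda>x. u (x, 0)) else c k)" for k
  have "germ1 (c' k)" for k using cu(1) germ_restrict_fst[OF cu(2)] by (simp add: c'_def)
  moreover have "\<forall>\<^sub>F z in nhds (0,0). f z = (\<Sum>k<Suc m. c' k (fst z) * snd z ^ k) + snd z ^ Suc m * g z"
    using cu(3) g(2)
  proof eventually_elim
    case (elim z)
    have "(\<Sum>k<m. c' k (fst z) * snd z ^ k) = (\<Sum>k<m. c k (fst z) * snd z ^ k)"
      by (rule sum.cong) (simp_all add: c'_def)
    moreover have "snd z ^ m * u z = u (fst z, 0) * snd z ^ m + snd z ^ Suc m * g z"
      by (subst elim(2)) (simp add: algebra_simps)
    ultimately show ?case unfolding elim(1) by (simp add: c'_def)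
  qed
  ultimately show ?case using g(1) by (intro exI[of _ c'] exI[of _ g] conjI allI)
qed

lemma germ_tendsto_snd:
  fixes u :: "real \<times> real \<Rightarrow> real"
  assumes "germ u" shows "((\<lambda>y. u (0, y)) \<longlongrightarrow> u (0, 0)) (at 0)"
proof -
  have "isCont (\<lambda>y. (0::real, y)) (0::real)" by (intro continuous_intros)
  from isCont_o2[OF this] germ_isCont[OF assms] show ?thesis by (simp add: isCont_def)
qed

text \<open>A substitute for Weierstrass preparation: the leading term keeps a unit \<open>u\<close>
  as a factor, while the lower coefficients vanish at \<open>x = 0\<close>.\<close>

lemma regular_expansion:
  fixes f :: "real \<times> real \<Rightarrow> real"
  assumes f: "germ f" and reg: "regular_order m f"
  shows "\<exists>c u. (\<forall>k. germ1 (c k)) \<and> germ u \<and> (\<forall>k<m. c k 0 = 0) \<and> u (0,0) \<noteq> 0 \<and>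
    (\<forall>\<^sub>F z in nhds (0,0). f z = (\<Sum>k<m. c k (fst z) * snd z ^ k) + snd z ^ m * u z)"
proof -
  obtain c u where cu: "\<forall>k. germ1 (c k)" "germ u"
    "\<forall>\<^sub>F z in nhds (0,0). f z = (\<Sum>k<m. c k (fst z) * snd z ^ k) + snd z ^ m * u z"
    using germ_expansion[OF f, of m] by (elim exE conjE) (rule that)
  obtain v0 where v0: "v0 \<noteq> 0" "((\<lambda>y. f (0, y) / y ^ m) \<longlongrightarrow> v0) (at 0)"
    using reg unfolding regular_order_def by (elim exE conjE) (rule that)
  note ut = germ_tendsto_snd[OF cu(2)]
  have e0: "\<forall>\<^sub>F y in at 0. f (0, y) = (\<Sum>k<m. c k 0 * y ^ k) + y ^ m * u (0, y)"
    using eventually_nhds_zero2_snd[OF cu(3)] by simp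
  have ne: "\<forall>\<^sub>F y in at (0::real). y \<noteq> 0" by (rule eventually_neq_at_within)
  have c0: "c k 0 = 0" if "k < m" for k
  proof (rule poly_bigo_zero[OF _ eventually_bounded_of_tendsto[OF tendsto_diff[OF v0(2) ut]] that])
    show "\<forall>\<^sub>F y in at 0. (\<Sum>k<m. c k 0 * y ^ k) = y ^ m * (f (0, y) / y ^ m - u (0, y))"
      using e0 ne by eventually_elim (simp add: field_simps)
  qed
  have "\<forall>\<^sub>F y in at 0. f (0, y) / y ^ m = u (0, y)"
    using e0 ne
  proof eventually_elim
    case (elim y)
    have "(\<Sum>k<m. c k 0 * y ^ k) = 0" by (rule sum.neutral) (simp add: c0)
    then show ?case using elim by simp
  qed
  with v0(2) have "((\<lambda>y. u (0, y)) \<longlongrightarrow> v0) (at 0)" by (rule Lim_transform_eventually)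
  with ut have "u (0, 0) = v0" by (rule tendsto_unique[OF trivial_limit_at])
  then show ?thesis using cu c0 v0(1) by (intro exI[of _ c] exI[of _ u]) simp
qed

text \<open>Shifting \<open>y\<close> by the zero \<open>h\<close> of the \<open>(m-1)\<close>-st \<open>y\<close>-derivative removes the term of order \<open>m - 1\<close>.\<close>

lemma tschirnhaus:
  fixes f :: "real \<times> real \<Rightarrow> real"
  assumes f: "germ f" and reg: "regular_order m f" and m: "m \<ge> 1"
  shows "\<exists>h c u. germ1 h \<and> h 0 = 0 \<and> (\<forall>k. germ1 (c k)) \<and> germ u \<and> (\<forall>k<m. c k 0 = 0) \<and> u (0,0) \<noteq> 0 \<and>
    (\<forall>\<^sub>F z in nhds (0,0). f (fst z, h (fst z) + snd z) = (\<Sum>k<m. c k (fst z) * snd z ^ k) + snd z ^ m * u z) \<and>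
    (\<forall>\<^sub>F x in nhds 0. c (m - 1) x = 0)"
proof -
  have "\<exists>d. \<forall>k. (germ (d k) \<and> (k = 0 \<longrightarrow> d k = f)) \<and>
    (\<forall>\<^sub>F z in nhds (0,0). ((\<lambda>y. d k (fst z, y)) has_real_derivative d (Suc k) z) (at (snd z)))"
  proof (rule dependent_nat_choice)
    show "\<exists>g. germ g \<and> ((0::nat) = 0 \<longrightarrow> g = f)" using f by (intro exI[of _ f]) simp
    fix g :: "real \<times> real \<Rightarrow> real" and k :: nat assume "germ g \<and> (k = 0 \<longrightarrow> g = f)"
    from germ_deriv_snd[OF conjunct1[OF this]] show "\<exists>g'. (germ g' \<and> (Suc k = 0 \<longrightarrow> g' = f)) \<and>
      (\<forall>\<^sub>F z in nhds (0,0). ((\<lambda>y. g (fst z, y)) has_real_derivative g' z) (at (snd z)))" by simp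
  qed
  then obtain d where d: "\<forall>k. (germ (d k) \<and> (k = 0 \<longrightarrow> d k = f)) \<and>
    (\<forall>\<^sub>F z in nhds (0,0). ((\<lambda>y. d k (fst z, y)) has_real_derivative d (Suc k) z) (at (snd z)))" ..
  have dg: "germ (d k)" for k by (rule conjunct1[OF conjunct1[OF spec[OF d]]])
  have d0: "d 0 = f" by (rule mp[OF conjunct2[OF conjunct1[OF spec[OF d, of 0]]] refl])
  have dd: "\<forall>\<^sub>F z in nhds (0,0). ((\<lambda>y. d k (fst z, y)) has_real_derivative d (Suc k) z) (at (snd z))" for k
    by (rule conjunct2[OF spec[OF d]])
  have "\<forall>\<^sub>F z in nhds (0,0). \<forall>k\<in>{..m}. ((\<lambda>y. d k (fst z, y)) has_real_derivative d (Suc k) z) (at (snd z))"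
    by (rule eventually_ball_finite) (use dd in auto)
  moreover have bd: "\<forall>\<^sub>F z in nhds (0,0). \<bar>d k z\<bar> \<le> \<bar>d k (0,0)\<bar> + 1" for k
    by (rule eventually_bounded_of_tendsto[OF germ_tendsto_nhds[OF dg]])
  then have "\<forall>\<^sub>F z in nhds (0,0). \<forall>k\<in>{..Suc m}. \<bar>d k z\<bar> \<le> \<bar>d k (0,0)\<bar> + 1"
    by (intro eventually_ball_finite) auto
  ultimately have "\<forall>\<^sub>F z in nhds (0,0).
      (\<forall>k\<in>{..m}. ((\<lambda>y. d k (fst z, y)) has_real_derivative d (Suc k) z) (at (snd z))) \<and>
      (\<forall>k\<in>{..Suc m}. \<bar>d k z\<bar> \<le> \<bar>d k (0,0)\<bar> + 1)" by (rule eventually_conj)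
  then obtain \<delta> where \<delta>: "\<delta> > 0" "\<forall>x y. \<bar>x\<bar> < \<delta> \<longrightarrow> \<bar>y\<bar> < \<delta> \<longrightarrow>
      (\<forall>k\<in>{..m}. ((\<lambda>ya. d k (fst (x, y), ya)) has_real_derivative d (Suc k) (x, y)) (at (snd (x, y)))) \<and>
      (\<forall>k\<in>{..Suc m}. \<bar>d k (x, y)\<bar> \<le> \<bar>d k (0,0)\<bar> + 1)"
    unfolding eventually_nhds_zero2 by (elim exE conjE) (rule that)
  have der: "((\<lambda>y. d k (x, y)) has_real_derivative d (Suc k) (x, y)) (at y)" if "k \<le> m" "\<bar>x\<bar> < \<delta>" "\<bar>y\<bar> < \<delta>" for k x y
    using \<delta>(2) that by simp
  have bnd: "\<bar>d k (x, y)\<bar> \<le> \<bar>d k (0,0)\<bar> + 1" if "k \<le> Suc m" "\<bar>x\<bar> < \<delta>" "\<bar>y\<bar> < \<delta>" for k x y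
    using \<delta>(2) that by simp
  obtain c1 u1 where cu1: "\<forall>k. germ1 (c1 k)" "germ u1" "\<forall>k<m. c1 k 0 = 0" "u1 (0,0) \<noteq> 0"
    "\<forall>\<^sub>F z in nhds (0,0). f z = (\<Sum>k<m. c1 k (fst z) * snd z ^ k) + snd z ^ m * u1 z"
    using regular_expansion[OF f reg] by (elim exE conjE) (rule that)
  obtain g where g: "germ g" "\<forall>\<^sub>F z in nhds (0,0). u1 z = u1 (fst z, 0) + snd z *\<^sub>R g z"
    using germ_div_snd[OF cu1(2)] by (elim exE conjE) (rule that)
  \<comment> \<open>The expected Taylor coefficients of \<open>f (0, y)\<close>. The expansion is
    pushed one order further by \<open>g\<close>, so that the coefficient of order \<open>m\<close>
    is covered too.\<close>
  define e where "e k = (if k = m then u1 (0,0) else 0)" for k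
  have coef: "e k = d k (0, 0) / fact k" if "k < Suc m" for k
  proof (rule taylor_coefficient[OF \<delta>(1), where n = "Suc m" and d = "\<lambda>k y. d k (0, y)" and v = "\<lambda>y. g (0, y)"])
    show "((\<lambda>y. d k (0, y)) has_real_derivative d (Suc k) (0, y)) (at y)" if "k < Suc m" "\<bar>y - 0\<bar> < \<delta>" for k y
      using that \<delta>(1) by (intro der) auto
    show "\<bar>d (Suc m) (0, y)\<bar> \<le> \<bar>d (Suc m) (0,0)\<bar> + 1" if "\<bar>y - 0\<bar> < \<delta>" for y
      using that \<delta>(1) by (intro bnd) auto
    show "\<forall>\<^sub>F y in at 0. d 0 (0, 0 + y) = (\<Sum>k<Suc m. e k * y ^ k) + y ^ Suc m * g (0, y)"
      using eventually_nhds_zero2_snd[OF cu1(5)] eventually_nhds_zero2_snd[OF g(2)]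
    proof eventually_elim
      case (elim y)
      have "(\<Sum>k<m. c1 k 0 * y ^ k) = 0" by (rule sum.neutral) (simp add: cu1(3))
      moreover have "(\<Sum>k<m. e k * y ^ k) = 0" by (rule sum.neutral) (simp add: e_def)
      moreover have "y ^ m * u1 (0, y) = u1 (0,0) * y ^ m + y ^ Suc m * g (0, y)"
        using elim(2) by (simp add: algebra_simps)
      ultimately show ?case using elim(1) by (simp add: d0 e_def)
    qed
    show "\<forall>\<^sub>F y in at 0. \<bar>g (0, y)\<bar> \<le> \<bar>g (0, 0)\<bar> + 1"
      by (rule eventually_bounded_of_tendsto[OF germ_tendsto_snd[OF g(1)]])
  qed (use that in auto)
  \<comment> \<open>Order \<open>m\<close> on the axis makes derivative \<open>m\<close> nonzero and
    derivative \<open>m - 1\<close> zero at the origin, so the equation for the latter has an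
    analytic solution \<open>h\<close>.\<close>
  have dm: "d m (0,0) \<noteq> 0" using coef[of m] cu1(4) by (auto simp: e_def)
  have "m - Suc 0 \<noteq> m" "m - Suc 0 < Suc m" using m by auto
  then have dm1: "d (m - 1) (0,0) = 0" using coef[of "m - 1"] by (simp add: e_def)
  have "((\<lambda>y. d (m - 1) (0, y)) has_real_derivative d m (0, 0)) (at 0)"
    using der[of "m - 1" 0 0] m \<delta>(1) by simp
  from germ_implicit[OF dg dm1 this dm] obtain h where h: "germ1 h" "h 0 = 0" "\<forall>\<^sub>F x in nhds 0. d (m - 1) (x, h x) = 0"
    by (elim exE conjE) (rule that)
  define F where "F z = f (fst z, h (fst z) + snd z)" for z
  have gF: "germ F" unfolding F_def
    by (rule germ_comp[OF f germ_fst germ_add[OF h(1) germ_snd]]) (simp_all add: h(2))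
  have "regular_order m F" using reg unfolding regular_order_def F_def by (simp add: h(2))
  from regular_expansion[OF gF this] obtain c u where cu: "\<forall>k. germ1 (c k)" "germ u" "\<forall>k<m. c k 0 = 0" "u (0,0) \<noteq> 0"
    "\<forall>\<^sub>F z in nhds (0,0). F z = (\<Sum>k<m. c k (fst z) * snd z ^ k) + snd z ^ m * u z"
    by (elim exE conjE) (rule that)
  have ub: "\<forall>\<^sub>F z in nhds (0,0). \<bar>u z\<bar> \<le> \<bar>u (0,0)\<bar> + 1"
    by (rule eventually_bounded_of_tendsto[OF germ_tendsto_nhds[OF cu(2)]])
  from eventually_conj[OF cu(5) ub] obtain \<delta>2 where \<delta>2: "\<delta>2 > 0" "\<forall>x y. \<bar>x\<bar> < \<delta>2 \<longrightarrow> \<bar>y\<bar> < \<delta>2 \<longrightarrow>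
      F (x, y) = (\<Sum>k<m. c k (fst (x, y)) * snd (x, y) ^ k) + snd (x, y) ^ m * u (x, y) \<and> \<bar>u (x, y)\<bar> \<le> \<bar>u (0,0)\<bar> + 1"
    unfolding eventually_nhds_zero2 by (elim exE conjE) (rule that)
  \<comment> \<open>With \<open>\<bar>h x\<bar>\<close> below \<open>\<delta> / 2\<close>, a window
    of half-width \<open>\<delta> / 2\<close> around \<open>h x\<close> stays where the derivatives
    are controlled.\<close>
  have hs: "\<forall>\<^sub>F x in nhds 0. \<bar>h x\<bar> < \<delta> / 2"
  proof -
    have "(h \<longlongrightarrow> h 0) (nhds 0)" by (rule germ1_tendsto_nhds[OF h(1)])
    from tendstoD[OF this, of "\<delta> / 2"] \<delta>(1) show ?thesis by (simp add: h(2) dist_norm)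
  qed
  have xs: "\<forall>\<^sub>F x in nhds (0::real). \<bar>x\<bar> < min \<delta> \<delta>2"
    unfolding eventually_nhds_zero1 using \<delta>(1) \<delta>2(1) by (intro exI[of _ "min \<delta> \<delta>2"]) simp
  have "\<forall>\<^sub>F x in nhds 0. c (m - 1) x = 0"
    using h(3) hs xs
  proof eventually_elim
    case (elim x)
    have small: "\<forall>\<^sub>F y in at (0::real). \<bar>y\<bar> < \<delta>2"
      unfolding eventually_at using \<delta>2(1) by (intro exI[of _ \<delta>2]) (simp add: dist_norm)
    \<comment> \<open>For each fixed small \<open>x\<close> this coefficient is a multiple of the
      derivative that vanishes at \<open>h x\<close>.\<close>
    have "c (m - 1) x = d (m - 1) (x, h x) / fact (m - 1)"
    proof (rule taylor_coefficient[where \<delta> = "\<delta> / 2" and n = m and d = "\<lambda>k y. d k (x, y)" and v = "\<lambda>y. u (x, y)" and c = "\<lambda>k. c k x"])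
      show "((\<lambda>y. d k (x, y)) has_real_derivative d (Suc k) (x, y)) (at y)" if "k < m" "\<bar>y - h x\<bar> < \<delta> / 2" for k y
        using that elim abs_triangle_ineq[of "y - h x" "h x"] by (intro der) auto
      show "\<bar>d m (x, y)\<bar> \<le> \<bar>d m (0,0)\<bar> + 1" if "\<bar>y - h x\<bar> < \<delta> / 2" for y
        using that elim abs_triangle_ineq[of "y - h x" "h x"] by (intro bnd) auto
      show "\<forall>\<^sub>F y in at 0. d 0 (x, h x + y) = (\<Sum>k<m. c k x * y ^ k) + y ^ m * u (x, y)"
        using small
      proof (rule eventually_mono)
        fix y assume "\<bar>y\<bar> < \<delta>2"
        then show "d 0 (x, h x + y) = (\<Sum>k<m. c k x * y ^ k) + y ^ m * u (x, y)"
          using \<delta>2(2)[rule_format, of x y] elim(3) by (simp add: d0 F_def)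
      qed
      show "\<forall>\<^sub>F y in at 0. \<bar>u (x, y)\<bar> \<le> \<bar>u (0,0)\<bar> + 1"
        using small
      proof (rule eventually_mono)
        fix y assume "\<bar>y\<bar> < \<delta>2"
        then show "\<bar>u (x, y)\<bar> \<le> \<bar>u (0,0)\<bar> + 1"
          using \<delta>2(2)[rule_format, of x y] elim(3) by simp
      qed
    qed (use \<delta>(1) m in auto)
    then show ?case using elim(1) by simp
  qed
  with h(1,2) cu show ?thesis unfolding F_def by (intro exI[of _ h] exI[of _ c] exI[of _ u] conjI)
qed

text \<open>Only zeros with \<open>x > 0\<close> are described, because \<open>x = t ^ q\<close>
  then has a positive solution. The last clause ranges over all \<open>\<eta>\<close>: zeros close
  to the origin must be reached at small parameters, which is what permits the branches to be cut
  later.\<close>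

definition half_branches :: "(real \<times> real \<Rightarrow> real) \<Rightarrow> (real \<Rightarrow> real \<times> real) set \<Rightarrow> bool" where
  "half_branches f Cs \<longleftrightarrow> finite Cs \<and>
    (\<forall>c\<in>Cs. germ1 (\<lambda>t. fst (c t)) \<and> germ1 (\<lambda>t. snd (c t)) \<and> c 0 = (0,0) \<and>
      (\<exists>\<eta>>0. \<forall>t. 0 < t \<and> t < \<eta> \<longrightarrow> fst (c t) > 0 \<and> f (c t) = 0)) \<and>
    (\<forall>\<eta>>0. \<exists>\<delta>>0. \<forall>x y. 0 < x \<and> x < \<delta> \<and> \<bar>y\<bar> < \<delta> \<and> f (x, y) = 0 \<longrightarrow>
      (\<exists>c\<in>Cs. \<exists>t. 0 < t \<and> t < \<eta> \<and> c t = (x, y)))"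

section \<open>The Newton edge and the induction on the order\<close>

lemma eventually_nhds_zero_power:
  assumes "\<forall>\<^sub>F x in nhds (0::real). P x" "q \<ge> 1"
  shows "\<forall>\<^sub>F t in nhds (0::real). P (t ^ q)"
proof -
  obtain d where d: "d > 0" "\<forall>x. \<bar>x\<bar> < d \<longrightarrow> P x"
    using assms(1) unfolding eventually_nhds_zero1 by (elim exE conjE) (rule that)
  have "P (t ^ q)" if "\<bar>t\<bar> < min d 1" for t
  proof -
    have "\<bar>t\<bar> ^ q \<le> \<bar>t\<bar> ^ 1" by (rule power_decreasing) (use that assms(2) in auto)
    then show ?thesis using d(2) that by (simp add: power_abs)
  qed
  then show ?thesis unfolding eventually_nhds_zero1 using d(1) by (intro exI[of _ "min d 1"]) simp
qed

text \<open>If \<open>z\<close> had multiplicity \<open>m\<close>, then \<open>P\<close> would be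
  \<open>a\<close> times the power \<open>[:- z, 1:] ^ m\<close>, whose coefficient of order
  \<open>m - 1\<close> is \<open>- m a z\<close>. Its vanishing gives \<open>z = 0\<close>, and then
  all lower coefficients vanish.\<close>

lemma order_less_degree:
  fixes P :: "real poly"
  assumes "degree P = m" "m \<ge> 1" "coeff P (m - 1) = 0" "k < m" "coeff P k \<noteq> 0"
  shows "order z P < m"
proof (rule ccontr)
  have P0: "P \<noteq> 0" using assms(5) by auto
  assume "\<not> order z P < m"
  then have om: "order z P = m" using order_degree[OF P0, of z] assms(1) by simp
  have "[:- z, 1:] ^ m dvd P" using order_1[of z P] om by simp
  then obtain Q where Q: "P = [:- z, 1:] ^ m * Q" by (rule dvdE)
  have Q0: "Q \<noteq> 0" using Q P0 by auto
  have "degree P = m + degree Q"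
    unfolding Q using Q0 by (subst degree_mult_eq) (auto simp: degree_linear_power)
  then have "degree Q = 0" using assms(1) by simp
  then obtain a where a: "Q = [:a:]" by (rule degree_eq_zeroE)
  have a0: "a \<noteq> 0" using a Q0 by auto
  have cf: "coeff P i = a * (real (m choose i) * (- z) ^ (m - i))" if "i \<le> m" for i
    unfolding Q a using coeff_linear_poly_power[OF that, of "- z" 1] by simp
  have "a * (real (m choose (m - 1)) * (- z) ^ (m - (m - 1))) = 0" using cf[of "m - 1"] assms(3) by simp
  moreover have "m choose (m - 1) > 0" "m - (m - 1) = 1" using assms(2) by auto
  ultimately have "z = 0" using a0 by auto
  then have "coeff P k = 0" using cf[of k] assms(4) by simp
  then show False using assms(5) by simp
qed

text \<open>The degenerate case without a Newton edge: after the shift \<open>f\<close> is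
  \<open>y ^ m\<close> times a unit, so its zeros form the single curve
  \<open>y = h x\<close>.\<close>

lemma half_branches_simple:
  assumes h: "germ1 h" "h 0 = 0" and u: "germ u" "u (0,0) \<noteq> 0" and m: "m \<ge> 1"
    and E: "\<forall>\<^sub>F z in nhds (0,0). f (fst z, h (fst z) + snd z) = snd z ^ m * u z"
  shows "half_branches f {\<lambda>t. (t, h t)}"
proof -
  have "\<forall>\<^sub>F z in nhds (0,0). u z \<noteq> 0"
  proof -
    have "(u \<longlongrightarrow> u (0,0)) (nhds (0,0))" by (rule germ_tendsto_nhds[OF u(1)])
    from tendsto_imp_eventually_ne[OF this u(2)] show ?thesis .
  qed
  from eventually_conj[OF E this] obtain d where d: "d > 0" "\<forall>x y. \<bar>x\<bar> < d \<longrightarrow> \<bar>y\<bar> < d \<longrightarrow>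
      f (fst (x, y), h (fst (x, y)) + snd (x, y)) = snd (x, y) ^ m * u (x, y) \<and> u (x, y) \<noteq> 0"
    unfolding eventually_nhds_zero2 by (elim exE conjE) (rule that)
  have fd: "f (x, h x + y) = y ^ m * u (x, y)" "u (x, y) \<noteq> 0" if "\<bar>x\<bar> < d" "\<bar>y\<bar> < d" for x y
    using d(2) that by simp_all
  have "(h \<longlongrightarrow> h 0) (nhds 0)" by (rule germ1_tendsto_nhds[OF h(1)])
  from tendstoD[OF this, of "d / 2"] d(1) have "\<forall>\<^sub>F x in nhds 0. \<bar>h x\<bar> < d / 2" by (simp add: h(2) dist_norm)
  then obtain d' where d': "d' > 0" "\<forall>x. \<bar>x\<bar> < d' \<longrightarrow> \<bar>h x\<bar> < d / 2"
    unfolding eventually_nhds_zero1 by (elim exE conjE) (rule that)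
  have z0: "f (t, h t) = 0" if "\<bar>t\<bar> < d" for t using fd(1)[of t 0] that d(1) m by simp
  have cov: "y = h x" if "0 < x" "x < min (d / 2) d'" "\<bar>y\<bar> < d / 2" "f (x, y) = 0" for x y
  proof -
    have "\<bar>h x\<bar> < d / 2" using d'(2) that by simp
    then have "\<bar>y - h x\<bar> < d" using that by linarith
    then have "f (x, h x + (y - h x)) = (y - h x) ^ m * u (x, y - h x)" "u (x, y - h x) \<noteq> 0"
      using that d(1) by (intro fd; simp)+
    then show ?thesis using that(4) by simp
  qed
  show ?thesis unfolding half_branches_def
  proof (intro conjI ballI allI impI)
    fix c assume c: "c \<in> {\<lambda>t. (t, h t)}"
    show "germ1 (\<lambda>t. fst (c t))" "germ1 (\<lambda>t. snd (c t))" "c 0 = (0,0)" using c h germ_fst by simp_all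
    show "\<exists>\<eta>>0. \<forall>t. 0 < t \<and> t < \<eta> \<longrightarrow> fst (c t) > 0 \<and> f (c t) = 0"
      using c d(1) z0 by (intro exI[of _ d]) simp
  next
    fix \<eta> :: real assume \<eta>: "\<eta> > 0"
    show "\<exists>\<delta>>0. \<forall>x y. 0 < x \<and> x < \<delta> \<and> \<bar>y\<bar> < \<delta> \<and> f (x, y) = 0 \<longrightarrow>
      (\<exists>c\<in>{\<lambda>t. (t, h t)}. \<exists>t. 0 < t \<and> t < \<eta> \<and> c t = (x, y))"
    proof (intro exI[of _ "min \<eta> (min (d / 2) d')"] conjI allI impI)
      show "0 < min \<eta> (min (d / 2) d')" using \<eta> d(1) d'(1) by simp
      fix x y assume xy: "0 < x \<and> x < min \<eta> (min (d / 2) d') \<and> \<bar>y\<bar> < min \<eta> (min (d / 2) d') \<and> f (x, y) = 0"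
      then have "y = h x" by (intro cov) auto
      then show "\<exists>c\<in>{\<lambda>t. (t, h t)}. \<exists>t. 0 < t \<and> t < \<eta> \<and> c t = (x, y)"
        using xy by (intro bexI[of _ "\<lambda>t. (t, h t)"] exI[of _ x]) simp_all
    qed
  qed simp
qed

text \<open>With \<open>e k\<close> the order of \<open>c k\<close>, the slope of the Newton edge is
  the least value of \<open>e k / (m - k)\<close>, and \<open>p / q\<close> is that slope. Where it
  is attained, \<open>C k 0\<close> is nonzero.\<close>

lemma newton_exponents:
  fixes c :: "nat \<Rightarrow> real \<Rightarrow> real"
  assumes c: "\<And>k. germ1 (c k)" "\<And>k. k < m \<Longrightarrow> c k 0 = 0"
    and last: "\<forall>\<^sub>F x in nhds 0. c (m - 1) x = 0" and nz: "\<exists>k<m. \<not> (\<forall>\<^sub>F x in nhds 0. c k x = 0)"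
  shows "\<exists>(q::nat) (p::nat) C. q \<ge> 1 \<and> p \<ge> 1 \<and> (\<forall>k. germ1 (C k)) \<and> C (m - 1) 0 = 0 \<and> (\<exists>k<m. C k 0 \<noteq> (0::real)) \<and>
    (\<forall>k<m. \<forall>\<^sub>F t in nhds 0. c k (t ^ q) = t ^ (p * (m - k)) * C k t)"
proof -
  define K where "K = {k. k < m \<and> \<not> (\<forall>\<^sub>F x in nhds 0. c k x = 0)}"
  have K: "finite K" "K \<noteq> {}" "\<And>k. k \<in> K \<Longrightarrow> k < m" using nz by (auto simp: K_def)
  let ?R = "\<lambda>k p. germ1 (snd p) \<and> snd p 0 \<noteq> 0 \<and> (\<forall>\<^sub>F x in nhds 0. c k x = x ^ fst p * snd p x)"
  have "\<forall>k\<in>K. \<exists>p. ?R k p"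
  proof
    fix k assume k: "k \<in> K"
    then have "\<not> (\<forall>\<^sub>F x in nhds 0. c k x = 0)" by (simp add: K_def)
    with germ1_order[OF c(1)[of k]] obtain e g where "germ1 g" "g 0 \<noteq> 0" "\<forall>\<^sub>F x in nhds 0. c k x = x ^ e *\<^sub>R g x"
      by blast
    then show "\<exists>p. ?R k p" by (intro exI[of _ "(e, g)"]) simp
  qed
  from bchoice[OF this] obtain eg where eg: "\<forall>k\<in>K. ?R k (eg k)" ..
  define e where "e k = fst (eg k)" for k
  define g where "g k = snd (eg k)" for k
  have g: "germ1 (g k)" "g k 0 \<noteq> 0" "\<forall>\<^sub>F x in nhds 0. c k x = x ^ e k * g k x" if "k \<in> K" for k
    using bspec[OF eg that] by (simp_all add: e_def g_def)
  have e1: "e k \<ge> 1" if "k \<in> K" for k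
  proof (rule ccontr)
    assume "\<not> e k \<ge> 1"
    moreover have "c k 0 = 0 ^ e k * g k 0" using eventually_nhds_x_imp_x[OF g(3)[OF that]] .
    ultimately show False using c(2)[OF K(3)[OF that]] g(2)[OF that] by simp
  qed
  \<comment> \<open>Every \<open>m - k\<close> divides \<open>m!\<close>, so this \<open>q\<close>
    makes all \<open>q * e k / (m - k)\<close> integers, and \<open>p\<close> can be their
    minimum.\<close>
  define q :: nat where "q = fact m"
  define w where "w k = e k * (q div (m - k))" for k
  define p where "p = Min (w ` K)"
  have q1: "q \<ge> 1" by (simp add: q_def)
  have dv: "(m - k) * (q div (m - k)) = q" if "k \<in> K" for k
    using dvd_fact[of "m - k" m] K(3)[OF that] unfolding q_def by simp
  have pw: "p \<le> w k" if "k \<in> K" for k unfolding p_def using K(1) that by simp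
  obtain k0 where k0: "k0 \<in> K" "w k0 = p"
    using Min_in[of "w ` K"] K(1,2) unfolding p_def by (metis (no_types, lifting) finite_imageI image_iff image_is_empty)
  have p1: "p \<ge> 1"
  proof -
    have "q div (m - k0) \<noteq> 0" using dv[OF k0(1)] q1 by (metis mult_0_right not_one_le_zero)
    then show ?thesis using k0(2)[unfolded w_def, symmetric] e1[OF k0(1)] by simp
  qed
  have eq: "w k * (m - k) = e k * q" if "k \<in> K" for k
    using dv[OF that] unfolding w_def by (metis mult.assoc mult.commute)
  have le: "p * (m - k) \<le> e k * q" if "k \<in> K" for k
    using mult_le_mono1[OF pw[OF that], of "m - k"] eq[OF that] by simp
  \<comment> \<open>The subtraction of naturals is exact by \<open>le\<close>; coefficients that
    vanish identically near 0 are replaced by 0.\<close>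
  define C where "C k t = (if k \<in> K then t ^ (e k * q - p * (m - k)) * g k (t ^ q) else 0)" for k t
  have "germ1 (C k)" for k
  proof (cases "k \<in> K")
    case True
    have "germ (\<lambda>z. g k (fst z ^ q))"
      by (rule germ1_comp[OF g(1)[OF True] germ_power[OF germ_fst]]) (use q1 in simp)
    then show ?thesis using True germ_mult[OF germ_power[OF germ_fst]] by (simp add: C_def)
  qed (simp add: C_def germ_const)
  moreover have "m - 1 \<notin> K" using last by (simp add: K_def)
  then have "C (m - 1) 0 = 0" by (simp add: C_def)
  moreover have "C k0 0 \<noteq> 0"
    using k0 eq[OF k0(1)] g(2)[OF k0(1)] q1 by (simp add: C_def power_0_left)
  then have "\<exists>k<m. C k 0 \<noteq> 0" using K(3)[OF k0(1)] by blast
  moreover have "\<forall>\<^sub>F t in nhds 0. c k (t ^ q) = t ^ (p * (m - k)) * C k t" if "k < m" for k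
  proof (cases "k \<in> K")
    case True
    from eventually_nhds_zero_power[OF g(3)[OF True] q1] show ?thesis
    proof eventually_elim
      case (elim t)
      have "(t ^ q) ^ e k = t ^ (p * (m - k)) * t ^ (e k * q - p * (m - k))"
        using le[OF True] by (simp add: power_add[symmetric] power_mult[symmetric] mult.commute)
      then show ?case using elim True by (simp add: C_def)
    qed
  next
    case False
    then have "\<forall>\<^sub>F x in nhds 0. c k x = 0" using that by (simp add: K_def)
    from eventually_nhds_zero_power[OF this q1] show ?thesis using False by (simp add: C_def)
  qed
  ultimately show ?thesis using q1 p1 
    by - (rule exI[of _ q], rule exI[of _ p], rule exI[of _ C], intro conjI allI impI)
qed

text \<open>With \<open>x = t\<^sup>q\<close> and \<open>y = h x + t\<^sup>p z\<close> the equation becomes \<open>G t z = 0\<close>, and by the choice of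
  \<open>q, p\<close> every root of the polynomial \<open>G 0\<close> has multiplicity below \<open>m\<close>.\<close>

lemma newton_branches:
  fixes f :: "real \<times> real \<Rightarrow> real"
  assumes h: "germ1 h" "h 0 = 0" and u: "germ u" "u (0,0) \<noteq> 0" and m: "m \<ge> 1"
    and E: "\<forall>\<^sub>F z in nhds (0,0). f (fst z, h (fst z) + snd z) = (\<Sum>k<m. c k (fst z) * snd z ^ k) + snd z ^ m * u z"
    and q: "q \<ge> 1" and p: "p \<ge> 1" and C: "\<And>k. germ1 (C k)" "C (m - 1) 0 = 0" "\<exists>k<m. C k 0 \<noteq> 0"
    and cC: "\<And>k. k < m \<Longrightarrow> \<forall>\<^sub>F t in nhds 0. c k (t ^ q) = t ^ (p * (m - k)) * C k t"
    and IH: "\<And>g n. n < m \<Longrightarrow> germ g \<Longrightarrow> regular_order n g \<Longrightarrow> \<exists>Cs. half_branches g Cs"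
  shows "\<exists>Cs. half_branches f Cs"
proof -
  \<comment> \<open>The equation after substitution, divided by \<open>t ^ (p * m)\<close>.\<close>
  define G where "G t z = (\<Sum>k<m. C k t * z ^ k) + z ^ m * u (t ^ q, t ^ p * z)" for t z
  have q0: "(0::real) ^ q = 0" and p0: "(0::real) ^ p = 0" using q p by simp_all
  have tq: "\<bar>t ^ n\<bar> \<le> \<bar>t\<bar>" if "\<bar>t\<bar> < 1" "n \<ge> 1" for t :: real and n
    using power_decreasing[of 1 n "\<bar>t\<bar>"] that by (simp add: power_abs)

  obtain \<delta>0 where \<delta>0: "\<delta>0 > 0" "\<And>t z. \<bar>t\<bar> < \<delta>0 \<Longrightarrow> \<bar>t ^ p * z\<bar> < \<delta>0 \<Longrightarrow>
      f (t ^ q, h (t ^ q) + t ^ p * z) = t ^ (p * m) * G t z"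
  proof -
    obtain d where d: "d > 0" "\<forall>x y. \<bar>x\<bar> < d \<longrightarrow> \<bar>y\<bar> < d \<longrightarrow>
        f (fst (x, y), h (fst (x, y)) + snd (x, y)) = (\<Sum>k<m. c k (fst (x, y)) * snd (x, y) ^ k) + snd (x, y) ^ m * u (x, y)"
      using E unfolding eventually_nhds_zero2 by (elim exE conjE) (rule that)
    have "\<forall>\<^sub>F t in nhds 0. \<forall>k\<in>{..<m}. c k (t ^ q) = t ^ (p * (m - k)) * C k t"
      by (rule eventually_ball_finite) (use cC in auto)
    then obtain d' where d': "d' > 0" "\<forall>t. \<bar>t\<bar> < d' \<longrightarrow> (\<forall>k\<in>{..<m}. c k (t ^ q) = t ^ (p * (m - k)) * C k t)"
      unfolding eventually_nhds_zero1 by (elim exE conjE) (rule that)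
    show ?thesis
    proof (rule that[of "min (min d d') 1"])
      show "0 < min (min d d') 1" using d(1) d'(1) by simp
      fix t z :: real assume t: "\<bar>t\<bar> < min (min d d') 1" and z: "\<bar>t ^ p * z\<bar> < min (min d d') 1"
      have "\<bar>t ^ q\<bar> < d" using tq[of t q] t q by simp
      then have "f (t ^ q, h (t ^ q) + t ^ p * z) = (\<Sum>k<m. c k (t ^ q) * (t ^ p * z) ^ k) + (t ^ p * z) ^ m * u (t ^ q, t ^ p * z)"
        using d(2)[rule_format, of "t ^ q" "t ^ p * z"] z by simp
      also have "(\<Sum>k<m. c k (t ^ q) * (t ^ p * z) ^ k) = (\<Sum>k<m. t ^ (p * m) * (C k t * z ^ k))"
      proof (rule sum.cong)
        fix k assume k: "k \<in> {..<m}"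
        have "p * m = p * (m - k) + p * k" using k by (simp add: distrib_left[symmetric])
        then have "t ^ (p * m) = t ^ (p * (m - k)) * (t ^ p) ^ k" by (simp add: power_add power_mult)
        moreover have "c k (t ^ q) = t ^ (p * (m - k)) * C k t" using d'(2) t k by simp
        ultimately show "c k (t ^ q) * (t ^ p * z) ^ k = t ^ (p * m) * (C k t * z ^ k)"
          by (simp add: power_mult_distrib)
      qed simp
      also have "(t ^ p * z) ^ m = t ^ (p * m) * z ^ m" by (simp add: power_mult_distrib power_mult)
      finally show "f (t ^ q, h (t ^ q) + t ^ p * z) = t ^ (p * m) * G t z"
        unfolding G_def by (simp add: sum_distrib_left distrib_left mult.assoc)
    qed
  qed

  define P where "P = (\<Sum>k<m. monom (C k 0) k) + monom (u (0,0)) m"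
  have cP: "coeff P i = (if i < m then C i 0 else if i = m then u (0,0) else 0)" for i
    unfolding P_def by (simp add: coeff_sum sum.delta)
  have degP: "degree P = m"
  proof (rule antisym)
    show "degree P \<le> m" by (rule degree_le) (simp add: cP)
    show "m \<le> degree P" by (rule le_degree) (simp add: cP u(2))
  qed
  have P0: "P \<noteq> 0" using cP[of m] u(2) by auto
  have PG: "poly P z = G 0 z" for z
    unfolding P_def G_def by (simp add: poly_sum poly_monom q0 p0 mult.commute)
  obtain k1 where k1: "k1 < m" "C k1 0 \<noteq> 0" using C(3) by blast
  have ord: "order z P < m" for z
    by (rule order_less_degree[OF degP m _ k1(1)]) (use cP[of "m - 1"] cP[of k1] m k1 C(2) in simp_all)
  define Z where "Z = {z. poly P z = 0}"
  have finZ: "finite Z" unfolding Z_def by (rule poly_roots_finite[OF P0])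
  \<comment> \<open>\<open>G\<close> recentred at \<open>z0\<close>; its order in the second
    variable is the multiplicity of \<open>z0\<close> as a root of \<open>P\<close>, which is 0 if
    \<open>z0\<close> is no root.\<close>
  define g where "g z0 v = G (fst v) (z0 + snd v)" for z0 v
  have gg: "germ (g z0)" for z0
  proof -
    have zz: "germ (\<lambda>v. z0 + snd v)" by (rule germ_add[OF germ_const germ_snd])
    have "germ (\<lambda>v. u (fst v ^ q, fst v ^ p * (z0 + snd v)))"
      by (rule germ_comp[OF u(1) germ_power[OF germ_fst] germ_mult[OF germ_power[OF germ_fst] zz]]) (simp_all add: q0 p0)
    then show ?thesis unfolding g_def[abs_def] G_def
      by (intro germ_add germ_sum germ_mult germ_power[OF zz] C(1)) simp_all
  qed
  have "regular_order (order z0 P) (g z0)" for z0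
  proof -
    obtain Q where Q: "P = [:- z0, 1:] ^ order z0 P * Q" "\<not> [:- z0, 1:] dvd Q"
      using order_decomp[OF P0, of z0] by (elim exE conjE) (rule that)
    have Qz: "poly Q z0 \<noteq> 0" using Q(2) by (simp add: poly_eq_0_iff_dvd)
    have "poly P (z0 + y) = y ^ order z0 P * poly Q (z0 + y)" for y
      using arg_cong[OF Q(1), of "\<lambda>R. poly R (z0 + y)"] by (simp add: poly_power)
    then have "g z0 (0, y) / y ^ order z0 P = poly Q (z0 + y)" if "y \<noteq> 0" for y
      using that by (simp add: g_def PG[symmetric])
    then have "\<forall>\<^sub>F y in at 0. poly Q (z0 + y) = g z0 (0, y) / y ^ order z0 P"
      unfolding eventually_at_filter by (intro always_eventually) simp
    moreover have "((\<lambda>y. poly Q (z0 + y)) \<longlongrightarrow> poly Q (z0 + 0)) (at 0)" by (intro tendsto_intros)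
    ultimately have "((\<lambda>y. g z0 (0, y) / y ^ order z0 P) \<longlongrightarrow> poly Q z0) (at 0)"
      using Lim_transform_eventually by fastforce
    then show ?thesis unfolding regular_order_def using Qz by blast
  qed
  then have "\<forall>z0. \<exists>Cs. half_branches (g z0) Cs" using IH[OF ord gg] by blast
  from choice[OF this] obtain CS where CS: "\<forall>z0. half_branches (g z0) (CS z0)" ..
  have finCS: "finite (CS z0)" for z0 using spec[OF CS, of z0] unfolding half_branches_def by (rule conjunct1)
  have CS1: "germ1 (\<lambda>t. fst (b t))" "germ1 (\<lambda>t. snd (b t))" "b 0 = (0,0)"
    "\<exists>\<eta>>0. \<forall>t. 0 < t \<and> t < \<eta> \<longrightarrow> fst (b t) > 0 \<and> g z0 (b t) = 0" if "b \<in> CS z0" for b z0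
    using bspec[OF conjunct1[OF conjunct2[OF spec[OF CS, of z0, unfolded half_branches_def]]] that] by simp_all
  have CS2: "\<exists>\<delta>>0. \<forall>x y. 0 < x \<and> x < \<delta> \<and> \<bar>y\<bar> < \<delta> \<and> g z0 (x, y) = 0 \<longrightarrow>
      (\<exists>b\<in>CS z0. \<exists>t. 0 < t \<and> t < \<eta> \<and> b t = (x, y))" if "\<eta> > 0" for z0 \<eta>
    using conjunct2[OF conjunct2[OF spec[OF CS, of z0, unfolded half_branches_def]]] that by simp
  \<comment> \<open>Carries a branch of \<open>g z0\<close> back to the original
    coordinates.\<close>
  define L where "L z0 b t = (fst (b t) ^ q, h (fst (b t) ^ q) + fst (b t) ^ p * (z0 + snd (b t)))"
    for z0 :: real and b :: "real \<Rightarrow> real \<times> real" and t :: real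

  \<comment> \<open>A root bound uniform in small \<open>t\<close>: \<open>u\<close> stays away from
    0, so for \<open>\<bar>z\<bar> > 1\<close> the leading term forces
    \<open>\<bar>z\<bar> * \<kappa> \<le> M\<close>. The relevant values of \<open>z\<close> thus
    form a compact range.\<close>
  obtain Kb \<delta>1 where Kb: "\<delta>1 > 0" "\<And>t z. 0 < t \<Longrightarrow> t < \<delta>1 \<Longrightarrow> \<bar>t ^ p * z\<bar> < \<delta>1 \<Longrightarrow> G t z = 0 \<Longrightarrow> \<bar>z\<bar> \<le> Kb"
  proof -
    define \<kappa> where "\<kappa> = \<bar>u (0,0)\<bar> / 2"
    have \<kappa>: "\<kappa> > 0" using u(2) by (simp add: \<kappa>_def)
    have "(u \<longlongrightarrow> u (0,0)) (nhds (0,0))" by (rule germ_tendsto_nhds[OF u(1)])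
    from tendstoD[OF this \<kappa>] have "\<forall>\<^sub>F z in nhds (0,0). \<kappa> \<le> \<bar>u z\<bar>"
    proof (rule eventually_mono)
      fix z assume "dist (u z) (u (0,0)) < \<kappa>"
      then show "\<kappa> \<le> \<bar>u z\<bar>" unfolding dist_real_def \<kappa>_def by linarith
    qed
    then obtain d where d: "d > 0" "\<forall>x y. \<bar>x\<bar> < d \<longrightarrow> \<bar>y\<bar> < d \<longrightarrow> \<kappa> \<le> \<bar>u (x, y)\<bar>"
      unfolding eventually_nhds_zero2 by (elim exE conjE) (rule that)
    define M where "M = (\<Sum>k<m. \<bar>C k 0\<bar> + 1)"
    have "\<forall>\<^sub>F t in nhds 0. \<bar>C k t\<bar> \<le> \<bar>C k 0\<bar> + 1" for k
      by (rule eventually_bounded_of_tendsto[OF germ1_tendsto_nhds[OF C(1)]])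
    then have "\<forall>\<^sub>F t in nhds 0. \<forall>k\<in>{..<m}. \<bar>C k t\<bar> \<le> \<bar>C k 0\<bar> + 1" by (intro eventually_ball_finite) auto
    then obtain d' where d': "d' > 0" "\<forall>t. \<bar>t\<bar> < d' \<longrightarrow> (\<forall>k\<in>{..<m}. \<bar>C k t\<bar> \<le> \<bar>C k 0\<bar> + 1)"
      unfolding eventually_nhds_zero1 by (elim exE conjE) (rule that)
    show ?thesis
    proof (rule that[of "min (min d d') 1" "max 1 (M / \<kappa>)"])
      show "0 < min (min d d') 1" using d(1) d'(1) by simp
      fix t z :: real assume t: "0 < t" "t < min (min d d') 1" and z: "\<bar>t ^ p * z\<bar> < min (min d d') 1" and G0: "G t z = 0"
      show "\<bar>z\<bar> \<le> max 1 (M / \<kappa>)"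
      proof (cases "\<bar>z\<bar> \<le> 1")
        case False
        have "\<bar>t ^ q\<bar> < d" using tq[of t q] t q by simp
        then have uk: "\<kappa> \<le> \<bar>u (t ^ q, t ^ p * z)\<bar>" using d(2) z by simp
        have "z ^ m * u (t ^ q, t ^ p * z) = - (\<Sum>k<m. C k t * z ^ k)" using G0 unfolding G_def by linarith
        then have eq: "\<bar>z\<bar> ^ m * \<bar>u (t ^ q, t ^ p * z)\<bar> = \<bar>\<Sum>k<m. C k t * z ^ k\<bar>"
          by (metis abs_minus_cancel abs_mult power_abs)
        have "\<bar>z\<bar> ^ m * \<kappa> \<le> \<bar>z\<bar> ^ m * \<bar>u (t ^ q, t ^ p * z)\<bar>" using uk by (intro mult_left_mono) auto
        also have "\<dots> \<le> (\<Sum>k<m. \<bar>C k t * z ^ k\<bar>)" unfolding eq by (rule sum_abs)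
        also have "\<dots> \<le> (\<Sum>k<m. (\<bar>C k 0\<bar> + 1) * \<bar>z\<bar> ^ (m - 1))"
        proof (rule sum_mono)
          fix k assume k: "k \<in> {..<m}"
          have "\<bar>C k t\<bar> \<le> \<bar>C k 0\<bar> + 1" using d'(2) t k by simp
          moreover have "\<bar>z\<bar> ^ k \<le> \<bar>z\<bar> ^ (m - 1)" using k False by (intro power_increasing) auto
          ultimately show "\<bar>C k t * z ^ k\<bar> \<le> (\<bar>C k 0\<bar> + 1) * \<bar>z\<bar> ^ (m - 1)"
            unfolding abs_mult power_abs by (rule mult_mono) auto
        qed
        also have "\<dots> = M * \<bar>z\<bar> ^ (m - 1)" unfolding M_def by (simp only: sum_distrib_right)
        finally have "\<bar>z\<bar> * \<bar>z\<bar> ^ (m - 1) * \<kappa> \<le> M * \<bar>z\<bar> ^ (m - 1)" using m by (cases m) simp_all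
        moreover have "\<bar>z\<bar> ^ (m - 1) > 0" by (rule zero_less_power) (use False in linarith)
        ultimately have "\<bar>z\<bar> * \<kappa> \<le> M" by (simp add: mult.commute mult.left_commute)
        then have "\<bar>z\<bar> \<le> M / \<kappa>" using \<kappa> by (simp add: pos_le_divide_eq)
        then show ?thesis by simp
      qed simp
    qed
  qed

  \<comment> \<open>Each \<open>z0\<close> has a neighbourhood in which the zeros of
    \<open>G\<close> lie on the branches at \<open>z0\<close>, or are absent if \<open>z0\<close> is
    not a root.\<close>
  have local: "\<exists>\<delta>>0. \<forall>t w. 0 < t \<and> t < \<delta> \<and> \<bar>w\<bar> < \<delta> \<and> G t (z0 + w) = 0 \<longrightarrow>
      z0 \<in> Z \<and> (\<exists>b\<in>CS z0. \<exists>s. 0 < s \<and> s < \<eta> \<and> b s = (t, w))" if "\<eta> > 0" for \<eta> z0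
  proof (cases "z0 \<in> Z")
    case True
    then show ?thesis using CS2[OF that, of z0] unfolding g_def by simp
  next
    case False
    have "(g z0 \<longlongrightarrow> g z0 (0,0)) (nhds (0,0))" by (rule germ_tendsto_nhds[OF gg])
    moreover have "g z0 (0,0) \<noteq> 0" using False by (simp add: Z_def PG g_def)
    ultimately have "\<forall>\<^sub>F v in nhds (0,0). g z0 v \<noteq> 0" by (rule tendsto_imp_eventually_ne)
    then obtain d where d: "d > 0" "\<forall>x y. \<bar>x\<bar> < d \<longrightarrow> \<bar>y\<bar> < d \<longrightarrow> g z0 (x, y) \<noteq> 0"
      unfolding eventually_nhds_zero2 by (elim exE conjE) (rule that)
    show ?thesis
    proof (intro exI[of _ d] conjI allI impI d(1))
      fix t w assume tw: "0 < t \<and> t < d \<and> \<bar>w\<bar> < d \<and> G t (z0 + w) = 0"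
      then have "g z0 (t, w) \<noteq> 0" using d(2) by simp
      then have False using tw by (simp add: g_def)
      then show "z0 \<in> Z" "\<exists>b\<in>CS z0. \<exists>s. 0 < s \<and> s < \<eta> \<and> b s = (t, w)" by simp_all
    qed
  qed

  have "half_branches f (\<Union>z0\<in>Z. L z0 ` CS z0)"
    unfolding half_branches_def
  proof (intro conjI ballI allI impI)
    show "finite (\<Union>z0\<in>Z. L z0 ` CS z0)" using finZ finCS by simp
  next
    fix c' assume "c' \<in> (\<Union>z0\<in>Z. L z0 ` CS z0)"
    then obtain z0 b where b: "b \<in> CS z0" and c': "c' = L z0 b" by blast
    note B = CS1[OF b]
    have B0: "fst (b 0) = 0" "snd (b 0) = 0" using B(3) by simp_all
    have fq: "germ1 (\<lambda>t. fst (b t) ^ q)" by (rule germ_power[OF B(1)])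
    have hq: "germ1 (\<lambda>t. h (fst (b t) ^ q))"
      by (rule germ1_comp[OF h(1) fq]) (simp add: B0 q0)
    show "germ1 (\<lambda>t. fst (c' t))" using fq by (simp add: c' L_def)
    have "germ1 (\<lambda>t. h (fst (b t) ^ q) + fst (b t) ^ p * (z0 + snd (b t)))"
      by (rule germ_add[OF hq germ_mult[OF germ_power[OF B(1)] germ_add[OF germ_const B(2)]]])
    then show "germ1 (\<lambda>t. snd (c' t))" by (simp add: c' L_def)
    show "c' 0 = (0,0)" by (simp add: c' L_def B0 q0 p0 h(2))
    obtain \<eta> where \<eta>: "\<eta> > 0" "\<forall>t. 0 < t \<and> t < \<eta> \<longrightarrow> fst (b t) > 0 \<and> g z0 (b t) = 0"
      using B(4) by (elim exE conjE) (rule that)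
    have "isCont (\<lambda>t. fst (b t)) 0" "isCont (\<lambda>t. snd (b t)) 0" by (rule germ1_isCont[OF B(1)], rule germ1_isCont[OF B(2)])
    then have t1: "((\<lambda>t. fst (b t)) \<longlongrightarrow> fst (b 0)) (nhds 0)" and t2: "((\<lambda>t. snd (b t)) \<longlongrightarrow> snd (b 0)) (nhds 0)"
      by (simp_all add: isCont_def tendsto_nhds_iff)
    have t3: "((\<lambda>t. fst (b t) ^ p * (z0 + snd (b t))) \<longlongrightarrow> fst (b 0) ^ p * (z0 + snd (b 0))) (nhds 0)"
      by (intro tendsto_intros t1 t2)
    from eventually_conj[OF tendstoD[OF t1 \<delta>0(1)] tendstoD[OF t3 \<delta>0(1)]]
    have "\<forall>\<^sub>F t in nhds 0. \<bar>fst (b t)\<bar> < \<delta>0 \<and> \<bar>fst (b t) ^ p * (z0 + snd (b t))\<bar> < \<delta>0"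
      by (simp add: B0 p0 dist_norm)
    then obtain \<eta>' where \<eta>': "\<eta>' > 0" "\<forall>t. \<bar>t\<bar> < \<eta>' \<longrightarrow> \<bar>fst (b t)\<bar> < \<delta>0 \<and> \<bar>fst (b t) ^ p * (z0 + snd (b t))\<bar> < \<delta>0"
      unfolding eventually_nhds_zero1 by (elim exE conjE) (rule that)
    show "\<exists>\<eta>>0. \<forall>t. 0 < t \<and> t < \<eta> \<longrightarrow> fst (c' t) > 0 \<and> f (c' t) = 0"
    proof (intro exI[of _ "min \<eta> \<eta>'"] conjI[of "0 < min \<eta> \<eta>'"] allI impI)
      show "0 < min \<eta> \<eta>'" using \<eta>(1) \<eta>'(1) by simp
      fix t assume t: "0 < t \<and> t < min \<eta> \<eta>'"
      then have b1: "fst (b t) > 0" "g z0 (b t) = 0" and b2: "\<bar>fst (b t)\<bar> < \<delta>0" "\<bar>fst (b t) ^ p * (z0 + snd (b t))\<bar> < \<delta>0"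
        using \<eta>(2) \<eta>'(2) by simp_all
      have "f (c' t) = fst (b t) ^ (p * m) * G (fst (b t)) (z0 + snd (b t))"
        unfolding c' L_def by (rule \<delta>0(2)[OF b2])
      also have "\<dots> = 0" using b1(2) by (simp add: g_def)
      finally show "fst (c' t) > 0 \<and> f (c' t) = 0" using b1(1) by (simp add: c' L_def)
    qed
  next
    fix \<eta> :: real assume \<eta>: "\<eta> > 0"
    have "\<forall>z0. \<exists>\<delta>. \<delta> > 0 \<and> (\<forall>t w. 0 < t \<and> t < \<delta> \<and> \<bar>w\<bar> < \<delta> \<and> G t (z0 + w) = 0 \<longrightarrow>
      z0 \<in> Z \<and> (\<exists>b\<in>CS z0. \<exists>s. 0 < s \<and> s < \<eta> \<and> b s = (t, w)))" using local[OF \<eta>] by blast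
    from choice[OF this] obtain r where r: "\<forall>z0. r z0 > 0 \<and> (\<forall>t w. 0 < t \<and> t < r z0 \<and> \<bar>w\<bar> < r z0 \<and> G t (z0 + w) = 0 \<longrightarrow>
      z0 \<in> Z \<and> (\<exists>b\<in>CS z0. \<exists>s. 0 < s \<and> s < \<eta> \<and> b s = (t, w)))" ..
    have r1: "r z0 > 0" for z0 by (rule conjunct1[OF spec[OF r]])
    have r2: "z0 \<in> Z" "\<exists>b\<in>CS z0. \<exists>s. 0 < s \<and> s < \<eta> \<and> b s = (t, w)"
      if "0 < t" "t < r z0" "\<bar>w\<bar> < r z0" "G t (z0 + w) = 0" for z0 t w
      using conjunct2[OF spec[OF r, of z0]] that by simp_all
    \<comment> \<open>Compactness reduces these neighbourhoods to finitely many, so that a single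
      \<open>\<mu>\<close> serves for the whole range of \<open>z\<close>.\<close>
    have "{-Kb..Kb} \<subseteq> (\<Union>z0\<in>{-Kb..Kb}. ball z0 (r z0))" using r1 by force
    then obtain D where D: "D \<subseteq> {-Kb..Kb}" "finite D" "{-Kb..Kb} \<subseteq> (\<Union>z0\<in>D. ball z0 (r z0))"
      using compactE_image[of "{-Kb..Kb}" "{-Kb..Kb}" "\<lambda>z0. ball z0 (r z0)"] by (metis compact_Icc open_ball)
    define \<mu> where "\<mu> = Min (insert 1 (insert \<delta>0 (insert \<delta>1 (r ` D))))"
    have \<mu>: "\<mu> > 0" "\<mu> \<le> 1" "\<mu> \<le> \<delta>0" "\<mu> \<le> \<delta>1" "\<And>z0. z0 \<in> D \<Longrightarrow> \<mu> \<le> r z0"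
    proof -
      have fin: "finite (insert 1 (insert \<delta>0 (insert \<delta>1 (r ` D))))" using D(2) by simp
      show "\<mu> > 0" unfolding \<mu>_def using fin \<delta>0(1) Kb(1) r1 by (subst Min_gr_iff) auto
      show "\<mu> \<le> 1" "\<mu> \<le> \<delta>0" "\<mu> \<le> \<delta>1" unfolding \<mu>_def by (rule Min_le[OF fin], simp)+
      show "\<mu> \<le> r z0" if "z0 \<in> D" for z0 unfolding \<mu>_def by (rule Min_le[OF fin]) (use that in simp)
    qed
    have "(h \<longlongrightarrow> h 0) (nhds 0)" by (rule germ1_tendsto_nhds[OF h(1)])
    from tendstoD[OF this, of "\<mu> / 2"] \<mu>(1) have "\<forall>\<^sub>F x in nhds 0. \<bar>h x\<bar> < \<mu> / 2" by (simp add: h(2) dist_norm)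
    then obtain d where d: "d > 0" "\<forall>x. \<bar>x\<bar> < d \<longrightarrow> \<bar>h x\<bar> < \<mu> / 2"
      unfolding eventually_nhds_zero1 by (elim exE conjE) (rule that)
    \<comment> \<open>The bound \<open>\<mu> ^ q\<close> gives \<open>t < \<mu>\<close>; the other
      two give \<open>\<bar>y - h x\<bar> < \<mu>\<close>.\<close>
    define \<delta> where "\<delta> = min (\<mu> ^ q) (min d (\<mu> / 2))"
    show "\<exists>\<delta>>0. \<forall>x y. 0 < x \<and> x < \<delta> \<and> \<bar>y\<bar> < \<delta> \<and> f (x, y) = 0 \<longrightarrow>
      (\<exists>c\<in>\<Union>z0\<in>Z. L z0 ` CS z0. \<exists>t. 0 < t \<and> t < \<eta> \<and> c t = (x, y))"
    proof (intro exI[of _ \<delta>] conjI allI impI)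
      show "0 < \<delta>" using \<mu>(1) d(1) by (simp add: \<delta>_def)
      fix x y assume xy: "0 < x \<and> x < \<delta> \<and> \<bar>y\<bar> < \<delta> \<and> f (x, y) = 0"
      define t where "t = root q x"
      have t0: "t > 0" "t ^ q = x" using xy q by (simp_all add: t_def)
      have "t < \<mu>"
      proof (rule power_less_imp_less_base)
        show "t ^ q < \<mu> ^ q" using xy t0(2) by (simp add: \<delta>_def)
        show "0 \<le> \<mu>" using \<mu>(1) by simp
      qed
      define z where "z = (y - h x) / t ^ p"
      have tz: "t ^ p * z = y - h x" using t0(1) by (simp add: z_def)
      have "\<bar>h x\<bar> < \<mu> / 2" "\<bar>y\<bar> < \<mu> / 2" using d(2) xy by (simp_all add: \<delta>_def)
      then have small: "\<bar>t ^ p * z\<bar> < \<mu>" unfolding tz by linarith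
      have "f (t ^ q, h (t ^ q) + t ^ p * z) = t ^ (p * m) * G t z"
        by (rule \<delta>0(2)) (use \<open>t < \<mu>\<close> t0 small \<mu> in auto)
      then have "t ^ (p * m) * G t z = 0" using xy unfolding tz t0(2) by simp
      then have G0: "G t z = 0" using t0(1) by simp
      have "\<bar>z\<bar> \<le> Kb" by (rule Kb(2)[OF t0(1) _ _ G0]) (use \<open>t < \<mu>\<close> small \<mu> in auto)
      then have "z \<in> {-Kb..Kb}" by auto
      then obtain z0 where z0: "z0 \<in> D" "z \<in> ball z0 (r z0)" using D(3) by blast
      have w: "\<bar>z - z0\<bar> < r z0" using z0(2) by (simp add: dist_norm abs_minus_commute)
      have tr: "t < r z0" using \<open>t < \<mu>\<close> \<mu>(5)[OF z0(1)] by simp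
      have G0': "G t (z0 + (z - z0)) = 0" using G0 by simp
      have "z0 \<in> Z" by (rule r2(1)[OF t0(1) tr w G0'])
      obtain b s where b: "b \<in> CS z0" "0 < s" "s < \<eta>" "b s = (t, z - z0)"
        using r2(2)[OF t0(1) tr w G0'] by blast
      have "L z0 b s = (x, y)" unfolding L_def b(4) by (simp add: t0(2) tz)
      moreover have "L z0 b \<in> (\<Union>z0\<in>Z. L z0 ` CS z0)" using \<open>z0 \<in> Z\<close> b(1) by blast
      ultimately show "\<exists>c\<in>\<Union>z0\<in>Z. L z0 ` CS z0. \<exists>t. 0 < t \<and> t < \<eta> \<and> c t = (x, y)"
        using b(2,3) by (intro bexI[of _ "L z0 b"] exI[of _ s]) simp_all
    qed
  qed
  then show ?thesis by (rule exI)
qed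

text \<open>Strong induction on the order. At order 0 there are no zeros near the origin; otherwise
  the shift leaves either the single curve \<open>y = h x\<close> or a Newton edge whose roots have
  smaller multiplicity.\<close>

lemma half_branches_exist:
  fixes f :: "real \<times> real \<Rightarrow> real"
  assumes "germ f" "regular_order m f"
  shows "\<exists>Cs. half_branches f Cs"
  using assms
proof (induction m arbitrary: f rule: less_induct)
  case (less m)
  show ?case
  proof (cases "m = 0")
    case True
    have "(f \<longlongrightarrow> f (0,0)) (nhds (0,0))" by (rule germ_tendsto_nhds[OF less.prems(1)])
    moreover have "f (0,0) \<noteq> 0"
      using less.prems(2) tendsto_unique[OF trivial_limit_at germ_tendsto_snd[OF less.prems(1)]]
      unfolding regular_order_def True by auto
    ultimately have "\<forall>\<^sub>F v in nhds (0,0). f v \<noteq> 0" by (rule tendsto_imp_eventually_ne)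
    then obtain d where d: "d > 0" "\<forall>x y. \<bar>x\<bar> < d \<longrightarrow> \<bar>y\<bar> < d \<longrightarrow> f (x, y) \<noteq> 0"
      unfolding eventually_nhds_zero2 by (elim exE conjE) (rule that)
    have "half_branches f {}" unfolding half_branches_def
      using d by (intro conjI allI impI exI[of _ d]) auto
    then show ?thesis by (rule exI)
  next
    case False
    then have m: "m \<ge> 1" by simp
    obtain h c u where hcu: "germ1 h" "h 0 = 0" "\<forall>k. germ1 (c k)" "germ u" "\<forall>k<m. c k 0 = 0" "u (0,0) \<noteq> 0"
      "\<forall>\<^sub>F z in nhds (0,0). f (fst z, h (fst z) + snd z) = (\<Sum>k<m. c k (fst z) * snd z ^ k) + snd z ^ m * u z"
      "\<forall>\<^sub>F x in nhds 0. c (m - 1) x = 0"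
      using tschirnhaus[OF less.prems m] by (elim exE conjE) (rule that)
    have c0: "c k 0 = 0" if "k < m" for k using hcu(5) that by simp
    show ?thesis
    proof (cases "\<exists>k<m. \<not> (\<forall>\<^sub>F x in nhds 0. c k x = 0)")
      case True
      have ex: "\<exists>(q::nat) (p::nat) C. q \<ge> 1 \<and> p \<ge> 1 \<and> (\<forall>k. germ1 (C k)) \<and> C (m - 1) 0 = 0 \<and> (\<exists>k<m. C k 0 \<noteq> (0::real)) \<and>
          (\<forall>k<m. \<forall>\<^sub>F t in nhds 0. c k (t ^ q) = t ^ (p * (m - k)) * C k t)"
        by (rule newton_exponents[OF spec[OF hcu(3)] _ hcu(8) True]) (rule c0)
      then obtain q p :: nat and C where D: "q \<ge> 1" "p \<ge> 1" "\<forall>k. germ1 (C k)" "C (m - 1) 0 = 0" "\<exists>k<m. C k 0 \<noteq> 0"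
        "\<forall>k<m. \<forall>\<^sub>F t in nhds 0. c k (t ^ q) = t ^ (p * (m - k)) * C k t"
        by (elim exE conjE) (rule that, assumption+, blast, assumption)
      have cC: "\<forall>\<^sub>F t in nhds 0. c k (t ^ q) = t ^ (p * (m - k)) * C k t" if "k < m" for k using D(6) that by simp
      show ?thesis
        by (rule newton_branches[OF hcu(1,2,4,6) m hcu(7) D(1,2) spec[OF D(3)] D(4,5) cC less.IH])
    next
      case no: False
      have "\<forall>\<^sub>F x in nhds 0. \<forall>k\<in>{..<m}. c k x = 0"
        by (rule eventually_ball_finite) (use no in auto)
      then obtain d where d: "d > 0" "\<forall>x. \<bar>x\<bar> < d \<longrightarrow> (\<forall>k\<in>{..<m}. c k x = 0)"
        unfolding eventually_nhds_zero1 by (elim exE conjE) (rule that)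
      then have "\<forall>\<^sub>F z :: real \<times> real in nhds (0,0). \<forall>k\<in>{..<m}. c k (fst z) = 0"
        unfolding eventually_nhds_zero2 by (intro exI[of _ d]) simp
      then have "\<forall>\<^sub>F z in nhds (0,0). f (fst z, h (fst z) + snd z) = snd z ^ m * u z"
        using hcu(7) by eventually_elim simp
      from half_branches_simple[OF hcu(1,2,4,6) m this] show ?thesis by (rule exI)
    qed
  qed
qed

text \<open>A shear along a line on which \<open>f\<close> does not vanish identically makes the
  order on the new axis finite. Zeros off that axis come from the half-branches of \<open>f1\<close>
  and of its reflection \<open>f2\<close>; on the axis only the origin can remain.\<close>

lemma plane_branches:
  fixes f :: "real \<times> real \<Rightarrow> real"
  assumes f: "germ f" and nz: "\<not> (\<forall>\<^sub>F z in nhds (0,0). f z = 0)"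
  shows "\<exists>Cs. finite Cs \<and>
    (\<forall>c\<in>Cs. germ1 (\<lambda>t. fst (c t)) \<and> germ1 (\<lambda>t. snd (c t)) \<and> c 0 = (0,0) \<and>
      (\<exists>\<eta>>0. \<forall>t. 0 < t \<and> t < \<eta> \<longrightarrow> c t \<noteq> (0,0) \<and> f (c t) = 0)) \<and>
    (\<forall>\<eta>>0. \<exists>\<delta>>0. \<forall>x y. \<bar>x\<bar> < \<delta> \<and> \<bar>y\<bar> < \<delta> \<and> f (x, y) = 0 \<longrightarrow>
      (x, y) = (0,0) \<or> (\<exists>c\<in>Cs. \<exists>t. 0 < t \<and> t < \<eta> \<and> c t = (x, y)))"
proof -
  obtain \<rho> C where p: "\<rho> > 0" "pser \<rho> f C" by (rule germE[OF f])
  \<comment> \<open>The line must be transverse to the \<open>x\<close>-axis, so a point on that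
    axis is moved off it by continuity.\<close>
  obtain x1 y1 where z1: "\<bar>x1\<bar> < \<rho> / 2" "\<bar>y1\<bar> < \<rho> / 2" "y1 \<noteq> 0" "f (x1, y1) \<noteq> 0"
  proof -
    obtain x y where xy: "\<bar>x\<bar> < \<rho> / 2" "\<bar>y\<bar> < \<rho> / 2" "f (x, y) \<noteq> 0"
      using nz p(1) unfolding eventually_nhds_zero2 by (metis half_gt_zero)
    have 1: "isCont (\<lambda>y. (x, y)) y" by (intro continuous_intros)
    have 2: "isCont f (x, y)" by (rule pser_isCont[OF p(2)]) (use xy p(1) in auto)
    have "((\<lambda>y. f (x, y)) \<longlongrightarrow> f (x, y)) (nhds y)"
      using isCont_o2[OF 1 2] by (simp add: isCont_def tendsto_nhds_iff)
    from tendsto_imp_eventually_ne[OF this xy(3)] obtain e where e: "e > 0" "\<And>y'. dist y' y < e \<Longrightarrow> f (x, y') \<noteq> 0"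
      unfolding eventually_nhds_metric by blast
    show ?thesis
    proof (cases "y = 0")
      case False then show ?thesis using that xy by blast
    next
      case True
      show ?thesis
        by (rule that[of x "min (e / 2) (\<rho> / 4)"]) (use xy e p(1) True in \<open>auto simp: dist_norm min_def\<close>)
    qed
  qed
  \<comment> \<open>The restriction of \<open>f\<close> to the line through \<open>(x1, y1)\<close>,
    on radius 2 so that the parameter 1, where it is nonzero, lies inside.\<close>
  define \<phi> where "\<phi> s = f (x1 * s, y1 * s)" for s
  have two: "(2::real) > 0" by simp
  have "pser 2 (\<lambda>z. x1 *\<^sub>R fst z) \<rho>" "pser 2 (\<lambda>z. y1 *\<^sub>R snd (snd z, fst z)) \<rho>"
    using pser_mono[OF pser_scale[OF two pser_fst[of 2], of x1]] pser_mono[OF pser_scale[OF two pser_fst[of 2], of y1]] z1 by auto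
  from pser_comp[OF p(1) two p(2) this] have p\<phi>: "pser 2 (\<lambda>z. \<phi> (fst z)) C" by (simp add: \<phi>_def)
  have "\<phi> 1 \<noteq> 0" using z1(4) by (simp add: \<phi>_def)
  then have "\<not> (\<forall>x. \<bar>x\<bar> < 2 \<longrightarrow> \<phi> x = 0)" by (metis abs_one one_less_numeral_iff semiring_norm(76))
  with pser1_order[OF two p\<phi>] obtain k g D where g: "pser 2 (\<lambda>z. g (fst z)) D" "g 0 \<noteq> 0" "\<forall>x. \<bar>x\<bar> \<le> 2 \<longrightarrow> \<phi> x = x ^ k *\<^sub>R g x"
    by blast
  define a where "a = x1 / y1"
  define f1 where "f1 z = f (fst z + a * snd z, snd z)" for z
  define f2 where "f2 z = f1 (- fst z, snd z)" for z
  have gsnd: "germ (\<lambda>z. a * snd z)" by (rule germ_mult[OF germ_const germ_snd])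
  have g1: "germ f1" unfolding f1_def[abs_def]
    by (rule germ_comp[OF f germ_add[OF germ_fst gsnd] germ_snd]) simp_all
  have g2: "germ f2" unfolding f2_def[abs_def]
    using germ_comp[OF g1 germ_mult[OF germ_const[of "-1"] germ_fst] germ_snd] by simp
  have lim: "((\<lambda>y. f1 (0, y) / y ^ k) \<longlongrightarrow> g 0 / y1 ^ k) (at 0)"
  proof -
    have "f1 (0, y) / y ^ k = g (y / y1) / y1 ^ k" if "y \<noteq> 0" "\<bar>y\<bar> < \<bar>y1\<bar>" for y
    proof -
      have "f1 (0, y) = \<phi> (y / y1)" using z1(3) by (simp add: f1_def \<phi>_def a_def)
      moreover have "\<bar>y / y1\<bar> \<le> 2" using that z1(3) by (simp add: divide_le_eq)
      then have "\<phi> (y / y1) = (y / y1) ^ k * g (y / y1)" using g(3) by simp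
      ultimately show ?thesis using that(1) by (simp add: power_divide)
    qed
    then have "\<forall>\<^sub>F y in at 0. g (y / y1) / y1 ^ k = f1 (0, y) / y ^ k"
      unfolding eventually_at using z1(3) by (intro exI[of _ "\<bar>y1\<bar>"]) (simp add: dist_norm)
    moreover have "isCont (\<lambda>y. g (y / y1) / y1 ^ k) 0"
    proof -
      have "isCont (\<lambda>y. y / y1) 0" using z1(3) by (intro continuous_intros) simp
      moreover have "isCont g (0 / y1)" using germ1_isCont[OF germI[OF two g(1)]] by simp
      ultimately have "isCont (\<lambda>y. g (y / y1)) 0" by (rule isCont_o2)
      then show ?thesis using z1(3) by (intro continuous_intros) simp_all
    qed
    then have "((\<lambda>y. g (y / y1) / y1 ^ k) \<longlongrightarrow> g 0 / y1 ^ k) (at 0)" unfolding isCont_def by simp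
    ultimately show ?thesis using Lim_transform_eventually by fastforce
  qed
  have v0: "g 0 / y1 ^ k \<noteq> 0" using g(2) z1(3) by simp
  have r1: "regular_order k f1" unfolding regular_order_def using lim v0 by blast
  have r2: "regular_order k f2" using r1 unfolding regular_order_def f2_def by simp
  obtain Cs1 where Cs1: "half_branches f1 Cs1" using half_branches_exist[OF g1 r1] ..
  obtain Cs2 where Cs2: "half_branches f2 Cs2" using half_branches_exist[OF g2 r2] ..
  obtain d0 where d0: "d0 > 0" "\<And>y. y \<noteq> 0 \<Longrightarrow> \<bar>y\<bar> < d0 \<Longrightarrow> f1 (0, y) \<noteq> 0"
  proof -
    from tendsto_imp_eventually_ne[OF lim v0] obtain d where d: "d > 0" "\<And>y. y \<noteq> 0 \<Longrightarrow> dist y 0 < d \<Longrightarrow> f1 (0, y) / y ^ k \<noteq> 0"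
      unfolding eventually_at by blast
    have "f1 (0, y) \<noteq> 0" if "y \<noteq> 0" "\<bar>y\<bar> < d" for y using d(2)[of y] that by auto
    then show ?thesis using d(1) that by blast
  qed
  define A where "A \<sigma> c t = (\<sigma> * fst (c t) + a * snd (c t), snd (c t))"
    for \<sigma> :: real and c :: "real \<Rightarrow> real \<times> real" and t :: real
  have fA: "f (A 1 c t) = f1 (c t)" "f (A (-1) c t) = f2 (c t)" for c t
    by (simp_all add: A_def f1_def f2_def)
  have good: "germ1 (\<lambda>t. fst (A \<sigma> c t)) \<and> germ1 (\<lambda>t. snd (A \<sigma> c t)) \<and> A \<sigma> c 0 = (0,0) \<and>
      (\<exists>\<eta>>0. \<forall>t. 0 < t \<and> t < \<eta> \<longrightarrow> A \<sigma> c t \<noteq> (0,0) \<and> f (A \<sigma> c t) = 0)"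
    if hb: "half_branches F Cs" and c: "c \<in> Cs" and \<sigma>: "\<sigma> \<noteq> 0" and fF: "\<And>t. f (A \<sigma> c t) = F (c t)" for F Cs c \<sigma>
  proof -
    have B: "germ1 (\<lambda>t. fst (c t))" "germ1 (\<lambda>t. snd (c t))" "c 0 = (0,0)"
      "\<exists>\<eta>>0. \<forall>t. 0 < t \<and> t < \<eta> \<longrightarrow> fst (c t) > 0 \<and> F (c t) = 0"
      using bspec[OF conjunct1[OF conjunct2[OF hb[unfolded half_branches_def]]] c] by simp_all
    obtain \<eta> where \<eta>: "\<eta> > 0" "\<forall>t. 0 < t \<and> t < \<eta> \<longrightarrow> fst (c t) > 0 \<and> F (c t) = 0"
      using B(4) by (elim exE conjE) (rule that)
    have "A \<sigma> c t \<noteq> (0,0) \<and> f (A \<sigma> c t) = 0" if "0 < t \<and> t < \<eta>" for t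
    proof
      have t: "fst (c t) > 0" "F (c t) = 0" using \<eta>(2) that by simp_all
      show "f (A \<sigma> c t) = 0" using fF t(2) by simp
      show "A \<sigma> c t \<noteq> (0,0)" using t(1) \<sigma> by (auto simp: A_def)
    qed
    moreover have "germ1 (\<lambda>t. \<sigma> * fst (c t) + a * snd (c t))"
      by (intro germ_add germ_mult germ_const B(1,2))
    ultimately show ?thesis using B(2,3) \<eta>(1) by (auto simp: A_def)
  qed
  have fin: "finite Cs1" "finite Cs2" using Cs1 Cs2 unfolding half_branches_def by simp_all
  define Cs where "Cs = A 1 ` Cs1 \<union> A (-1) ` Cs2"
  have cover: "\<exists>\<delta>>0. \<forall>x y. \<bar>x\<bar> < \<delta> \<and> \<bar>y\<bar> < \<delta> \<and> f (x, y) = 0 \<longrightarrow>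
      (x, y) = (0,0) \<or> (\<exists>c\<in>Cs. \<exists>t. 0 < t \<and> t < \<eta> \<and> c t = (x, y))" if \<eta>: "\<eta> > 0" for \<eta>
  proof -
    obtain d1 where d1: "d1 > 0" "\<forall>x y. 0 < x \<and> x < d1 \<and> \<bar>y\<bar> < d1 \<and> f1 (x, y) = 0 \<longrightarrow> (\<exists>c\<in>Cs1. \<exists>t. 0 < t \<and> t < \<eta> \<and> c t = (x, y))"
      using mp[OF spec[OF conjunct2[OF conjunct2[OF Cs1[unfolded half_branches_def]]]] \<eta>] by (elim exE conjE) (rule that)
    obtain d2 where d2: "d2 > 0" "\<forall>x y. 0 < x \<and> x < d2 \<and> \<bar>y\<bar> < d2 \<and> f2 (x, y) = 0 \<longrightarrow> (\<exists>c\<in>Cs2. \<exists>t. 0 < t \<and> t < \<eta> \<and> c t = (x, y))"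
      using mp[OF spec[OF conjunct2[OF conjunct2[OF Cs2[unfolded half_branches_def]]]] \<eta>] by (elim exE conjE) (rule that)
    define d where "d = min d0 (min d1 d2)"
    \<comment> \<open>The division by \<open>1 + \<bar>a\<bar>\<close> is needed because
      \<open>x' = x - a * y\<close> may exceed \<open>x\<close>; it still gives
      \<open>\<bar>x'\<bar> < d\<close>.\<close>
    define \<delta> where "\<delta> = d / (1 + \<bar>a\<bar>)"
    have d: "d > 0" "d \<le> d0" "d \<le> d1" "d \<le> d2" using d0(1) d1(1) d2(1) by (auto simp: d_def)
    have "\<delta> > 0" using d(1) by (simp add: \<delta>_def add_pos_nonneg)
    moreover have "\<delta> * 1 \<le> \<delta> * (1 + \<bar>a\<bar>)" using \<open>\<delta> > 0\<close> by (intro mult_left_mono) auto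
    moreover have \<delta>a: "\<delta> * (1 + \<bar>a\<bar>) = d" by (simp add: \<delta>_def add_pos_nonneg less_imp_neq[symmetric])
    ultimately have \<delta>: "\<delta> > 0" "\<delta> \<le> d" by simp_all
    show ?thesis
    proof (intro exI[of _ \<delta>] conjI allI impI \<delta>(1))
      fix x y assume xy: "\<bar>x\<bar> < \<delta> \<and> \<bar>y\<bar> < \<delta> \<and> f (x, y) = 0"
      define x' where "x' = x - a * y"
      have "\<bar>x'\<bar> \<le> \<bar>x\<bar> + \<bar>a\<bar> * \<bar>y\<bar>" unfolding x'_def using abs_triangle_ineq4[of x "a * y"] by (simp add: abs_mult)
      also have "\<dots> < \<delta> + \<bar>a\<bar> * \<delta>" using xy by (intro add_less_le_mono mult_left_mono) auto
      also have "\<dots> = d" using \<delta>a by (simp add: algebra_simps)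
      finally have x': "\<bar>x'\<bar> < d" .
      have y: "\<bar>y\<bar> < d" using xy \<delta>(2) by simp
      have f0: "f1 (x', y) = 0" using xy by (simp add: f1_def x'_def)
      consider "x' > 0" | "x' < 0" | "x' = 0" by linarith
      then show "(x, y) = (0,0) \<or> (\<exists>c\<in>Cs. \<exists>t. 0 < t \<and> t < \<eta> \<and> c t = (x, y))"
      proof cases
        case 1
        then obtain c t where c: "c \<in> Cs1" "0 < t" "t < \<eta>" "c t = (x', y)"
          using d1(2)[rule_format, of x' y] f0 x' y d by auto
        have "A 1 c t = (x, y)" by (simp add: A_def c(4) x'_def)
        then show ?thesis using c(1-3) unfolding Cs_def by (intro disjI2 bexI[of _ "A 1 c"] exI[of _ t]) auto
      next
        case 2
        have "f2 (- x', y) = 0" using f0 by (simp add: f2_def)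
        then obtain c t where c: "c \<in> Cs2" "0 < t" "t < \<eta>" "c t = (- x', y)"
          using d2(2)[rule_format, of "- x'" y] 2 x' y d by auto
        have "A (-1) c t = (x, y)" by (simp add: A_def c(4) x'_def)
        then show ?thesis using c(1-3) unfolding Cs_def by (intro disjI2 bexI[of _ "A (-1) c"] exI[of _ t]) auto
      next
        case 3
        then have "y = 0" using d0(2)[of y] f0 y d by auto
        then show ?thesis using 3 by (simp add: x'_def)
      qed
    qed
  qed
  have "finite Cs" using fin by (simp add: Cs_def)
  moreover have "\<forall>c\<in>Cs. germ1 (\<lambda>t. fst (c t)) \<and> germ1 (\<lambda>t. snd (c t)) \<and> c 0 = (0,0) \<and>
      (\<exists>\<eta>>0. \<forall>t. 0 < t \<and> t < \<eta> \<longrightarrow> c t \<noteq> (0,0) \<and> f (c t) = 0)"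
  proof
    fix c assume "c \<in> Cs"
    then consider b where "b \<in> Cs1" "c = A 1 b" | b where "b \<in> Cs2" "c = A (-1) b" unfolding Cs_def by blast
    then show "germ1 (\<lambda>t. fst (c t)) \<and> germ1 (\<lambda>t. snd (c t)) \<and> c 0 = (0,0) \<and>
      (\<exists>\<eta>>0. \<forall>t. 0 < t \<and> t < \<eta> \<longrightarrow> c t \<noteq> (0,0) \<and> f (c t) = 0)"
    proof cases
      case 1
      show ?thesis unfolding 1(2) by (rule good[OF Cs1 1(1) _ fA(1)]) simp
    next
      case 2
      show ?thesis unfolding 2(2) by (rule good[OF Cs2 2(1) _ fA(2)]) simp
    qed
  qed
  ultimately show ?thesis using cover by (intro exI[of _ Cs] conjI allI impI)
qed

section \<open>Growth of the distance along a branch\<close>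

lemma germ1_lipschitz:
  fixes E :: "real \<Rightarrow> 'w::banach"
  assumes "germ1 E"
  shows "\<exists>\<delta>>0. \<exists>L. \<forall>s t. 0 \<le> s \<and> s \<le> t \<and> t < \<delta> \<longrightarrow> norm (E t - E s) \<le> L * (t - s)"
proof -
  \<comment> \<open>The difference quotient of \<open>E\<close> is a germ in \<open>s\<close> and
    \<open>t - s\<close>, hence bounded near the origin.\<close>
  have "germ (\<lambda>z. E (fst z + snd z))"
    by (rule germ1_comp[OF assms germ_add[OF germ_fst germ_snd]]) simp
  from germ_div_snd[OF this] obtain g where g: "germ g"
    "\<forall>\<^sub>F z in nhds (0,0). E (fst z + snd z) = E (fst (fst z, 0::real) + snd (fst z, 0)) + snd z *\<^sub>R g z"
    by (elim exE conjE) (rule that)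
  have "(g \<longlongrightarrow> g (0,0)) (nhds (0,0))" by (rule germ_tendsto_nhds[OF g(1)])
  from eventually_bounded_of_tendsto[OF tendsto_norm[OF this]]
  have "\<forall>\<^sub>F z in nhds (0,0). norm (g z) \<le> norm (g (0,0)) + 1" by simp
  from eventually_conj[OF g(2) this] obtain d where d: "d > 0" "\<forall>x y. \<bar>x\<bar> < d \<longrightarrow> \<bar>y\<bar> < d \<longrightarrow>
      E (fst (x, y) + snd (x, y)) = E (fst (fst (x, y), 0::real) + snd (fst (x, y), 0)) + snd (x, y) *\<^sub>R g (x, y) \<and>
      norm (g (x, y)) \<le> norm (g (0,0)) + 1"
    unfolding eventually_nhds_zero2 by (elim exE conjE) (rule that)
  have "norm (E t - E s) \<le> (norm (g (0,0)) + 1) * (t - s)" if "0 \<le> s \<and> s \<le> t \<and> t < d" for s t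
  proof -
    have "E (s + (t - s)) = E s + (t - s) *\<^sub>R g (s, t - s)" and b: "norm (g (s, t - s)) \<le> norm (g (0,0)) + 1"
      using d(2)[rule_format, of s "t - s"] that by simp_all
    then have "norm (E t - E s) = (t - s) * norm (g (s, t - s))" using that by simp
    also have "\<dots> \<le> (t - s) * (norm (g (0,0)) + 1)" using b that by (intro mult_left_mono) auto
    finally show ?thesis by (simp add: mult.commute)
  qed
  then show ?thesis using d(1) by (intro exI[of _ d] conjI exI[of _ "norm (g (0,0)) + 1"] allI impI)
qed

text \<open>\<open>C t - C 0 = t\<^sup>k E t\<close> with \<open>E 0 \<noteq> 0\<close> and \<open>E\<close> Lipschitz, so the growth of \<open>t\<^sup>k\<close> dominates the
  variation of \<open>\<parallel>E t\<parallel>\<close>, even though the norm need not be differentiable.\<close>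

lemma germ1_norm_strict_mono:
  fixes C :: "real \<Rightarrow> 'w::banach"
  assumes C: "germ1 C" and nc: "\<exists>\<eta>>0. \<forall>t. 0 < t \<and> t < \<eta> \<longrightarrow> C t \<noteq> C 0"
  shows "\<exists>\<tau>>0. \<forall>s t. 0 \<le> s \<and> s < t \<and> t < \<tau> \<longrightarrow> norm (C s - C 0) < norm (C t - C 0)"
proof -
  have "germ1 (\<lambda>t. C t - C 0)" by (rule germ_diff[OF C germ_const])
  moreover have "\<not> (\<forall>\<^sub>F t in nhds 0. C t - C 0 = 0)"
  proof
    assume "\<forall>\<^sub>F t in nhds 0. C t - C 0 = 0"
    then obtain d where d: "d > 0" "\<forall>t. \<bar>t\<bar> < d \<longrightarrow> C t - C 0 = 0" unfolding eventually_nhds_zero1 by (elim exE conjE) (rule that)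
    obtain \<eta> where \<eta>: "\<eta> > 0" "\<forall>t. 0 < t \<and> t < \<eta> \<longrightarrow> C t \<noteq> C 0" using nc by (elim exE conjE) (rule that)
    define t0 where "t0 = min d \<eta> / 2"
    have "0 < t0" "t0 < d" "t0 < \<eta>" using d(1) \<eta>(1) by (auto simp: t0_def)
    then show False using d(2)[rule_format, of t0] \<eta>(2)[rule_format, of t0] by simp
  qed
  ultimately obtain k E where E: "germ1 E" "E 0 \<noteq> 0" "\<forall>\<^sub>F t in nhds 0. C t - C 0 = t ^ k *\<^sub>R E t"
    using germ1_order[of "\<lambda>t. C t - C 0"] by blast
  have k: "k \<ge> 1"
  proof (rule ccontr)
    assume "\<not> k \<ge> 1"
    then have "k = 0" by simp
    then show False using eventually_nhds_x_imp_x[OF E(3)] E(2) by simp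
  qed
  obtain d1 L where L: "d1 > 0" "\<forall>s t. 0 \<le> s \<and> s \<le> t \<and> t < d1 \<longrightarrow> norm (E t - E s) \<le> L * (t - s)"
    using germ1_lipschitz[OF E(1)] by (elim exE conjE) (rule that)
  define \<nu> where "\<nu> = norm (E 0) / 2"
  have \<nu>: "\<nu> > 0" using E(2) by (simp add: \<nu>_def)
  have "(E \<longlongrightarrow> E 0) (nhds 0)" by (rule germ1_tendsto_nhds[OF E(1)])
  from tendstoD[OF tendsto_norm[OF this] \<nu>] have "\<forall>\<^sub>F t in nhds 0. \<nu> < norm (E t)"
  proof (rule eventually_mono)
    fix t assume "dist (norm (E t)) (norm (E 0)) < \<nu>"
    then show "\<nu> < norm (E t)" unfolding dist_real_def \<nu>_def by linarith
  qed
  from eventually_conj[OF E(3) this] obtain d2 where d2: "d2 > 0" "\<forall>t. \<bar>t\<bar> < d2 \<longrightarrow> C t - C 0 = t ^ k *\<^sub>R E t \<and> \<nu> < norm (E t)"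
    unfolding eventually_nhds_zero1 by (elim exE conjE) (rule that)
  \<comment> \<open>Keeps \<open>s * \<bar>L\<bar>\<close> at most \<open>\<nu>\<close>, which is
    half of \<open>norm (E 0)\<close> and a lower bound for \<open>norm (E t)\<close>.\<close>
  define \<tau> where "\<tau> = min (min d1 d2) (\<nu> / (\<bar>L\<bar> + 1))"
  have \<tau>: "\<tau> > 0" "\<tau> \<le> d1" "\<tau> \<le> d2" "\<tau> * (\<bar>L\<bar> + 1) \<le> \<nu>"
  proof -
    show "\<tau> > 0" "\<tau> \<le> d1" "\<tau> \<le> d2" using L(1) d2(1) \<nu> by (auto simp: \<tau>_def add_nonneg_pos)
    have "\<tau> \<le> \<nu> / (\<bar>L\<bar> + 1)" by (simp add: \<tau>_def)
    then show "\<tau> * (\<bar>L\<bar> + 1) \<le> \<nu>" by (subst (asm) pos_le_divide_eq) auto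
  qed
  have "norm (C s - C 0) < norm (C t - C 0)" if st: "0 \<le> s \<and> s < t \<and> t < \<tau>" for s t
  proof -
    have Cs: "C s - C 0 = s ^ k *\<^sub>R E s" and Ct: "C t - C 0 = t ^ k *\<^sub>R E t" and Et: "\<nu> < norm (E t)"
      using d2(2) st \<tau> by auto
    have ns: "norm (C s - C 0) = s ^ k * norm (E s)" and nt: "norm (C t - C 0) = t ^ k * norm (E t)"
      unfolding Cs Ct using st by simp_all
    show ?thesis
    proof (cases "s = 0")
      case True
      have "norm (E t) > 0" using Et \<nu> by linarith
      then show ?thesis unfolding nt ns using True k st by (simp add: power_0_left)
    next
      case False
      then have s0: "s > 0" using st by simp
      have "norm (E t - E s) \<le> L * (t - s)" using L(2) st \<tau> by simp
      also have "\<dots> \<le> \<bar>L\<bar> * (t - s)" using st by (intro mult_right_mono) auto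
      finally have 1: "norm (E s) \<le> norm (E t) + \<bar>L\<bar> * (t - s)"
        using norm_triangle_sub[of "E s" "E t"] by (simp add: norm_minus_commute)
      obtain j where j: "k = Suc j" using k by (cases k) auto
      have tj: "s ^ j \<le> t ^ j" using st by (intro power_mono) auto
      \<comment> \<open>With \<open>k = Suc j\<close>, the gain from
        \<open>t ^ k - s ^ k \<ge> (t - s) * s ^ j\<close> exceeds the possible loss
        \<open>s ^ k * (\<bar>L\<bar> * (t - s))\<close> caused by the variation of
        \<open>E\<close>.\<close>
      have "(t - s) * s ^ j * \<nu> < (t - s) * s ^ j * norm (E t)" using st s0 Et by simp
      also have "\<dots> \<le> (t ^ k - s ^ k) * norm (E t)"
      proof (rule mult_right_mono)
        have "t * s ^ j \<le> t * t ^ j" using tj st by (intro mult_left_mono) auto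
        then show "(t - s) * s ^ j \<le> t ^ k - s ^ k" by (simp add: j algebra_simps)
      qed simp
      finally have 2: "(t - s) * s ^ j * \<nu> < (t ^ k - s ^ k) * norm (E t)" .
      have "s * \<bar>L\<bar> \<le> \<nu>"
      proof -
        have "s * \<bar>L\<bar> \<le> \<tau> * (\<bar>L\<bar> + 1)" using st by (intro mult_mono) auto
        then show ?thesis using \<tau>(4) by simp
      qed
      then have "(t - s) * s ^ j * (s * \<bar>L\<bar>) \<le> (t - s) * s ^ j * \<nu>" using st by (intro mult_left_mono) auto
      then have 3: "s ^ k * (\<bar>L\<bar> * (t - s)) \<le> (t - s) * s ^ j * \<nu>" by (simp add: j mult_ac)
      have "s ^ k * norm (E s) \<le> s ^ k * norm (E t) + s ^ k * (\<bar>L\<bar> * (t - s))"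
        using mult_left_mono[OF 1, of "s ^ k"] st by (simp add: distrib_left)
      then show ?thesis unfolding ns nt using 2 3 by (simp add: left_diff_distrib)
    qed
  qed
  then show ?thesis using \<tau>(1) by (intro exI[of _ \<tau>]) simp
qed

section \<open>Local structure of the zero set\<close>

lemma analytic_germ_curve:
  fixes \<gamma> :: "real \<Rightarrow> 'w::banach"
  assumes "pser \<rho> (\<lambda>z. \<gamma> (fst z)) C" "\<bar>a + b * s\<bar> < \<rho>"
  shows "analytic_map_at (\<lambda>s. \<gamma> (a + b * s)) s"
proof -
  have "analytic_map_at (\<lambda>z. \<gamma> (fst z)) (a + b * s, 0::real)"
    by (rule pser_imp_analytic_at[OF assms]) (use assms(2) in linarith)
  then have 1: "analytic_map_at (\<lambda>z. \<gamma> (fst z)) ((a, 0::real) + (b * s, 0::real))" by simp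
  have 2: "bounded_linear (\<lambda>s. (b * s, 0::real))"
    by (intro bounded_linear_Pair bounded_linear_const_mult bounded_linear_ident bounded_linear_zero)
  from analytic_map_at_affine[OF 1 2] show ?thesis by simp
qed

text \<open>A vertex is by definition not an edge point, so it is enough to produce the half-branches; no curve
  through \<open>p\<close> has to be glued from them.\<close>

lemma edge_or_vertex_of_branches:
  fixes A :: "(real \<times> 'u::banach) set"
  assumes p: "p \<in> A" and fin: "finite \<Gamma>"
    and \<Gamma>: "\<And>\<gamma>. \<gamma> \<in> \<Gamma> \<Longrightarrow> germ1 \<gamma>" "\<And>\<gamma>. \<gamma> \<in> \<Gamma> \<Longrightarrow> \<gamma> 0 = p"
      "\<And>\<gamma>. \<gamma> \<in> \<Gamma> \<Longrightarrow> \<exists>\<eta>>0. \<forall>t. 0 < t \<and> t < \<eta> \<longrightarrow> \<gamma> t \<noteq> p \<and> \<gamma> t \<in> A"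
    and cov: "\<And>\<eta>. \<eta> > 0 \<Longrightarrow> \<exists>\<epsilon>>0. ball p \<epsilon> \<inter> A \<subseteq> {p} \<union> (\<Union>\<gamma>\<in>\<Gamma>. \<gamma> ` {0<..<\<eta>})"
  shows "edge_point A p \<or> vertex_point A p"
proof (cases "\<Gamma> = {}")
  case True
  obtain \<epsilon> where "\<epsilon> > 0" "ball p \<epsilon> \<inter> A \<subseteq> {p}" using cov[OF zero_less_one] True by auto
  then have "\<epsilon> > 0" "ball p \<epsilon> \<inter> A = {p}" using p by auto
  then show ?thesis unfolding vertex_point_def by blast
next
  case False
  let ?P = "\<lambda>\<gamma> \<tau>. \<tau> > 0 \<and> (\<exists>\<rho> C. \<tau> < \<rho> \<and> pser \<rho> (\<lambda>z. \<gamma> (fst z)) C) \<and>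
      (\<forall>s t. 0 \<le> s \<and> s < t \<and> t \<le> \<tau> \<longrightarrow> norm (\<gamma> s - p) < norm (\<gamma> t - p)) \<and> (\<forall>t. 0 < t \<and> t \<le> \<tau> \<longrightarrow> \<gamma> t \<in> A)"
  have "\<forall>\<gamma>\<in>\<Gamma>. \<exists>\<tau>. ?P \<gamma> \<tau>"
  proof
    fix \<gamma> assume g: "\<gamma> \<in> \<Gamma>"
    obtain \<rho> C where r: "\<rho> > 0" "pser \<rho> (\<lambda>z. \<gamma> (fst z)) C" by (rule germE[OF \<Gamma>(1)[OF g]])
    obtain \<eta> where \<eta>: "\<eta> > 0" "\<forall>t. 0 < t \<and> t < \<eta> \<longrightarrow> \<gamma> t \<noteq> p \<and> \<gamma> t \<in> A" using \<Gamma>(3)[OF g] by (elim exE conjE) (rule that)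
    then have "\<exists>\<eta>>0. \<forall>t. 0 < t \<and> t < \<eta> \<longrightarrow> \<gamma> t \<noteq> \<gamma> 0" using \<Gamma>(2)[OF g] by (intro exI[of _ \<eta>]) simp
    from germ1_norm_strict_mono[OF \<Gamma>(1)[OF g] this] obtain \<tau> where
      \<tau>: "\<tau> > 0" "\<forall>s t. 0 \<le> s \<and> s < t \<and> t < \<tau> \<longrightarrow> norm (\<gamma> s - \<gamma> 0) < norm (\<gamma> t - \<gamma> 0)"
      by (elim exE conjE) (rule that)
    \<comment> \<open>Half the minimum, so that all properties hold on the closed interval up to
      \<open>\<tau>'\<close>.\<close>
    define \<tau>' where "\<tau>' = min \<tau> (min \<eta> \<rho>) / 2"
    have t': "\<tau>' > 0" "\<tau>' < \<tau>" "\<tau>' < \<eta>" "\<tau>' < \<rho>" using \<tau>(1) \<eta>(1) r(1) by (auto simp: \<tau>'_def)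
    show "\<exists>\<tau>. ?P \<gamma> \<tau>"
      by (intro exI[of _ \<tau>'] conjI exI[of _ \<rho>] exI[of _ C]) (use t' r \<tau>(2) \<eta>(2) \<Gamma>(2)[OF g] in auto)
  qed
  from bchoice[OF this] obtain T where T: "\<forall>\<gamma>\<in>\<Gamma>. ?P \<gamma> (T \<gamma>)" ..
  define \<tau> where "\<tau> = Min (T ` \<Gamma>)"
  have \<tau>T: "\<tau> \<le> T \<gamma>" if "\<gamma> \<in> \<Gamma>" for \<gamma> unfolding \<tau>_def by (rule Min_le) (use fin that in auto)
  have \<tau>0: "\<tau> > 0" unfolding \<tau>_def using fin False T by (subst Min_gr_iff) auto
  have an: "\<exists>\<rho> C. \<tau> < \<rho> \<and> pser \<rho> (\<lambda>z. \<gamma> (fst z)) C"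
    and mono: "0 \<le> s \<Longrightarrow> s < t \<Longrightarrow> t \<le> \<tau> \<Longrightarrow> norm (\<gamma> s - p) < norm (\<gamma> t - p)"
    and inA: "0 < t \<Longrightarrow> t \<le> \<tau> \<Longrightarrow> \<gamma> t \<in> A" if g: "\<gamma> \<in> \<Gamma>" for \<gamma> s t
  proof -
    note P = bspec[OF T g]
    obtain \<rho> C where "T \<gamma> < \<rho>" "pser \<rho> (\<lambda>z. \<gamma> (fst z)) C" using P by (elim exE conjE) (rule that)
    then show "\<exists>\<rho> C. \<tau> < \<rho> \<and> pser \<rho> (\<lambda>z. \<gamma> (fst z)) C" using \<tau>T[OF g] by (intro exI[of _ \<rho>] exI[of _ C]) simp
    show "0 \<le> s \<Longrightarrow> s < t \<Longrightarrow> t \<le> \<tau> \<Longrightarrow> norm (\<gamma> s - p) < norm (\<gamma> t - p)" using P \<tau>T[OF g] by simp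
    show "0 < t \<Longrightarrow> t \<le> \<tau> \<Longrightarrow> \<gamma> t \<in> A" using P \<tau>T[OF g] by simp
  qed
  obtain \<epsilon>0 where \<epsilon>0: "\<epsilon>0 > 0" "ball p \<epsilon>0 \<inter> A \<subseteq> {p} \<union> (\<Union>\<gamma>\<in>\<Gamma>. \<gamma> ` {0<..<\<tau>})"
    using cov[OF \<tau>0] by (elim exE conjE) (rule that)
  \<comment> \<open>Every branch has left the ball by the parameter \<open>\<tau>\<close>, so each
    one reaches the sphere of radius \<open>\<epsilon>\<close>.\<close>
  define \<epsilon> where "\<epsilon> = Min (insert \<epsilon>0 ((\<lambda>\<gamma>. norm (\<gamma> \<tau> - p)) ` \<Gamma>))"
  have fin': "finite (insert \<epsilon>0 ((\<lambda>\<gamma>. norm (\<gamma> \<tau> - p)) ` \<Gamma>))" using fin by simp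
  have \<epsilon>\<epsilon>0: "\<epsilon> \<le> \<epsilon>0" unfolding \<epsilon>_def by (rule Min_le[OF fin']) simp
  have \<epsilon>\<tau>: "\<epsilon> \<le> norm (\<gamma> \<tau> - p)" if "\<gamma> \<in> \<Gamma>" for \<gamma> unfolding \<epsilon>_def by (rule Min_le[OF fin']) (use that in simp)
  have pos: "0 < norm (\<gamma> t - p)" if "\<gamma> \<in> \<Gamma>" "0 < t" "t \<le> \<tau>" for \<gamma> t
    using mono[OF that(1), of 0 t] that \<Gamma>(2) by simp
  have \<epsilon>: "\<epsilon> > 0" unfolding \<epsilon>_def using fin' \<epsilon>0(1) pos \<tau>0 by (subst Min_gr_iff) auto
  have contC: "isCont \<gamma> t" if g: "\<gamma> \<in> \<Gamma>" and t: "0 \<le> t" "t \<le> \<tau>" for \<gamma> t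
  proof -
    obtain \<rho> C where r: "\<tau> < \<rho>" "pser \<rho> (\<lambda>z. \<gamma> (fst z)) C" using an[OF g] by (elim exE conjE) (rule that)
    have "analytic_map_at (\<lambda>s. \<gamma> (0 + 1 * s)) t" by (rule analytic_germ_curve[OF r(2)]) (use t r(1) in simp)
    then show ?thesis using analytic_map_at_imp_isCont by simp
  qed
  \<comment> \<open>The exit parameter: as the distance increases strictly, the branch on
    \<open>{0<..\<tau>}\<close> is inside the ball exactly for
    \<open>t < b \<gamma>\<close>.\<close>
  have "\<forall>\<gamma>\<in>\<Gamma>. \<exists>b. 0 < b \<and> b \<le> \<tau> \<and> norm (\<gamma> b - p) = \<epsilon>"
  proof
    fix \<gamma> assume g: "\<gamma> \<in> \<Gamma>"
    have "\<exists>b. 0 \<le> b \<and> b \<le> \<tau> \<and> norm (\<gamma> b - p) = \<epsilon>"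
    proof (rule IVT)
      show "norm (\<gamma> 0 - p) \<le> \<epsilon>" using \<Gamma>(2)[OF g] \<epsilon> by simp
      show "\<epsilon> \<le> norm (\<gamma> \<tau> - p)" by (rule \<epsilon>\<tau>[OF g])
      show "\<forall>x. 0 \<le> x \<and> x \<le> \<tau> \<longrightarrow> isCont (\<lambda>b. norm (\<gamma> b - p)) x"
        using contC[OF g] by (auto intro!: continuous_intros)
    qed (use \<tau>0 in simp)
    then obtain b where b: "0 \<le> b" "b \<le> \<tau>" "norm (\<gamma> b - p) = \<epsilon>" by blast
    then have "b \<noteq> 0" using \<Gamma>(2)[OF g] \<epsilon> by auto
    then show "\<exists>b. 0 < b \<and> b \<le> \<tau> \<and> norm (\<gamma> b - p) = \<epsilon>" using b by (intro exI[of _ b]) simp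
  qed
  from bchoice[OF this] obtain b where b: "\<forall>\<gamma>\<in>\<Gamma>. 0 < b \<gamma> \<and> b \<gamma> \<le> \<tau> \<and> norm (\<gamma> (b \<gamma>) - p) = \<epsilon>" ..
  have b1: "0 < b \<gamma>" "b \<gamma> \<le> \<tau>" "norm (\<gamma> (b \<gamma>) - p) = \<epsilon>" if "\<gamma> \<in> \<Gamma>" for \<gamma> using bspec[OF b that] by simp_all
  have ball_eq: "ball p \<epsilon> \<inter> A = (\<Union>\<gamma>\<in>\<Gamma>. \<gamma> ` {0<..<b \<gamma>}) \<union> {p}"
  proof (intro equalityI subsetI)
    fix x assume x: "x \<in> ball p \<epsilon> \<inter> A"
    then have "x \<in> ball p \<epsilon>0 \<inter> A" using \<epsilon>\<epsilon>0 by simp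
    then have "x \<in> {p} \<union> (\<Union>\<gamma>\<in>\<Gamma>. \<gamma> ` {0<..<\<tau>})" by (rule subsetD[OF \<epsilon>0(2)])
    then show "x \<in> (\<Union>\<gamma>\<in>\<Gamma>. \<gamma> ` {0<..<b \<gamma>}) \<union> {p}"
    proof
      assume "x \<in> (\<Union>\<gamma>\<in>\<Gamma>. \<gamma> ` {0<..<\<tau>})"
      then obtain \<gamma> t where g: "\<gamma> \<in> \<Gamma>" and t: "0 < t" "t < \<tau>" "x = \<gamma> t" by auto
      have "t < b \<gamma>"
      proof (rule ccontr)
        assume "\<not> t < b \<gamma>"
        then have "\<epsilon> \<le> norm (\<gamma> t - p)"
          using mono[OF g, of "b \<gamma>" t] b1[OF g] t by (cases "t = b \<gamma>") auto
        then show False using x t(3) by (simp add: dist_norm norm_minus_commute)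
      qed
      then have "x \<in> \<gamma> ` {0<..<b \<gamma>}" using t by simp
      then show ?thesis using g by blast
    qed simp
  next
    fix x assume "x \<in> (\<Union>\<gamma>\<in>\<Gamma>. \<gamma> ` {0<..<b \<gamma>}) \<union> {p}"
    then show "x \<in> ball p \<epsilon> \<inter> A"
    proof
      assume "x \<in> (\<Union>\<gamma>\<in>\<Gamma>. \<gamma> ` {0<..<b \<gamma>})"
      then obtain \<gamma> t where g: "\<gamma> \<in> \<Gamma>" and t: "0 < t" "t < b \<gamma>" "x = \<gamma> t" by auto
      have "norm (\<gamma> t - p) < \<epsilon>" using mono[OF g, of t "b \<gamma>"] b1[OF g] t by simp
      moreover have "\<gamma> t \<in> A" by (rule inA[OF g t(1)]) (use t b1[OF g] in linarith)
      ultimately show ?thesis using t(3) by (simp add: dist_norm norm_minus_commute)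
    qed (use p \<epsilon> in simp)
  qed
  obtain e where e: "bij_betw e {1..card \<Gamma>} \<Gamma>" using ex_bij_betw_nat_finite_1[OF fin] by blast
  \<comment> \<open>The parameter is reversed and rescaled to the unit interval, so that
    \<open>s = 1\<close> corresponds to \<open>t = 0\<close>, where the branch meets
    \<open>p\<close>.\<close>
  define \<beta> where "\<beta> i s = e i (b (e i) + (- b (e i)) * s)" for i s
  have eG: "e i \<in> \<Gamma>" if "i \<in> {1..card \<Gamma>}" for i using bij_betwE[OF e] that by blast
  have im: "\<beta> i ` {0<..<1} = e i ` {0<..<b (e i)}" if i: "i \<in> {1..card \<Gamma>}" for i
  proof -
    have b0: "b (e i) > 0" by (rule b1(1)[OF eG[OF i]])
    have "(\<lambda>s. b (e i) + (- b (e i)) * s) ` {0<..<1} = {0<..<b (e i)}"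
    proof (intro equalityI subsetI)
      fix t assume "t \<in> {0<..<b (e i)}"
      then show "t \<in> (\<lambda>s. b (e i) + (- b (e i)) * s) ` {0<..<1}"
        using b0 by (intro image_eqI[of _ _ "1 - t / b (e i)"]) (auto simp: field_simps)
    next
      fix t assume "t \<in> (\<lambda>s. b (e i) + (- b (e i)) * s) ` {0<..<1}"
      then obtain s where s: "0 < s" "s < 1" "t = b (e i) + (- b (e i)) * s" by auto
      then show "t \<in> {0<..<b (e i)}" using b0 mult_strict_left_mono[OF s(2) b0] by simp
    qed
    moreover have "\<beta> i ` {0<..<1} = e i ` ((\<lambda>s. b (e i) + (- b (e i)) * s) ` {0<..<1})"
      unfolding \<beta>_def image_image ..
    ultimately show ?thesis by (simp only:)
  qed
  have props: "analytic_map_on (\<beta> i) {0<..<1} \<and> inj_on (\<beta> i) {0<..<1} \<and> p \<notin> \<beta> i ` {0<..<1} \<and> (\<beta> i \<longlongrightarrow> p) (at_left 1)"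
    if i: "i \<in> {1..card \<Gamma>}" for i
  proof (intro conjI)
    note g = eG[OF i]
    note bb = b1[OF g]
    obtain \<rho> C where r: "\<tau> < \<rho>" "pser \<rho> (\<lambda>z. e i (fst z)) C" using an[OF g] by (elim exE conjE) (rule that)
    have range: "0 < b (e i) + (- b (e i)) * s" "b (e i) + (- b (e i)) * s < b (e i)" if "0 < s" "s < 1" for s
      using bb(1) that mult_strict_left_mono[OF that(2) bb(1)] by simp_all
    show "analytic_map_on (\<beta> i) {0<..<1}" unfolding analytic_map_on_def
    proof
      fix s :: real assume "s \<in> {0<..<1}"
      then have "\<bar>b (e i) + (- b (e i)) * s\<bar> < \<rho>" using range[of s] bb(2) r(1) by auto
      from analytic_germ_curve[OF r(2) this] show "analytic_map_at (\<beta> i) s" unfolding \<beta>_def .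
    qed
    have inj: "inj_on (e i) {0<..<b (e i)}"
    proof (rule linorder_inj_onI)
      fix s t assume "s < t" "s \<in> {0<..<b (e i)}" "t \<in> {0<..<b (e i)}"
      then show "e i s \<noteq> e i t" using mono[OF g, of s t] bb by auto
    qed auto
    show "inj_on (\<beta> i) {0<..<1}"
    proof (rule inj_onI)
      fix s t assume st: "s \<in> {0<..<1}" "t \<in> {0<..<1}" "\<beta> i s = \<beta> i t"
      have "b (e i) + (- b (e i)) * s = b (e i) + (- b (e i)) * t"
        by (rule inj_onD[OF inj]) (use st range in \<open>auto simp: \<beta>_def\<close>)
      then show "s = t" using bb(1) by simp
    qed
    show "p \<notin> \<beta> i ` {0<..<1}"
      unfolding im[OF i] using pos[OF g] bb by fastforce
    have 1: "isCont (e i) (b (e i) + (- b (e i)) * 1)" using contC[OF g, of 0] \<tau>0 by simp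
    have 2: "isCont (\<lambda>s. b (e i) + (- b (e i)) * s) 1" by (intro continuous_intros)
    from isCont_o2[OF 2 1] have "isCont (\<beta> i) 1" unfolding \<beta>_def .
    then have "(\<beta> i \<longlongrightarrow> \<beta> i 1) (at_left 1)" unfolding isCont_def by (rule tendsto_within_subset) simp
    moreover have "\<beta> i 1 = p" using \<Gamma>(2)[OF g] by (simp add: \<beta>_def)
    ultimately show "(\<beta> i \<longlongrightarrow> p) (at_left 1)" by simp
  qed
  have "ball p \<epsilon> \<inter> A = (\<Union>i\<in>{1..card \<Gamma>}. \<beta> i ` {0<..<1}) \<union> {p}"
  proof -
    have "(\<Union>\<gamma>\<in>\<Gamma>. \<gamma> ` {0<..<b \<gamma>}) = (\<Union>\<gamma>\<in>e ` {1..card \<Gamma>}. \<gamma> ` {0<..<b \<gamma>})"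
      by (simp only: bij_betw_imp_surj_on[OF e])
    also have "\<dots> = (\<Union>i\<in>{1..card \<Gamma>}. e i ` {0<..<b (e i)})" by (simp only: image_image)
    also have "\<dots> = (\<Union>i\<in>{1..card \<Gamma>}. \<beta> i ` {0<..<1})" by (rule SUP_cong) (simp_all add: im)
    finally show ?thesis unfolding ball_eq by simp
  qed
  moreover have "card \<Gamma> \<ge> 1" using fin False by (simp add: Suc_leI card_gt_0_iff)
  ultimately have "\<exists>\<epsilon>>0. ball p \<epsilon> \<inter> A = {p} \<or>
        (\<exists>N\<ge>1. \<exists>\<gamma> :: nat \<Rightarrow> real \<Rightarrow> real \<times> 'u.
           (\<forall>i\<in>{1..N}. analytic_map_on (\<gamma> i) {0<..<1} \<and> inj_on (\<gamma> i) {0<..<1} \<and>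
              p \<notin> \<gamma> i ` {0<..<1} \<and> (\<gamma> i \<longlongrightarrow> p) (at_left 1)) \<and>
           ball p \<epsilon> \<inter> A = (\<Union>i\<in>{1..N}. \<gamma> i ` {0<..<1}) \<union> {p})"
    using ballI[of "{1..card \<Gamma>}", OF props] \<epsilon>
    by (intro exI[of _ \<epsilon>] conjI[of "0 < \<epsilon>"] disjI2 exI[of _ "card \<Gamma>"] conjI[of "1 \<le> card \<Gamma>"] exI[of _ \<beta>]) simp_all
  then show ?thesis unfolding vertex_point_def by (cases "edge_point A p") simp_all
qed

text \<open>Lyapunov-Schmidt reduction: \<open>\<Psi>\<close> parametrises the candidate points by
  \<open>(x, y)\<close>, and \<open>\<Phi>\<close> reads \<open>x\<close> and \<open>y\<close> off a
  point. Both are continuous near the base points, so the zeros of \<open>F\<close> inherit the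
  local shape of the zeros of \<open>f\<close>.\<close>

lemma zero_set_local_structure:
  fixes F :: "real \<times> 'u::banach \<Rightarrow> 'v::banach"
  assumes F: "analytic_map_at F (l0, u0)" "F (l0, u0) = 0"
    and fred: "fredholm (D_u F l0 u0)" "fredholm_index (D_u F l0 u0) = 0" "dim (null_space (D_u F l0 u0)) \<in> {0, 1}"
  shows "edge_point (F -` {0}) (l0, u0) \<or> vertex_point (F -` {0}) (l0, u0) \<or> residual_point (F -` {0}) (l0, u0)"
proof -
  let ?A = "F -` {0}" and ?p = "(l0, u0)"
  obtain l :: "'u \<Rightarrow> real" and \<psi> K where l: "bounded_linear l" and K: "bounded_linear K"
    and KL: "\<forall>w. K (D_u F l0 u0 w + l w *\<^sub>R \<psi>) = w" and LK: "\<forall>v. D_u F l0 u0 (K v) + l (K v) *\<^sub>R \<psi> = v"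
    using fredholm_index_zero_bordered[OF fred] by (elim exE conjE) (rule that)
  obtain \<rho> R w where w: "\<rho> > 0" "R > 0" "pser \<rho> w R" "w (0, 0) = 0"
    and sol: "\<forall>z\<in>box2 \<rho>. \<forall>h. norm h \<le> R \<longrightarrow> (F (l0 + fst z, u0 + h) + l h *\<^sub>R \<psi> = snd z *\<^sub>R \<psi> \<longleftrightarrow> h = w z)"
    using bordered_implicit_function[OF F l K spec[OF KL] spec[OF LK]] by (elim exE conjE) (rule that)
  define \<Psi> where "\<Psi> z = (l0 + fst z, u0 + w z)" for z
  define f where "f z = snd z - l (w z)" for z
  \<comment> \<open>At a zero of \<open>F\<close> with displacement \<open>h\<close> from
    \<open>u0\<close>, the bordered equation holds with \<open>y = l h\<close>, whatever
    \<open>\<psi>\<close> is; hence the second coordinate.\<close>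
  define \<Phi> where "\<Phi> q = (fst q - l0, l (snd q - u0))" for q
  have gw: "germ w" by (rule germI[OF w(1,3)])
  have gf: "germ f" unfolding f_def[abs_def] by (rule germ_diff[OF germ_snd germ_linear[OF l gw]])
  have p\<Psi>: "\<exists>C. pser \<rho> \<Psi> C"
  proof -
    have 1: "pser \<rho> (\<lambda>z. (fst z, 0::'u)) (1 * \<rho>)"
      by (rule pser_linear[OF bounded_linear_Pair[OF bounded_linear_ident bounded_linear_zero] _ w(1) pser_fst])
        (use w(1) in simp_all)
    have 2: "pser \<rho> (\<lambda>z. (0::real, w z)) (1 * R)"
      by (rule pser_linear[OF bounded_linear_Pair[OF bounded_linear_zero bounded_linear_ident] _ w(1,3)]) simp_all
    from pser_add[OF w(1) pser_const[of \<rho> ?p] pser_add[OF w(1) 1 2]] show ?thesis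
      unfolding \<Psi>_def[abs_def] by (intro exI) simp
  qed
  then obtain C\<Psi> where p\<Psi>: "pser \<rho> \<Psi> C\<Psi>" ..
  have \<Psi>0: "\<Psi> (0,0) = ?p" by (simp add: \<Psi>_def w(4))
  have \<Psi>A: "\<Psi> z \<in> ?A" if "z \<in> box2 \<rho>" "f z = 0" for z
  proof -
    have "F (l0 + fst z, u0 + w z) + l (w z) *\<^sub>R \<psi> = snd z *\<^sub>R \<psi>"
      using sol that(1) pser_norm_le[OF w(3) that(1)] by simp
    then show ?thesis using that(2) by (simp add: \<Psi>_def f_def)
  qed
  have \<Phi>\<Psi>: "\<Phi> (\<Psi> z) = z" if "f z = 0" for z using that by (simp add: \<Phi>_def \<Psi>_def f_def prod_eq_iff)
  have cont\<Phi>: "continuous_on UNIV \<Phi>"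
    unfolding \<Phi>_def[abs_def] by (intro continuous_intros bounded_linear.continuous_on[OF l])
  \<comment> \<open>Zeros close to the point have small coordinates and satisfy the norm bound in
    the uniqueness statement \<open>sol\<close>, so they lie in the image of
    \<open>\<Psi>\<close>.\<close>
  have near: "\<exists>\<epsilon>>0. \<forall>q\<in>ball ?p \<epsilon> \<inter> ?A. \<bar>fst (\<Phi> q)\<bar> < \<delta> \<and> \<bar>snd (\<Phi> q)\<bar> < \<delta> \<and> f (\<Phi> q) = 0 \<and> \<Psi> (\<Phi> q) = q"
    if \<delta>: "\<delta> > 0" for \<delta>
  proof -
    have "\<Phi> ?p = (0, 0)" using linear_0[OF bounded_linear.linear[OF l]] by (simp add: \<Phi>_def)
    moreover have "isCont \<Phi> ?p" using cont\<Phi> by (simp add: continuous_on_eq_continuous_at)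
    ultimately have "(\<Phi> \<longlongrightarrow> (0,0)) (nhds ?p)" by (simp add: isCont_def tendsto_nhds_iff)
    moreover have "\<forall>\<^sub>F z in nhds (0,0). \<bar>fst z\<bar> < min \<delta> \<rho> \<and> \<bar>snd z\<bar> < min \<delta> \<rho>"
      unfolding eventually_nhds_zero2 using \<delta> w(1) by (intro exI[of _ "min \<delta> \<rho>"]) simp
    ultimately have "\<forall>\<^sub>F q in nhds ?p. \<bar>fst (\<Phi> q)\<bar> < min \<delta> \<rho> \<and> \<bar>snd (\<Phi> q)\<bar> < min \<delta> \<rho>"
      using filterlim_iff by blast
    then obtain e where e: "e > 0" "\<And>q. dist q ?p < e \<Longrightarrow> \<bar>fst (\<Phi> q)\<bar> < min \<delta> \<rho> \<and> \<bar>snd (\<Phi> q)\<bar> < min \<delta> \<rho>"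
      unfolding eventually_nhds_metric by blast
    show ?thesis
    proof (intro exI[of _ "min e R"] conjI[of "0 < min e R"] ballI)
      show "0 < min e R" using e(1) w(2) by simp
      fix q assume q: "q \<in> ball ?p (min e R) \<inter> ?A"
      have small: "\<bar>fst (\<Phi> q)\<bar> < min \<delta> \<rho> \<and> \<bar>snd (\<Phi> q)\<bar> < min \<delta> \<rho>"
        by (rule e(2)) (use q in \<open>simp add: dist_commute\<close>)
      then have box: "\<Phi> q \<in> box2 \<rho>" by (simp add: box2_def)
      have "norm (snd q - u0) \<le> dist q ?p"
        using norm_snd_le[of "snd q - u0" "fst q - l0"] by (cases q) (simp add: dist_norm)
      then have "norm (snd q - u0) \<le> R" using q by (simp add: dist_commute)
      moreover have "F (l0 + fst (\<Phi> q), u0 + (snd q - u0)) + l (snd q - u0) *\<^sub>R \<psi> = snd (\<Phi> q) *\<^sub>R \<psi>"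
        using q by (simp add: \<Phi>_def)
      ultimately have wq: "snd q - u0 = w (\<Phi> q)" using sol box by blast
      have "f (\<Phi> q) = 0" unfolding f_def wq[symmetric] by (simp add: \<Phi>_def)
      moreover have "\<Psi> (\<Phi> q) = q" unfolding \<Psi>_def wq[symmetric] by (simp add: \<Phi>_def)
      ultimately show "\<bar>fst (\<Phi> q)\<bar> < \<delta> \<and> \<bar>snd (\<Phi> q)\<bar> < \<delta> \<and> f (\<Phi> q) = 0 \<and> \<Psi> (\<Phi> q) = q" using small by simp
    qed
  qed
  show ?thesis
  proof (cases "\<forall>\<^sub>F z in nhds (0,0). f z = 0")
    case True
    then obtain d where d: "d > 0" "\<forall>x y. \<bar>x\<bar> < d \<longrightarrow> \<bar>y\<bar> < d \<longrightarrow> f (x, y) = 0"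
      unfolding eventually_nhds_zero2 by (elim exE conjE) (rule that)
    define \<delta> where "\<delta> = min d \<rho>"
    have \<delta>: "\<delta> > 0" "\<delta> \<le> d" "\<delta> \<le> \<rho>" using d(1) w(1) by (auto simp: \<delta>_def)
    obtain \<epsilon> where \<epsilon>: "\<epsilon> > 0" "\<forall>q\<in>ball ?p \<epsilon> \<inter> ?A. \<bar>fst (\<Phi> q)\<bar> < \<delta> \<and> \<bar>snd (\<Phi> q)\<bar> < \<delta> \<and> f (\<Phi> q) = 0 \<and> \<Psi> (\<Phi> q) = q"
      using near[OF \<delta>(1)] by (elim exE conjE) (rule that)
    define B where "B = {-\<delta><..<\<delta>} \<times> {-\<delta><..<\<delta>}"
    have B: "open B" unfolding B_def by (intro open_Times) auto
    have fB: "f z = 0" "z \<in> box2 \<rho>" "analytic_map_at \<Psi> z" if "z \<in> B" for z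
    proof -
      have z: "\<bar>fst z\<bar> < \<delta>" "\<bar>snd z\<bar> < \<delta>" using that unfolding B_def by (auto simp: mem_Times_iff)
      show "f z = 0" using d(2)[rule_format, of "fst z" "snd z"] z \<delta> by simp
      show "z \<in> box2 \<rho>" using z \<delta> by (simp add: box2_def)
      show "analytic_map_at \<Psi> z" using pser_imp_analytic_at[OF p\<Psi>, of "fst z" "snd z"] z \<delta> by simp
    qed
    have cont\<Psi>: "continuous_on B \<Psi>"
      by (rule analytic_map_on_imp_continuous_on) (simp add: analytic_map_on_def fB(3))
    \<comment> \<open>Only the part of the square mapped into the ball is kept, so that the image is
      all of \<open>ball ?p \<epsilon> \<inter> ?A\<close> and nothing more.\<close>
    define \<Omega> where "\<Omega> = B \<inter> \<Psi> -` ball ?p \<epsilon>"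
    have "open \<Omega>" unfolding \<Omega>_def by (rule continuous_open_preimage[OF cont\<Psi> B]) simp
    moreover have "analytic_map_on \<Psi> \<Omega>" unfolding analytic_map_on_def \<Omega>_def using fB(3) by simp
    moreover have "homeomorphism \<Omega> (ball ?p \<epsilon> \<inter> ?A) \<Psi> \<Phi>"
    proof (rule homeomorphismI)
      show "continuous_on \<Omega> \<Psi>" by (rule continuous_on_subset[OF cont\<Psi>]) (simp add: \<Omega>_def)
      show "continuous_on (ball ?p \<epsilon> \<inter> ?A) \<Phi>" by (rule continuous_on_subset[OF cont\<Phi>]) simp
      show "\<Psi> ` \<Omega> \<subseteq> ball ?p \<epsilon> \<inter> ?A"
      proof
        fix y assume "y \<in> \<Psi> ` \<Omega>"
        then obtain z where z: "z \<in> B" "\<Psi> z \<in> ball ?p \<epsilon>" "y = \<Psi> z" unfolding \<Omega>_def by blast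
        then show "y \<in> ball ?p \<epsilon> \<inter> ?A" using \<Psi>A[OF fB(2,1)[OF z(1)]] by blast
      qed
      show "\<Phi> ` (ball ?p \<epsilon> \<inter> ?A) \<subseteq> \<Omega>"
      proof
        fix z assume "z \<in> \<Phi> ` (ball ?p \<epsilon> \<inter> ?A)"
        then obtain q where q: "q \<in> ball ?p \<epsilon> \<inter> ?A" "z = \<Phi> q" by blast
        note Q = bspec[OF \<epsilon>(2) q(1)]
        have "z \<in> B" unfolding B_def q(2) using Q by (simp add: mem_Times_iff abs_less_iff)
        then show "z \<in> \<Omega>" using Q q unfolding \<Omega>_def by simp
      qed
      show "\<Phi> (\<Psi> z) = z" if "z \<in> \<Omega>" for z by (rule \<Phi>\<Psi>) (use that fB(1) in \<open>simp add: \<Omega>_def\<close>)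
      show "\<Psi> (\<Phi> q) = q" if "q \<in> ball ?p \<epsilon> \<inter> ?A" for q using bspec[OF \<epsilon>(2) that] by simp
    qed
    ultimately have "residual_point ?A ?p" unfolding residual_point_def using \<epsilon>(1)
      by (intro exI[of _ \<epsilon>] conjI exI[of _ \<Omega>] exI[of _ \<Psi>] exI[of _ \<Phi>])
    then show ?thesis by simp
  next
    case False
    obtain Cs where Cs: "finite Cs"
      "\<forall>c\<in>Cs. germ1 (\<lambda>t. fst (c t)) \<and> germ1 (\<lambda>t. snd (c t)) \<and> c 0 = (0,0) \<and>
        (\<exists>\<eta>>0. \<forall>t. 0 < t \<and> t < \<eta> \<longrightarrow> c t \<noteq> (0,0) \<and> f (c t) = 0)"
      "\<forall>\<eta>>0. \<exists>\<delta>>0. \<forall>x y. \<bar>x\<bar> < \<delta> \<and> \<bar>y\<bar> < \<delta> \<and> f (x, y) = 0 \<longrightarrow>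
        (x, y) = (0,0) \<or> (\<exists>c\<in>Cs. \<exists>t. 0 < t \<and> t < \<eta> \<and> c t = (x, y))"
      using plane_branches[OF gf False] by (elim exE conjE) (rule that)
    have "edge_point ?A ?p \<or> vertex_point ?A ?p"
    proof (rule edge_or_vertex_of_branches[where \<Gamma> = "(\<lambda>c t. \<Psi> (c t)) ` Cs"])
      show "?p \<in> ?A" using F(2) by simp
      show "finite ((\<lambda>c t. \<Psi> (c t)) ` Cs)" using Cs(1) by simp
      fix \<gamma> assume "\<gamma> \<in> (\<lambda>c t. \<Psi> (c t)) ` Cs"
      then obtain c where c: "c \<in> Cs" "\<gamma> = (\<lambda>t. \<Psi> (c t))" by blast
      have C: "germ1 (\<lambda>t. fst (c t))" "germ1 (\<lambda>t. snd (c t))" "c 0 = (0,0)"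
        "\<exists>\<eta>>0. \<forall>t. 0 < t \<and> t < \<eta> \<longrightarrow> c t \<noteq> (0,0) \<and> f (c t) = 0"
        using bspec[OF Cs(2) c(1)] by simp_all
      show "germ1 \<gamma>"
        using germ_comp[OF germI[OF w(1) p\<Psi>] C(1,2)] C(3) by (simp add: c(2))
      show "\<gamma> 0 = ?p" by (simp add: c(2) C(3) \<Psi>0)
      obtain \<eta> where \<eta>: "\<eta> > 0" "\<forall>t. 0 < t \<and> t < \<eta> \<longrightarrow> c t \<noteq> (0,0) \<and> f (c t) = 0"
        using C(4) by (elim exE conjE) (rule that)
      have "((\<lambda>t. fst (c t)) \<longlongrightarrow> fst (c 0)) (nhds 0)" "((\<lambda>t. snd (c t)) \<longlongrightarrow> snd (c 0)) (nhds 0)"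
        using germ1_isCont[OF C(1)] germ1_isCont[OF C(2)] by (simp_all add: isCont_def tendsto_nhds_iff)
      from eventually_conj[OF tendstoD[OF this(1) w(1)] tendstoD[OF this(2) w(1)]]
      have "\<forall>\<^sub>F t in nhds 0. c t \<in> box2 \<rho>"
        by (rule eventually_mono) (simp add: C(3) box2_def dist_norm)
      then obtain \<eta>' where \<eta>': "\<eta>' > 0" "\<forall>t. \<bar>t\<bar> < \<eta>' \<longrightarrow> c t \<in> box2 \<rho>"
        unfolding eventually_nhds_zero1 by (elim exE conjE) (rule that)
      show "\<exists>\<eta>>0. \<forall>t. 0 < t \<and> t < \<eta> \<longrightarrow> \<gamma> t \<noteq> ?p \<and> \<gamma> t \<in> ?A"
      proof (intro exI[of _ "min \<eta> \<eta>'"] conjI[of "0 < min \<eta> \<eta>'"] allI impI)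
        show "0 < min \<eta> \<eta>'" using \<eta>(1) \<eta>'(1) by simp
        fix t assume t: "0 < t \<and> t < min \<eta> \<eta>'"
        then have ct: "c t \<noteq> (0,0)" "f (c t) = 0" "c t \<in> box2 \<rho>" using \<eta>(2) \<eta>'(2) by simp_all
        \<comment> \<open>\<open>\<Phi>\<close> inverts \<open>\<Psi>\<close> on zeros of
          \<open>f\<close>, so the branch can meet the point only where \<open>c t\<close> is the
          origin.\<close>
        have "\<gamma> t \<noteq> ?p"
        proof
          assume "\<gamma> t = ?p"
          then have "\<Phi> (\<Psi> (c t)) = \<Phi> ?p" by (simp add: c(2))
          moreover have "\<Phi> ?p = (0,0)" using linear_0[OF bounded_linear.linear[OF l]] by (simp add: \<Phi>_def)
          ultimately show False using \<Phi>\<Psi>[OF ct(2)] ct(1) by simp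
        qed
        moreover have "\<gamma> t \<in> ?A" unfolding c(2) by (rule \<Psi>A[OF ct(3,2)])
        ultimately show "\<gamma> t \<noteq> ?p \<and> \<gamma> t \<in> ?A" ..
      qed
    next
      fix \<eta> :: real assume "\<eta> > 0"
      with Cs(3) obtain \<delta> where \<delta>: "\<delta> > 0" "\<forall>x y. \<bar>x\<bar> < \<delta> \<and> \<bar>y\<bar> < \<delta> \<and> f (x, y) = 0 \<longrightarrow>
        (x, y) = (0,0) \<or> (\<exists>c\<in>Cs. \<exists>t. 0 < t \<and> t < \<eta> \<and> c t = (x, y))" by blast
      obtain \<epsilon> where \<epsilon>: "\<epsilon> > 0" "\<forall>q\<in>ball ?p \<epsilon> \<inter> ?A. \<bar>fst (\<Phi> q)\<bar> < \<delta> \<and> \<bar>snd (\<Phi> q)\<bar> < \<delta> \<and> f (\<Phi> q) = 0 \<and> \<Psi> (\<Phi> q) = q"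
        using near[OF \<delta>(1)] by (elim exE conjE) (rule that)
      show "\<exists>\<epsilon>>0. ball ?p \<epsilon> \<inter> ?A \<subseteq> {?p} \<union> (\<Union>\<gamma>\<in>(\<lambda>c t. \<Psi> (c t)) ` Cs. \<gamma> ` {0<..<\<eta>})"
      proof (intro exI[of _ \<epsilon>] conjI \<epsilon>(1) subsetI)
        fix q assume "q \<in> ball ?p \<epsilon> \<inter> ?A"
        note Q = bspec[OF \<epsilon>(2) this]
        have "\<Phi> q = (0,0) \<or> (\<exists>c\<in>Cs. \<exists>t. 0 < t \<and> t < \<eta> \<and> c t = \<Phi> q)"
          using \<delta>(2)[rule_format, of "fst (\<Phi> q)" "snd (\<Phi> q)"] Q by simp
        then show "q \<in> {?p} \<union> (\<Union>\<gamma>\<in>(\<lambda>c t. \<Psi> (c t)) ` Cs. \<gamma> ` {0<..<\<eta>})"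
        proof
          assume "\<Phi> q = (0,0)"
          then have "q = ?p" using Q \<Psi>0 by simp
          then show ?thesis by simp
        next
          assume "\<exists>c\<in>Cs. \<exists>t. 0 < t \<and> t < \<eta> \<and> c t = \<Phi> q"
          then obtain c t where c: "c \<in> Cs" "0 < t" "t < \<eta>" "c t = \<Phi> q" by blast
          then have "q = (\<lambda>t. \<Psi> (c t)) t" using Q by simp
          then have "q \<in> (\<lambda>t. \<Psi> (c t)) ` {0<..<\<eta>}" by (rule image_eqI) (use c in simp)
          then show ?thesis using c(1) by blast
        qed
      qed
    qed
    then show ?thesis by blast
  qed
qed

theorem theorem7p4:
  fixes F :: "real \<times> 'u::banach \<Rightarrow> 'v::banach"
  assumes "analytic_map_on F UNIV"
    and F1: "\<And>l. F (l, 0) = 0"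
    and F2: "\<And>l u. fredholm (D_u F l u) \<and> fredholm_index (D_u F l u) = 0"
    and F3: "\<And>l u. dim (null_space (D_u F l u)) \<in> {0, 1}"
  shows "analytic_graph (F -` {0})"
proof -
  have an: "analytic_map_at F x" for x using assms(1) unfolding analytic_map_on_def by (rule bspec) (rule UNIV_I)
  have "closed (F -` {0})"
    by (rule continuous_closed_vimage) (simp_all add: analytic_map_at_imp_isCont[OF an])
  moreover have "F -` {0} \<noteq> {}" using F1[of 0] by auto
  moreover have "(edge_point (F -` {0}) q \<or> vertex_point (F -` {0}) q \<or> residual_point (F -` {0}) q) \<and>
      \<not> (edge_point (F -` {0}) q \<and> vertex_point (F -` {0}) q) \<and>
      \<not> (edge_point (F -` {0}) q \<and> residual_point (F -` {0}) q) \<and>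
      \<not> (vertex_point (F -` {0}) q \<and> residual_point (F -` {0}) q)" if q: "q \<in> F -` {0}" for q
  proof -
    obtain l u where lu: "q = (l, u)" by (cases q)
    have "edge_point (F -` {0}) q \<or> vertex_point (F -` {0}) q \<or> residual_point (F -` {0}) q"
      unfolding lu using q F2[of l u] F3[of l u] by (intro zero_set_local_structure an) (simp_all add: lu)
    moreover have "\<not> (edge_point (F -` {0}) q \<and> vertex_point (F -` {0}) q)" unfolding vertex_point_def by simp
    ultimately show ?thesis using edge_point_not_residual[OF _ q] vertex_point_not_residual[OF _ q] by simp
  qed
  ultimately show ?thesis unfolding analytic_graph_def by simp
qed

end
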